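(* Let $g\ge 2$. The generalized cone complex $T^{\mathrm{trop}}_g=\varinjlim(\sigma_{(G,P)},\iota_\gamma)$ satisfies: (1) its points are in natural bijection with isomorphism classes of pairs $(\Gamma,\theta)$, where $\Gamma$ is a tropical curve of genus $g$ and $\theta\in T^{\mathrm{trop}}_\Gamma$ (two pairs identified when $\Gamma\cong\Gamma'$ via an isomorphism carrying $\theta$ to $\theta'$), and there is a stratification $T^{\mathrm{trop}}_g=\bigsqcup_{[G,P]} T^{\mathrm{trop}}_{(G,P)}$ over isomorphism classes of pairs $(G,P)$ with $G$ a stable weighted graph of genus $g$ and $P\in\mathcal C_G$, modulo $\operatorname{Aut}(G)$; (2) $T^{\mathrm{trop}}_{(G,P)}\cong \sigma^o_{(G,P)}/\operatorname{Aut}(G,P)$; (3) $T^{\mathrm{trop}}_g$ is connected and of pure dimension $3g-3$; (4) $T^{\mathrm{trop}}_{(G',P')}\subseteq\overline{T^{\mathrm{trop}}_{(G,P)}}$ if and only if $(G,P)\ge(G',P')$.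
   Context: A stable weighted graph $(G,w)$, $G=(V,E)$ finite connected (loops and multiple edges allowed), has $w\colon V\to\mathbb Z_{\ge0}$ with $2w(v)-2+\deg(v)>0$; its genus is $\sum w(v)+|E|-|V|+1$. A tropical curve is $\Gamma=(G,w,\ell)$ with $(G,w)$ stable and $\ell\colon E\to\mathbb R_{>0}$; $T^{\mathrm{trop}}_\Gamma$ is its set of theta-characteristics (classes $[D]\in\operatorname{Pic}(\Gamma)$ with $[2D]=[K_\Gamma]$, $K_\Gamma=\sum_v(2w(v)-2+\deg(v))v$). $\mathcal C_G$ is the set of $P\subseteq E$ such that every vertex has even degree in $P$; for $P\in\mathcal C_G$ let $T_P=\sum_{v}(\frac{\deg_P(v)}2-1+w(v))v+\sum_{e\notin P}p_e$ ($p_e$ the mid-point of $e$); $P\mapsto[T_P]$ is a bijection $\mathcal C_G\to T^{\mathrm{trop}}_\Gamma$. For pairs $(G,P),(G',P')$ with $G,G'$ stable of genus $g$, write $(G,P)\ge(G',P')$ if there is a weighted edge contraction $\gamma\colon G\to G'$ (contracting a set of edges, so that $E(G')$ is identified with the non-contracted edges and weights are updated to preserve genus) with $P'=\gamma_*P$, the set of non-contracted edges of $P$. Let $\operatorname{Aut}(G,P)$ be the subgroup of $\operatorname{Aut}(G)$ (weight-preserving) fixing $P$. Consider the category whose objects are isomorphism classes of pairs $(G,P)$ and whose arrows are generated by such contractions and by elements of $\operatorname{Aut}(G,P)$. To $(G,P)$ associate the cone $\sigma_{(G,P)}=\mathbb R_{\ge0}^{E(G)}$ (integral structure $\mathbb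 Z^{E(G)}$), with interior $\sigma^o_{(G,P)}=\mathbb R^{E(G)}_{>0}$; to a contraction $\gamma$ the face inclusion $\iota_\gamma\colon\sigma_{(G',P')}\hookrightarrow\sigma_{(G,P)}$ onto the face where coordinates of contracted edges vanish; to an automorphism the induced coordinate permutation. $T^{\mathrm{trop}}_g$ is the colimit of this diagram; a point $\underline l\in\sigma^o_{(G,P)}$ corresponds to $(\Gamma,[T_P])$ with $\Gamma=(G,w,\ell)$, $\ell(e)=l_e$. $T^{\mathrm{trop}}_{(G,P)}$ denotes the set of isomorphism classes of pairs $(\Gamma,[T_P])$ with $\Gamma$ of combinatorial type $(G,w)$. *)

theory Defs
  imports "HOL-Analysis.Analysis"
begin

section \<open>Weighted graphs (loops and multiple edges allowed)\<close>

text \<open>Vertices and edges are natural numbers. An edge e in E has endpoints ends e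
(an ordered pair used only as an arbitrary orientation); wt is the weight function.\<close>

record sgraph =
  V :: "nat set"
  E :: "nat set"
  ends :: "nat \<Rightarrow> nat \<times> nat"
  wt :: "nat \<Rightarrow> nat"

text \<open>Degree of v in the edge set P (a loop counts twice).\<close>
definition degP :: "sgraph \<Rightarrow> nat set \<Rightarrow> nat \<Rightarrow> nat" where
  "degP G P v = card {e \<in> P. fst (ends G e) = v} + card {e \<in> P. snd (ends G e) = v}"

definition deg :: "sgraph \<Rightarrow> nat \<Rightarrow> nat" where
  "deg G v = degP G (E G) v"

text \<open>Adjacency relation induced by an edge set.\<close>
definition adj :: "sgraph \<Rightarrow> nat set \<Rightarrow> (nat \<times> nat) set" where
  "adj G F = {(fst (ends G e), snd (ends G e)) | e. e \<in> F}
           \<union> {(snd (ends G e), fst (ends G e)) | e. e \<in> F}"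

definition stable_graph :: "sgraph \<Rightarrow> bool" where
  "stable_graph G \<longleftrightarrow> finite (V G) \<and> finite (E G) \<and> V G \<noteq> {} \<and>
     (\<forall>e \<in> E G. fst (ends G e) \<in> V G \<and> snd (ends G e) \<in> V G) \<and>
     (\<forall>u \<in> V G. \<forall>v \<in> V G. (u, v) \<in> (adj G (E G))\<^sup>*) \<and>
     (\<forall>v \<in> V G. 2 * int (wt G v) - 2 + int (deg G v) > 0)"

definition genus :: "sgraph \<Rightarrow> int" where
  "genus G = (\<Sum>v \<in> V G. int (wt G v)) + int (card (E G)) - int (card (V G)) + 1"

text \<open>The set C_G: subsets of edges with every vertex of even degree.\<close>
definition cyc :: "sgraph \<Rightarrow> nat set \<Rightarrow> bool" where
  "cyc G P \<longleftrightarrow> P \<subseteq> E G \<and> (\<forall>v \<in> V G. even (degP G P v))"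

text \<open>Objects: pairs (G,P), G stable of genus g, P in C_G.\<close>
definition Obj :: "nat \<Rightarrow> (sgraph \<times> nat set) set" where
  "Obj g = {(G, P). stable_graph G \<and> genus G = int g \<and> cyc G P}"

section \<open>Weighted edge contractions (up to isomorphism)\<close>

text \<open>contr G P G' P' S phi psi: G' is (isomorphic to) the weighted contraction of G
along the edge set S; phi sends vertices of G to the vertex of G' they are
contracted to, psi identifies the non-contracted edges with E G'.  With S = {}
this is exactly an isomorphism of pairs.\<close>
definition contr :: "sgraph \<Rightarrow> nat set \<Rightarrow> sgraph \<Rightarrow> nat set \<Rightarrow> nat set
                     \<Rightarrow> (nat \<Rightarrow> nat) \<Rightarrow> (nat \<Rightarrow> nat) \<Rightarrow> bool" where
  "contr G P G' P' S \<phi> \<psi> \<longleftrightarrow>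
     S \<subseteq> E G \<and> \<phi> ` V G = V G' \<and> bij_betw \<psi> (E G - S) (E G') \<and>
     (\<forall>e \<in> S. \<phi> (fst (ends G e)) = \<phi> (snd (ends G e))) \<and>
     (\<forall>e \<in> E G - S. ends G' (\<psi> e) = (\<phi> (fst (ends G e)), \<phi> (snd (ends G e)))
                   \<or> ends G' (\<psi> e) = (\<phi> (snd (ends G e)), \<phi> (fst (ends G e)))) \<and>
     (\<forall>v' \<in> V G'.
        (let F = {v \<in> V G. \<phi> v = v'};
             SF = {e \<in> S. \<phi> (fst (ends G e)) = v'}
         in (\<forall>u \<in> F. \<forall>v \<in> F. (u, v) \<in> (adj G SF)\<^sup>*) \<and>
            int (wt G' v') = (\<Sum>v \<in> F. int (wt G v)) + int (card SF) - int (card F) + 1)) \<and>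
     P' = \<psi> ` (P - S)"

definition pair_ge :: "sgraph \<times> nat set \<Rightarrow> sgraph \<times> nat set \<Rightarrow> bool" where
  "pair_ge GP GP' \<longleftrightarrow> (\<exists>S \<phi> \<psi>. contr (fst GP) (snd GP) (fst GP') (snd GP') S \<phi> \<psi>)"

definition pair_iso :: "sgraph \<times> nat set \<Rightarrow> sgraph \<times> nat set \<Rightarrow> bool" where
  "pair_iso GP GP' \<longleftrightarrow> (\<exists>\<phi> \<psi>. contr (fst GP) (snd GP) (fst GP') (snd GP') {} \<phi> \<psi>)"

section \<open>Cones and the generalized cone complex\<close>

definition cone :: "sgraph \<Rightarrow> (nat \<Rightarrow> real) set" where
  "cone G = {x. (\<forall>e. 0 \<le> x e) \<and> (\<forall>e. e \<notin> E G \<longrightarrow> x e = 0)}"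

definition cone_int :: "sgraph \<Rightarrow> (nat \<Rightarrow> real) set" where
  "cone_int G = {x. (\<forall>e \<in> E G. 0 < x e) \<and> (\<forall>e. e \<notin> E G \<longrightarrow> x e = 0)}"

text \<open>The face map iota_gamma : sigma_(G',P') -> sigma_(G,P).\<close>
definition iota :: "sgraph \<Rightarrow> nat set \<Rightarrow> (nat \<Rightarrow> nat) \<Rightarrow> (nat \<Rightarrow> real) \<Rightarrow> (nat \<Rightarrow> real)" where
  "iota G S \<psi> x' = (\<lambda>e. if e \<in> E G - S then x' (\<psi> e) else 0)"

type_synonym cpt = "(sgraph \<times> nat set) \<times> (nat \<Rightarrow> real)"

text \<open>Disjoint union of the cones (each with its Euclidean topology).\<close>
definition sumtop :: "nat \<Rightarrow> cpt topology" where
  "sumtop g = sum_topology (\<lambda>GP. subtopology euclidean (cone (fst GP))) (Obj g)"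

text \<open>Generating relation of the colimit: a point of a face is identified with its
image under the face map (contractions, including isomorphisms/automorphisms).\<close>
definition gen_rel :: "nat \<Rightarrow> (cpt \<times> cpt) set" where
  "gen_rel g = {(((G', P'), x'), ((G, P), iota G S \<psi> x')) | G P G' P' S \<phi> \<psi> x'.
      (G, P) \<in> Obj g \<and> (G', P') \<in> Obj g \<and> contr G P G' P' S \<phi> \<psi> \<and> x' \<in> cone G'}"

definition ceq :: "nat \<Rightarrow> (cpt \<times> cpt) set" where
  "ceq g = (gen_rel g \<union> (gen_rel g)\<inverse>)\<^sup>*"

definition cls :: "nat \<Rightarrow> cpt \<Rightarrow> cpt set" where
  "cls g a = ceq g `` {a}"

text \<open>Points of T_g^trop.\<close>
definition Tg :: "nat \<Rightarrow> cpt set set" where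
  "Tg g = topspace (sumtop g) // ceq g"

text \<open>Colimit (quotient) topology: U open iff its preimage is open.\<close>
definition Ttop :: "nat \<Rightarrow> cpt set topology" where
  "Ttop g = topology_generated_by {U. U \<subseteq> Tg g \<and> openin (sumtop g) (\<Union>U)}"

text \<open>The stratum T_(G,P) (image of the open cone).\<close>
definition strat :: "nat \<Rightarrow> sgraph \<Rightarrow> nat set \<Rightarrow> cpt set set" where
  "strat g G P = {cls g ((G, P), x) | x. x \<in> cone_int G}"

section \<open>Tropical curves, divisors, theta characteristics\<close>

type_synonym tcurve = "sgraph \<times> (nat \<Rightarrow> real)"

definition trop_curve :: "nat \<Rightarrow> tcurve \<Rightarrow> bool" where
  "trop_curve g \<Gamma> \<longleftrightarrow> stable_graph (fst \<Gamma>) \<and> genus (fst \<Gamma>) = int g \<and>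
     (\<forall>e \<in> E (fst \<Gamma>). snd \<Gamma> e > 0)"

text \<open>Points of the metric graph: vertices, and interior points of edges at
distance t from the first endpoint of the edge.\<close>
datatype tpt = Vt nat | Ep nat real

definition pts :: "tcurve \<Rightarrow> tpt set" where
  "pts \<Gamma> = Vt ` V (fst \<Gamma>) \<union> {Ep e t | e t. e \<in> E (fst \<Gamma>) \<and> 0 < t \<and> t < snd \<Gamma> e}"

definition Div :: "tcurve \<Rightarrow> (tpt \<Rightarrow> int) set" where
  "Div \<Gamma> = {D. finite {p. D p \<noteq> 0} \<and> {p. D p \<noteq> 0} \<subseteq> pts \<Gamma>}"

text \<open>Restriction of a function on Gamma to the edge e, parametrised by [0, l e].\<close>
definition fedge :: "tcurve \<Rightarrow> (tpt \<Rightarrow> real) \<Rightarrow> nat \<Rightarrow> real \<Rightarrow> real" where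
  "fedge \<Gamma> f e t = (if t = 0 then f (Vt (fst (ends (fst \<Gamma>) e)))
                    else if t = snd \<Gamma> e then f (Vt (snd (ends (fst \<Gamma>) e)))
                    else f (Ep e t))"

text \<open>Continuous piecewise linear with finitely many pieces and integer slopes on [0,L].\<close>
definition pl_int :: "(real \<Rightarrow> real) \<Rightarrow> real \<Rightarrow> bool" where
  "pl_int h L \<longleftrightarrow> (\<exists>n::nat. \<exists>t::nat \<Rightarrow> real. t 0 = 0 \<and> t n = L \<and>
      (\<forall>i < n. t i < t (Suc i)) \<and>
      (\<forall>i < n. \<exists>m::int. \<exists>c::real. \<forall>s \<in> {t i .. t (Suc i)}. h s = of_int m * s + c))"

definition rational_fun :: "tcurve \<Rightarrow> (tpt \<Rightarrow> real) \<Rightarrow> bool" where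
  "rational_fun \<Gamma> f \<longleftrightarrow> (\<forall>e \<in> E (fst \<Gamma>). pl_int (fedge \<Gamma> f e) (snd \<Gamma> e))"

text \<open>Outgoing slopes in the increasing and decreasing directions.\<close>
definition rslope :: "(real \<Rightarrow> real) \<Rightarrow> real \<Rightarrow> real" where
  "rslope h s = Lim (at_right 0) (\<lambda>u. (h (s + u) - h s) / u)"

definition lslope :: "(real \<Rightarrow> real) \<Rightarrow> real \<Rightarrow> real" where
  "lslope h s = Lim (at_right 0) (\<lambda>u. (h (s - u) - h s) / u)"

text \<open>ord_p(f): sum of the outgoing slopes of f at p.\<close>
definition ordf :: "tcurve \<Rightarrow> (tpt \<Rightarrow> real) \<Rightarrow> tpt \<Rightarrow> real" where
  "ordf \<Gamma> f p = (case p of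
      Vt v \<Rightarrow> (\<Sum>e \<in> {e \<in> E (fst \<Gamma>). fst (ends (fst \<Gamma>) e) = v}. rslope (fedge \<Gamma> f e) 0)
            + (\<Sum>e \<in> {e \<in> E (fst \<Gamma>). snd (ends (fst \<Gamma>) e) = v}. lslope (fedge \<Gamma> f e) (snd \<Gamma> e))
    | Ep e t \<Rightarrow> rslope (fedge \<Gamma> f e) t + lslope (fedge \<Gamma> f e) t)"

definition lin_equiv :: "tcurve \<Rightarrow> (tpt \<Rightarrow> int) \<Rightarrow> (tpt \<Rightarrow> int) \<Rightarrow> bool" where
  "lin_equiv \<Gamma> D D' \<longleftrightarrow> D \<in> Div \<Gamma> \<and> D' \<in> Div \<Gamma> \<and>
     (\<exists>f. rational_fun \<Gamma> f \<and> (\<forall>p \<in> pts \<Gamma>. of_int (D p - D' p) = ordf \<Gamma> f p))"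

text \<open>The class [D] in Pic(Gamma).\<close>
definition pic_cls :: "tcurve \<Rightarrow> (tpt \<Rightarrow> int) \<Rightarrow> (tpt \<Rightarrow> int) set" where
  "pic_cls \<Gamma> D = {D'. lin_equiv \<Gamma> D' D}"

definition canon :: "tcurve \<Rightarrow> tpt \<Rightarrow> int" where
  "canon \<Gamma> p = (case p of
      Vt v \<Rightarrow> if v \<in> V (fst \<Gamma>) then 2 * int (wt (fst \<Gamma>) v) - 2 + int (deg (fst \<Gamma>) v) else 0
    | Ep e t \<Rightarrow> 0)"

definition theta_chars :: "tcurve \<Rightarrow> (tpt \<Rightarrow> int) set set" where
  "theta_chars \<Gamma> = {pic_cls \<Gamma> D | D. D \<in> Div \<Gamma> \<and> lin_equiv \<Gamma> (\<lambda>p. 2 * D p) (canon \<Gamma>)}"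

text \<open>The divisor T_P.\<close>
definition TP :: "tcurve \<Rightarrow> nat set \<Rightarrow> tpt \<Rightarrow> int" where
  "TP \<Gamma> P p = (case p of
      Vt v \<Rightarrow> if v \<in> V (fst \<Gamma>) then int (degP (fst \<Gamma>) P v) div 2 - 1 + int (wt (fst \<Gamma>) v) else 0
    | Ep e t \<Rightarrow> if e \<in> E (fst \<Gamma>) - P \<and> t = snd \<Gamma> e / 2 then 1 else 0)"

text \<open>Isomorphisms of tropical curves: vertex bijection, edge bijection and, for
each edge, whether its orientation is reversed; they preserve weights and lengths.\<close>
definition tc_iso :: "tcurve \<Rightarrow> tcurve \<Rightarrow> (nat \<Rightarrow> nat) \<Rightarrow> (nat \<Rightarrow> nat) \<Rightarrow> (nat \<Rightarrow> bool) \<Rightarrow> bool" where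
  "tc_iso \<Gamma> \<Gamma>' \<phi> \<psi> \<sigma> \<longleftrightarrow>
     bij_betw \<phi> (V (fst \<Gamma>)) (V (fst \<Gamma>')) \<and> bij_betw \<psi> (E (fst \<Gamma>)) (E (fst \<Gamma>')) \<and>
     (\<forall>v \<in> V (fst \<Gamma>). wt (fst \<Gamma>') (\<phi> v) = wt (fst \<Gamma>) v) \<and>
     (\<forall>e \<in> E (fst \<Gamma>). snd \<Gamma>' (\<psi> e) = snd \<Gamma> e \<and>
        ends (fst \<Gamma>') (\<psi> e) = (if \<sigma> e then prod.swap else id)
                                   (map_prod \<phi> \<phi> (ends (fst \<Gamma>) e)))"

definition ptmap :: "tcurve \<Rightarrow> (nat \<Rightarrow> nat) \<Rightarrow> (nat \<Rightarrow> nat) \<Rightarrow> (nat \<Rightarrow> bool) \<Rightarrow> tpt \<Rightarrow> tpt" where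
  "ptmap \<Gamma> \<phi> \<psi> \<sigma> p = (case p of
      Vt v \<Rightarrow> Vt (\<phi> v)
    | Ep e t \<Rightarrow> Ep (\<psi> e) (if \<sigma> e then snd \<Gamma> e - t else t))"

text \<open>(Gamma,theta) and (Gamma',theta') are isomorphic: an isomorphism carrying theta to theta'.\<close>
definition tc_pair_rel :: "((tcurve \<times> (tpt \<Rightarrow> int) set) \<times> (tcurve \<times> (tpt \<Rightarrow> int) set)) set" where
  "tc_pair_rel = {((\<Gamma>, \<theta>), (\<Gamma>', \<theta>')) | \<Gamma> \<theta> \<Gamma>' \<theta>'. \<exists>\<phi> \<psi> \<sigma>. tc_iso \<Gamma> \<Gamma>' \<phi> \<psi> \<sigma> \<and>
      \<theta>' = {D' \<in> Div \<Gamma>'. \<exists>D \<in> \<theta>. \<forall>p \<in> pts \<Gamma>. D' (ptmap \<Gamma> \<phi> \<psi> \<sigma> p) = D p}}"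

text \<open>Isomorphism classes of pairs (Gamma, theta), Gamma of genus g.\<close>
definition TC :: "nat \<Rightarrow> (tcurve \<times> (tpt \<Rightarrow> int) set) set set" where
  "TC g = {(\<Gamma>, \<theta>). trop_curve g \<Gamma> \<and> \<theta> \<in> theta_chars \<Gamma>} // tc_pair_rel"

end

theory Submission
  imports Defs
begin

text \<open>
  Every point of the disjoint union of the cones is the image, under a face map, of a point in the
  interior of some cone (contract the edges of length zero), and two contractions of a graph along
  the same edges differ by an isomorphism. Hence two points become equal in the colimit exactly when
  their interior representatives are isomorphic; this gives the stratification and the description
  of the strata. Contractions compose and factor, so the set of points whose graph contracts to
  \<open>(G, P)\<close> with prescribed remaining lengths in an open set is an open union of classes; such stars
  yield the quotient topology on the strata and the closure relations. All cones share the point of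
  the one-vertex graph of weight \<open>g\<close>, which gives connectedness. A graph with fewer than \<open>3 g - 3\<close>
  edges can be expanded by trading a unit of weight for a loop or by splitting a vertex of valence
  at least four, the parity of \<open>P\<close> at the new vertex deciding whether the new edge belongs to \<open>P\<close>.

  The distance to the vertices, measured along the edges outside a cycle \<open>P\<close>, has divisor
  \<open>K - 2 T_P\<close>. If \<open>div f = 2 D - K\<close>, the slopes of \<open>f\<close> have constant parity on each edge, and the
  edges of even slope form a cycle \<open>P\<close> with \<open>D \<sim> T_P\<close>. Conversely \<open>T_P \<sim> T_P'\<close> forces \<open>P = P'\<close>,
  since a function with zero divisor has zero energy, hence zero slopes.
\<close>

section \<open>Graphs\<close>

definition endpoints :: "sgraph \<Rightarrow> nat \<Rightarrow> nat set" where
  "endpoints G e = {fst (ends G e), snd (ends G e)}"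

definition wf_graph :: "sgraph \<Rightarrow> bool" where
  "wf_graph G \<longleftrightarrow> finite (V G) \<and> finite (E G) \<and> (\<forall>e \<in> E G. endpoints G e \<subseteq> V G)"

lemma wf_graphD:
  assumes "wf_graph G"
  shows "finite (V G)" "finite (E G)" "e \<in> E G \<Longrightarrow> endpoints G e \<subseteq> V G"
  using assms by (auto simp: wf_graph_def)

lemma endpoints_eq_doubleton_iff:
  "endpoints G e = {u, v} \<longleftrightarrow> ends G e = (u, v) \<or> ends G e = (v, u)"
  by (cases "ends G e") (auto simp: endpoints_def doubleton_eq_iff)

lemma adj_iff: "(u, v) \<in> adj G F \<longleftrightarrow> (\<exists>e \<in> F. endpoints G e = {u, v})"
  by (force simp: adj_def endpoints_eq_doubleton_iff prod_eq_iff)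

lemma adj_rtrancl_mono: "F \<subseteq> F' \<Longrightarrow> (adj G F)\<^sup>* \<subseteq> (adj G F')\<^sup>*"
  by (rule rtrancl_mono) (auto simp: adj_def)

definition connected_graph :: "sgraph \<Rightarrow> bool" where
  "connected_graph G \<longleftrightarrow> V G \<noteq> {} \<and> (\<forall>u \<in> V G. \<forall>v \<in> V G. (u, v) \<in> (adj G (E G))\<^sup>*)"

text \<open>The half-edges of \<open>e\<close> are \<open>(e, False)\<close> at its first and \<open>(e, True)\<close> at its second end.\<close>

definition origin :: "sgraph \<Rightarrow> nat \<times> bool \<Rightarrow> nat" where
  "origin G h = (if snd h then snd (ends G (fst h)) else fst (ends G (fst h)))"

definition half_edges :: "sgraph \<Rightarrow> nat set \<Rightarrow> nat \<Rightarrow> (nat \<times> bool) set" where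
  "half_edges G P v = {h \<in> P \<times> UNIV. origin G h = v}"

lemma endpoints_eq_origins: "endpoints G e = range (\<lambda>b. origin G (e, b))"
  by (auto simp: endpoints_def origin_def image_iff)

lemma endpoints_image_iff:
  "endpoints G' e' = \<phi> ` endpoints G e \<longleftrightarrow>
     (\<exists>s. \<forall>b. origin G' (e', if s then \<not> b else b) = \<phi> (origin G (e, b)))"
  unfolding endpoints_eq_origins
  by (auto simp: UNIV_bool doubleton_eq_iff ex_bool_eq all_bool_eq)

lemma origin_in_V: "wf_graph G \<Longrightarrow> e \<in> E G \<Longrightarrow> origin G (e, b) \<in> V G"
  using wf_graphD(3) unfolding endpoints_eq_origins by blast

lemma finite_half_edges: "finite P \<Longrightarrow> finite (half_edges G P v)"
  unfolding half_edges_def by (rule finite_subset[of _ "P \<times> UNIV"]) auto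

lemma sum_half_edges:
  fixes f :: "nat \<times> bool \<Rightarrow> 'a::comm_monoid_add"
  assumes "finite P"
  shows "(\<Sum>h \<in> half_edges G P v. f h) = (\<Sum>e \<in> {e \<in> P. fst (ends G e) = v}. f (e, False))
     + (\<Sum>e \<in> {e \<in> P. snd (ends G e) = v}. f (e, True))"
proof -
  let ?at = "\<lambda>b. (\<lambda>e. (e, b)) ` {e \<in> P. origin G (e, b) = v}"
  have "half_edges G P v = ?at False \<union> ?at True"
    by (auto simp: half_edges_def UNIV_bool)
  then have "(\<Sum>h \<in> half_edges G P v. f h) = (\<Sum>h \<in> ?at False. f h) + (\<Sum>h \<in> ?at True. f h)"
    using assms by (simp only:) (intro sum.union_disjoint; auto)
  then show ?thesis by (simp add: sum.reindex inj_on_def origin_def)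
qed

lemma degP_eq_card_half_edges:
  assumes "finite P"
  shows "degP G P v = card (half_edges G P v)"
  using sum_half_edges[OF assms, of "\<lambda>_. 1::nat" G v] by (simp add: degP_def)

definition half_edge_map :: "(nat \<Rightarrow> nat) \<Rightarrow> (nat \<Rightarrow> bool) \<Rightarrow> nat \<times> bool \<Rightarrow> nat \<times> bool" where
  "half_edge_map \<psi> \<sigma> = (\<lambda>(e, b). (\<psi> e, if \<sigma> e then \<not> b else b))"

lemma inj_on_half_edge_map: "inj_on \<psi> F \<Longrightarrow> inj_on (half_edge_map \<psi> \<sigma>) (F \<times> UNIV)"
  by (auto simp: inj_on_def half_edge_map_def split: if_splits)

lemma half_edges_image:
  assumes origin: "\<And>h. h \<in> F \<times> UNIV \<Longrightarrow> origin G' (half_edge_map \<psi> \<sigma> h) = \<phi> (origin G h)"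
  shows "half_edges G' (\<psi> ` F) w = half_edge_map \<psi> \<sigma> ` {h \<in> F \<times> UNIV. \<phi> (origin G h) = w}"
proof -
  have "(\<psi> e, b) = half_edge_map \<psi> \<sigma> (e, if \<sigma> e then \<not> b else b)" for e b
    by (simp add: half_edge_map_def)
  then have "\<psi> ` F \<times> UNIV \<subseteq> half_edge_map \<psi> \<sigma> ` (F \<times> UNIV)" by blast
  then have "\<psi> ` F \<times> UNIV = half_edge_map \<psi> \<sigma> ` (F \<times> UNIV)" by (auto simp: half_edge_map_def)
  then have "half_edges G' (\<psi> ` F) w = {h' \<in> half_edge_map \<psi> \<sigma> ` (F \<times> UNIV). origin G' h' = w}"
    by (simp add: half_edges_def)
  also have "\<dots> = half_edge_map \<psi> \<sigma> ` {h \<in> F \<times> UNIV. origin G' (half_edge_map \<psi> \<sigma> h) = w}" by blast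
  also have "{h \<in> F \<times> UNIV. origin G' (half_edge_map \<psi> \<sigma> h) = w}
      = {h \<in> F \<times> UNIV. \<phi> (origin G h) = w}"
    using origin by auto
  finally show ?thesis .
qed

lemma degP_Diff:
  assumes "finite F" "P \<subseteq> F"
  shows "degP G F v = degP G P v + degP G (F - P) v"
proof -
  have "half_edges G F v = half_edges G P v \<union> half_edges G (F - P) v"
    using assms(2) by (auto simp: half_edges_def)
  moreover have "half_edges G P v \<inter> half_edges G (F - P) v = {}" by (auto simp: half_edges_def)
  ultimately show ?thesis
    using assms finite_subset[OF assms(2,1)]
    by (simp add: degP_eq_card_half_edges card_Un_disjoint finite_half_edges)
qed

lemma sum_half_edges_group:
  fixes f :: "nat \<times> bool \<Rightarrow> 'a::comm_monoid_add"
  assumes "finite P" "finite W"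
  shows "(\<Sum>v \<in> W. \<Sum>h \<in> half_edges G P v. f h) = (\<Sum>h \<in> {h \<in> P \<times> UNIV. origin G h \<in> W}. f h)"
proof -
  let ?H = "{h \<in> P \<times> UNIV. origin G h \<in> W}"
  have "finite ?H" using assms(1) by (simp add: finite_subset[of _ "P \<times> UNIV"] Collect_restrict)
  then have "(\<Sum>v \<in> W. \<Sum>h \<in> {h \<in> ?H. origin G h = v}. f h) = (\<Sum>h \<in> ?H. f h)"
    using assms(2) by (rule sum.group) auto
  moreover have "{h \<in> ?H. origin G h = v} = half_edges G P v" if "v \<in> W" for v
    using that by (auto simp: half_edges_def)
  ultimately show ?thesis by simp
qed

lemma sum_all_half_edges:
  assumes "wf_graph G"
  shows "(\<Sum>v \<in> V G. \<Sum>h \<in> half_edges G (E G) v. f h) = (\<Sum>e \<in> E G. f (e, False) + f (e, True))"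
proof -
  have "{h \<in> E G \<times> UNIV. origin G h \<in> V G} = E G \<times> UNIV"
    using origin_in_V[OF assms] by auto
  then show ?thesis
    using sum_half_edges_group[of "E G" "V G" f G] wf_graphD[OF assms]
    by (simp add: sum.cartesian_product' UNIV_bool add.commute)
qed

lemma sum_degP:
  assumes "finite P" "finite W"
  shows "(\<Sum>v \<in> W. degP G P v) = card {h \<in> P \<times> UNIV. origin G h \<in> W}"
  using sum_half_edges_group[OF assms, of "\<lambda>_. 1::nat"] assms(1)
  by (simp add: degP_eq_card_half_edges)

text \<open>The genus of a subgraph minus one, which unlike the genus is additive over disjoint unions.\<close>

definition reduced_genus :: "sgraph \<Rightarrow> nat set \<Rightarrow> nat set \<Rightarrow> int" where
  "reduced_genus G F W = (\<Sum>v \<in> W. int (wt G v) - 1) + int (card {e \<in> F. endpoints G e \<subseteq> W})"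

lemma genus_eq_reduced_genus:
  assumes "wf_graph G"
  shows "genus G = reduced_genus G (E G) (V G) + 1"
proof -
  have "{e \<in> E G. endpoints G e \<subseteq> V G} = E G" using wf_graphD(3)[OF assms] by auto
  then show ?thesis by (simp add: genus_def reduced_genus_def sum_subtractf)
qed

definition canon_deg :: "sgraph \<Rightarrow> nat \<Rightarrow> int" where
  "canon_deg G v = 2 * int (wt G v) - 2 + int (deg G v)"

lemma sum_canon_deg_eq:
  "(\<Sum>v \<in> W. canon_deg G v) = 2 * (\<Sum>v \<in> W. int (wt G v) - 1) + int (\<Sum>v \<in> W. deg G v)"
  unfolding canon_deg_def sum_distrib_left of_nat_sum sum.distrib[symmetric]
  by (intro sum.cong) auto

lemma sum_canon_deg:
  assumes "wf_graph G"
  shows "(\<Sum>v \<in> V G. canon_deg G v) = 2 * genus G - 2"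
proof -
  have "{h \<in> E G \<times> UNIV. origin G h \<in> V G} = E G \<times> (UNIV :: bool set)"
    using origin_in_V[OF assms] by auto
  then have "(\<Sum>v \<in> V G. deg G v) = 2 * card (E G)"
    using sum_degP[of "E G" "V G" G] wf_graphD[OF assms]
    by (simp add: deg_def card_cartesian_product)
  then show ?thesis by (simp add: sum_canon_deg_eq genus_def sum_subtractf)
qed

lemma stable_graph_iff:
  "stable_graph G \<longleftrightarrow> wf_graph G \<and> connected_graph G \<and> (\<forall>v \<in> V G. 0 < canon_deg G v)"
  by (auto simp: stable_graph_def wf_graph_def connected_graph_def canon_deg_def endpoints_def)

lemma ObjD:
  assumes "(G, P) \<in> Obj g"
  shows "wf_graph G" "connected_graph G" "v \<in> V G \<Longrightarrow> 0 < canon_deg G v" "genus G = int g" "cyc G P"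
    "P \<subseteq> E G" "finite (V G)" "finite (E G)"
  using assms by (auto simp: Obj_def stable_graph_iff cyc_def dest: wf_graphD)

lemma ObjI:
  assumes "wf_graph G" "connected_graph G" "\<And>v. v \<in> V G \<Longrightarrow> 0 < canon_deg G v"
    "genus G = int g" "cyc G P"
  shows "(G, P) \<in> Obj g"
  using assms by (simp add: Obj_def stable_graph_iff)

section \<open>Contractions\<close>

lemma path_in_fibre:
  assumes collapsed: "\<And>e. e \<in> S \<Longrightarrow> \<exists>w. \<phi> ` endpoints G e = {w}" and path: "(u, v) \<in> (adj G S)\<^sup>*"
  shows "\<phi> v = \<phi> u \<and> (u, v) \<in> (adj G {e \<in> S. \<phi> ` endpoints G e = {\<phi> u}})\<^sup>*"
  using path
proof (induction rule: rtrancl_induct)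
  case (step y z)
  obtain e where e: "e \<in> S" "endpoints G e = {y, z}" using step.hyps(2) by (auto simp: adj_iff)
  obtain w where "\<phi> ` endpoints G e = {w}" using collapsed[OF e(1)] by blast
  then have "\<phi> z = \<phi> u" "\<phi> ` endpoints G e = {\<phi> u}" using e(2) step.IH by auto
  moreover from this have "(y, z) \<in> adj G {e \<in> S. \<phi> ` endpoints G e = {\<phi> u}}"
    using e by (auto simp: adj_iff)
  ultimately show ?case using step.IH by (auto intro: rtrancl_into_rtrancl)
qed simp

lemma contr_iff:
  assumes wf: "wf_graph G"
  shows "contr G P G' P' S \<phi> \<psi> \<longleftrightarrow>
     S \<subseteq> E G \<and> \<phi> ` V G = V G' \<and> bij_betw \<psi> (E G - S) (E G') \<and>
     (\<forall>e \<in> S. \<exists>w. \<phi> ` endpoints G e = {w}) \<and>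
     (\<forall>e \<in> E G - S. endpoints G' (\<psi> e) = \<phi> ` endpoints G e) \<and>
     (\<forall>u \<in> V G. \<forall>v \<in> V G. \<phi> u = \<phi> v \<longrightarrow> (u, v) \<in> (adj G S)\<^sup>*) \<and>
     (\<forall>w \<in> V G'. int (wt G' w) - 1 = reduced_genus G S {v \<in> V G. \<phi> v = w}) \<and>
     P' = \<psi> ` (P - S)"
proof -
  have collapsed: "(\<phi> (fst (ends G e)) = \<phi> (snd (ends G e))) \<longleftrightarrow> (\<exists>w. \<phi> ` endpoints G e = {w})" for e
    by (auto simp: endpoints_def)
  have kept: "ends G' (\<psi> e) = (\<phi> (fst (ends G e)), \<phi> (snd (ends G e))) \<or>
      ends G' (\<psi> e) = (\<phi> (snd (ends G e)), \<phi> (fst (ends G e))) \<longleftrightarrow>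
      endpoints G' (\<psi> e) = \<phi> ` endpoints G e" for e
    by (simp add: endpoints_eq_doubleton_iff endpoints_def[of G])
  show ?thesis
  proof (cases "S \<subseteq> E G \<and> \<phi> ` V G = V G' \<and> (\<forall>e \<in> S. \<exists>w. \<phi> ` endpoints G e = {w})")
    case True
    have fibre_edges:
      "{e \<in> S. \<phi> (fst (ends G e)) = w} = {e \<in> S. endpoints G e \<subseteq> {v \<in> V G. \<phi> v = w}}"
      "{e \<in> S. \<phi> ` endpoints G e = {w}} = {e \<in> S. \<phi> (fst (ends G e)) = w}" for w
      using True wf_graphD(3)[OF wf] by (fastforce simp: endpoints_def)+
    let ?fib = "\<lambda>w. {v \<in> V G. \<phi> v = w}"
    have image: "V G' = \<phi> ` V G" using True by simp
    have path: "(u, v) \<in> (adj G {e \<in> S. \<phi> (fst (ends G e)) = \<phi> u})\<^sup>* \<longleftrightarrow> (u, v) \<in> (adj G S)\<^sup>*" for u v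
      using True path_in_fibre[of S \<phi> G u v]
        adj_rtrancl_mono[of "{e \<in> S. \<phi> (fst (ends G e)) = \<phi> u}" S G]
      unfolding fibre_edges(2) by blast
    have "(\<forall>w \<in> V G'. \<forall>u \<in> ?fib w. \<forall>v \<in> ?fib w. (u, v) \<in> (adj G {e \<in> S. \<phi> (fst (ends G e)) = w})\<^sup>*)
        \<longleftrightarrow> (\<forall>w \<in> V G'. \<forall>u \<in> ?fib w. \<forall>v \<in> ?fib w. (u, v) \<in> (adj G S)\<^sup>*)"
      by (intro ball_cong refl) (auto simp: path)
    also have "\<dots> \<longleftrightarrow> (\<forall>u \<in> V G. \<forall>v \<in> V G. \<phi> u = \<phi> v \<longrightarrow> (u, v) \<in> (adj G S)\<^sup>*)"
      unfolding image by auto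
    finally have connected: "(\<forall>w \<in> V G'. \<forall>u \<in> ?fib w. \<forall>v \<in> ?fib w.
        (u, v) \<in> (adj G {e \<in> S. \<phi> (fst (ends G e)) = w})\<^sup>*) \<longleftrightarrow>
      (\<forall>u \<in> V G. \<forall>v \<in> V G. \<phi> u = \<phi> v \<longrightarrow> (u, v) \<in> (adj G S)\<^sup>*)" .
    have weight: "int (wt G' w) = (\<Sum>v \<in> ?fib w. int (wt G v))
          + int (card {e \<in> S. \<phi> (fst (ends G e)) = w}) - int (card (?fib w)) + 1 \<longleftrightarrow>
        int (wt G' w) - 1 = reduced_genus G S (?fib w)" for w
      by (auto simp: reduced_genus_def sum_subtractf fibre_edges(1))
    show ?thesis
      unfolding contr_def Let_def collapsed kept weight ball_conj_distrib connected
      by (simp only: conj_assoc)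
  qed (auto simp: contr_def collapsed)
qed

locale contraction =
  fixes G :: sgraph and P :: "nat set" and G' :: sgraph and P' :: "nat set"
    and S :: "nat set" and \<phi> \<psi> :: "nat \<Rightarrow> nat"
  assumes wf: "wf_graph G" and P_subset: "P \<subseteq> E G" and contr: "contr G P G' P' S \<phi> \<psi>"
begin

lemma contracted_subset: "S \<subseteq> E G"
  and vertex_image: "\<phi> ` V G = V G'"
  and edge_bij: "bij_betw \<psi> (E G - S) (E G')"
  and contracted_endpoints: "e \<in> S \<Longrightarrow> \<exists>w. \<phi> ` endpoints G e = {w}"
  and kept_endpoints: "e \<in> E G - S \<Longrightarrow> endpoints G' (\<psi> e) = \<phi> ` endpoints G e"
  and fibre_connected: "u \<in> V G \<Longrightarrow> v \<in> V G \<Longrightarrow> \<phi> u = \<phi> v \<Longrightarrow> (u, v) \<in> (adj G S)\<^sup>*"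
  and fibre_reduced_genus: "w \<in> V G' \<Longrightarrow> int (wt G' w) - 1 = reduced_genus G S {v \<in> V G. \<phi> v = w}"
  and cycle_image: "P' = \<psi> ` (P - S)"
  using contr unfolding contr_iff[OF wf] by simp_all

lemma edge_inj: "inj_on \<psi> (E G - S)" and edge_image: "\<psi> ` (E G - S) = E G'"
  using edge_bij by (simp_all add: bij_betw_def)

lemma kept_image_Diff:
  assumes "S \<subseteq> T" "T \<subseteq> E G"
  shows "E G' - \<psi> ` (T - S) = \<psi> ` (E G - T)"
proof -
  have "(E G - S) - (T - S) = E G - T" using assms by auto
  then show ?thesis
    using inj_on_image_set_diff[OF edge_inj, of "E G - S" "T - S"] assms(2)
    by (auto simp: edge_image)
qed

lemma edge_bij_Diff:
  assumes "S \<subseteq> T" "T \<subseteq> E G"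
  shows "bij_betw \<psi> (E G - T) (E G' - \<psi> ` (T - S))"
  unfolding kept_image_Diff[OF assms]
  using assms(1) by (intro inj_on_imp_bij_betw inj_on_subset[OF edge_inj]) auto

lemma cycle_image_Diff:
  assumes "S \<subseteq> T" "T \<subseteq> E G"
  shows "P' - \<psi> ` (T - S) = \<psi> ` (P - T)"
proof -
  have "(P - S) - (T - S) = P - T" using assms(1) by blast
  moreover have "\<psi> ` ((P - S) - (T - S)) = \<psi> ` (P - S) - \<psi> ` (T - S)"
    using P_subset assms(2) by (intro inj_on_image_set_diff[OF edge_inj]) auto
  ultimately show ?thesis by (simp add: cycle_image)
qed

lemma wf_image: "wf_graph G'"
proof -
  have "endpoints G' e' \<subseteq> V G'" if e': "e' \<in> E G'" for e'
  proof -
    obtain e where "e \<in> E G - S" "e' = \<psi> e" using e' edge_image by blast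
    then show ?thesis using kept_endpoints[of e] wf_graphD(3)[OF wf, of e] vertex_image by auto
  qed
  moreover have "finite (V G')" "finite (E G')"
    using wf_graphD(1,2)[OF wf] vertex_image edge_image
    by (metis finite_imageI, metis finite_Diff finite_imageI)
  ultimately show ?thesis by (simp add: wf_graph_def)
qed

lemma cycle_image_subset: "P' \<subseteq> E G'"
  using cycle_image P_subset edge_image by blast

lemma path_image:
  assumes T: "T \<subseteq> E G" and path: "(u, v) \<in> (adj G T)\<^sup>*"
  shows "(\<phi> u, \<phi> v) \<in> (adj G' (\<psi> ` (T - S)))\<^sup>*"
  using path
proof (induction rule: rtrancl_induct)
  case (step y z)
  obtain e where e: "e \<in> T" "endpoints G e = {y, z}" using step.hyps(2) by (auto simp: adj_iff)
  show ?case
  proof (cases "e \<in> S")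
    case True
    then have "\<phi> y = \<phi> z" using contracted_endpoints[of e] e(2) by auto
    then show ?thesis using step.IH by simp
  next
    case False
    then have "endpoints G' (\<psi> e) = {\<phi> y, \<phi> z}" using kept_endpoints[of e] e T by auto
    then have "(\<phi> y, \<phi> z) \<in> adj G' (\<psi> ` (T - S))" using e(1) False by (auto simp: adj_iff)
    then show ?thesis using step.IH by simp
  qed
qed simp

lemma path_lift:
  assumes T: "S \<subseteq> T" "T \<subseteq> E G" and u: "u \<in> V G" and path: "(\<phi> u, w) \<in> (adj G' (\<psi> ` (T - S)))\<^sup>*"
  shows "\<forall>v \<in> V G. \<phi> v = w \<longrightarrow> (u, v) \<in> (adj G T)\<^sup>*"
  using path
proof (induction rule: rtrancl_induct)
  case base
  then show ?case using fibre_connected[OF u] adj_rtrancl_mono[OF T(1)] by force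
next
  case (step y z)
  obtain e where e: "e \<in> T - S" "endpoints G' (\<psi> e) = {y, z}"
    using step.hyps(2) by (auto simp: adj_iff)
  then have image_e: "\<phi> ` endpoints G e = {y, z}" and endpoints_subset: "endpoints G e \<subseteq> V G"
    using kept_endpoints[of e] wf_graphD(3)[OF wf, of e] T(2) by auto
  have "endpoints G e = {fst (ends G e), snd (ends G e)}" by (simp add: endpoints_def)
  then obtain r s where endpoints_e: "endpoints G e = {r, s}" "\<phi> r = y" "\<phi> s = z"
    using image_e by (fastforce simp: doubleton_eq_iff)
  show ?case
  proof (intro ballI impI)
    fix v assume v: "v \<in> V G" "\<phi> v = z"
    have "(u, r) \<in> (adj G T)\<^sup>*" using step.IH endpoints_e endpoints_subset by auto
    also have "(r, s) \<in> adj G T" using e(1) endpoints_e(1) by (auto simp: adj_iff)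
    also have "(s, v) \<in> (adj G T)\<^sup>*"
      using fibre_connected[of s v] v endpoints_e endpoints_subset adj_rtrancl_mono[OF T(1)] by auto
    finally show "(u, v) \<in> (adj G T)\<^sup>*" .
  qed
qed

lemma path_iff:
  assumes "S \<subseteq> T" "T \<subseteq> E G" "u \<in> V G" "v \<in> V G"
  shows "(\<phi> u, \<phi> v) \<in> (adj G' (\<psi> ` (T - S)))\<^sup>* \<longleftrightarrow> (u, v) \<in> (adj G T)\<^sup>*"
  using path_image[OF assms(2)] path_lift[OF assms(1-3)] assms(4) by blast

lemma connected_iff: "connected_graph G' \<longleftrightarrow> connected_graph G"
proof -
  have "(\<forall>u' \<in> V G'. \<forall>v' \<in> V G'. (u', v') \<in> (adj G' (E G'))\<^sup>*)
     \<longleftrightarrow> (\<forall>u \<in> V G. \<forall>v \<in> V G. (\<phi> u, \<phi> v) \<in> (adj G' (\<psi> ` (E G - S)))\<^sup>*)"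
    unfolding vertex_image[symmetric] edge_image by blast
  then show ?thesis
    unfolding connected_graph_def using path_iff[OF contracted_subset] vertex_image by auto
qed

lemma reduced_genus_image:
  assumes T: "S \<subseteq> T" "T \<subseteq> E G" and W: "W \<subseteq> V G'"
  shows "reduced_genus G' (\<psi> ` (T - S)) W = reduced_genus G T {v \<in> V G. \<phi> v \<in> W}"
proof -
  let ?U = "{v \<in> V G. \<phi> v \<in> W}" and ?fib = "\<lambda>w. {v \<in> V G. \<phi> v = w}"
  let ?over = "\<lambda>F U. {e \<in> F. endpoints G e \<subseteq> U}"
  have finite: "finite (V G)" "finite T" "finite S" "finite W"
    using wf_graphD(1,2)[OF wf] wf_graphD(1)[OF wf_image] T W finite_subset by metis+
  have "(\<Sum>w \<in> W. int (wt G' w) - 1) = (\<Sum>w \<in> W. reduced_genus G S (?fib w))"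
    using fibre_reduced_genus W by (intro sum.cong) auto
  also have "\<dots> = (\<Sum>w \<in> W. \<Sum>v \<in> ?fib w. int (wt G v) - 1) + (\<Sum>w \<in> W. int (card (?over S (?fib w))))"
    by (simp add: reduced_genus_def sum.distrib)
  also have "(\<Sum>w \<in> W. \<Sum>v \<in> ?fib w. int (wt G v) - 1) = (\<Sum>v \<in> (\<Union>w \<in> W. ?fib w). int (wt G v) - 1)"
    by (rule sum.UNION_disjoint[symmetric]) (use finite in auto)
  also have "(\<Union>w \<in> W. ?fib w) = ?U" by auto
  also have "(\<Sum>w \<in> W. int (card (?over S (?fib w)))) = int (card (\<Union>w \<in> W. ?over S (?fib w)))"
  proof -
    have "?over S (?fib w) \<inter> ?over S (?fib w') = {}" if "w \<noteq> w'" for w w'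
      using that by (auto simp: endpoints_def)
    then show ?thesis using finite by (subst card_UN_disjoint) auto
  qed
  also have "(\<Union>w \<in> W. ?over S (?fib w)) = ?over S ?U"
    using contracted_endpoints by (fastforce simp: endpoints_def)
  finally have vertices: "(\<Sum>w \<in> W. int (wt G' w) - 1)
      = (\<Sum>v \<in> ?U. int (wt G v) - 1) + int (card (?over S ?U))" .
  have "{e' \<in> \<psi> ` (T - S). endpoints G' e' \<subseteq> W} = \<psi> ` ?over (T - S) ?U"
    using kept_endpoints wf_graphD(3)[OF wf] T(2) by fastforce
  moreover have "inj_on \<psi> (?over (T - S) ?U)" using T(2) by (intro inj_on_subset[OF edge_inj]) auto
  ultimately have "card {e' \<in> \<psi> ` (T - S). endpoints G' e' \<subseteq> W} = card (?over (T - S) ?U)"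
    by (simp add: card_image)
  moreover have "card (?over T ?U) = card (?over S ?U) + card (?over (T - S) ?U)"
    using finite T(1) by (subst card_Un_disjoint[symmetric]) (auto intro: arg_cong[of _ _ card])
  ultimately show ?thesis unfolding reduced_genus_def using vertices by simp
qed

lemma genus_image: "genus G' = genus G"
proof -
  have "{v \<in> V G. \<phi> v \<in> V G'} = V G" using vertex_image by auto
  then show ?thesis
    using reduced_genus_image[OF contracted_subset order_refl order_refl] edge_image
    by (simp add: genus_eq_reduced_genus wf wf_image)
qed

lemma collapsed_factor_iff:
  assumes T: "S \<subseteq> T" "T \<subseteq> E G"
    and \<phi>: "\<And>e. e \<in> E G \<Longrightarrow> \<phi>'' ` endpoints G e = \<phi>' ` \<phi> ` endpoints G e"
  shows "(\<forall>e \<in> T. \<exists>w. \<phi>'' ` endpoints G e = {w})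
     \<longleftrightarrow> (\<forall>e' \<in> \<psi> ` (T - S). \<exists>w. \<phi>' ` endpoints G' e' = {w})"
proof -
  have "\<exists>w. \<phi>'' ` endpoints G e = {w}" if "e \<in> S" for e
    using contracted_endpoints[OF that] \<phi>[of e] that T by fastforce
  moreover have "\<phi>'' ` endpoints G e = \<phi>' ` endpoints G' (\<psi> e)" if "e \<in> T - S" for e
    using kept_endpoints[of e] \<phi>[of e] that T by auto
  ultimately show ?thesis by fastforce
qed

lemma contr_factor_iff:
  assumes T: "S \<subseteq> T" "T \<subseteq> E G"
    and \<phi>: "\<And>v. v \<in> V G \<Longrightarrow> \<phi>' (\<phi> v) = \<phi>'' v"
    and \<psi>: "\<And>e. e \<in> E G - S \<Longrightarrow> \<psi>' (\<psi> e) = \<psi>'' e"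
  shows "contr G P G'' P'' T \<phi>'' \<psi>'' \<longleftrightarrow> contr G' P' G'' P'' (\<psi> ` (T - S)) \<phi>' \<psi>'"
proof -
  let ?T' = "\<psi> ` (T - S)"
  have \<phi>_endpoints: "\<phi>'' ` endpoints G e = \<phi>' ` \<phi> ` endpoints G e" if "e \<in> E G" for e
    using wf_graphD(3)[OF wf that] \<phi> unfolding image_image by (intro image_cong) auto
  have kept: "e \<in> E G - S" if "e \<in> E G - T" for e using that T(1) by blast
  have "?T' \<subseteq> E G'" using T(2) edge_image by blast
  moreover have "\<phi>'' ` V G = \<phi>' ` V G'"
    unfolding vertex_image[symmetric] image_image using \<phi> by simp
  moreover have "bij_betw \<psi>'' (E G - T) (E G'') \<longleftrightarrow> bij_betw \<psi>' (E G' - ?T') (E G'')"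
  proof -
    have "bij_betw \<psi>' (E G' - ?T') (E G'') \<longleftrightarrow> bij_betw (\<psi>' \<circ> \<psi>) (E G - T) (E G'')"
      by (rule bij_betw_comp_iff[OF edge_bij_Diff[OF T]])
    also have "\<dots> \<longleftrightarrow> bij_betw \<psi>'' (E G - T) (E G'')"
      using \<psi> kept by (intro bij_betw_cong) simp
    finally show ?thesis ..
  qed
  moreover have "(\<forall>e \<in> T. \<exists>w. \<phi>'' ` endpoints G e = {w})
     \<longleftrightarrow> (\<forall>e' \<in> ?T'. \<exists>w. \<phi>' ` endpoints G' e' = {w})"
    by (rule collapsed_factor_iff[OF T \<phi>_endpoints])
  moreover have "(\<forall>e \<in> E G - T. endpoints G'' (\<psi>'' e) = \<phi>'' ` endpoints G e)
     \<longleftrightarrow> (\<forall>e' \<in> E G' - ?T'. endpoints G'' (\<psi>' e') = \<phi>' ` endpoints G' e')"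
    unfolding kept_image_Diff[OF T] using \<psi> kept kept_endpoints \<phi>_endpoints by auto
  moreover have "(\<forall>u \<in> V G. \<forall>v \<in> V G. \<phi>'' u = \<phi>'' v \<longrightarrow> (u, v) \<in> (adj G T)\<^sup>*)
     \<longleftrightarrow> (\<forall>u' \<in> V G'. \<forall>v' \<in> V G'. \<phi>' u' = \<phi>' v' \<longrightarrow> (u', v') \<in> (adj G' ?T')\<^sup>*)"
    unfolding vertex_image[symmetric] using \<phi> path_iff[OF T] by simp
  moreover have
    "reduced_genus G T {v \<in> V G. \<phi>'' v = w} = reduced_genus G' ?T' {v \<in> V G'. \<phi>' v = w}" for w
  proof -
    have "{v \<in> V G. \<phi> v \<in> {v \<in> V G'. \<phi>' v = w}} = {v \<in> V G. \<phi>'' v = w}"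
      using \<phi> vertex_image by auto
    then show ?thesis using reduced_genus_image[OF T, of "{v \<in> V G'. \<phi>' v = w}"] by auto
  qed
  moreover have "\<psi>'' ` (P - T) = \<psi>' ` (P' - ?T')"
    unfolding cycle_image_Diff[OF T] image_image using \<psi>[symmetric] P_subset T(1)
    by (intro image_cong) (auto simp: subset_iff)
  ultimately show ?thesis unfolding contr_iff[OF wf] contr_iff[OF wf_image] using T(2) by simp
qed

lemma contr_compose:
  assumes "contr G' P' G'' P'' T' \<phi>' \<psi>'"
  obtains T where "S \<subseteq> T" "T \<subseteq> E G" "\<psi> ` (T - S) = T'" "contr G P G'' P'' T (\<phi>' \<circ> \<phi>) (\<psi>' \<circ> \<psi>)"
proof -
  let ?T = "S \<union> {e \<in> E G - S. \<psi> e \<in> T'}"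
  have T: "S \<subseteq> ?T" "?T \<subseteq> E G" using contracted_subset by auto
  have "T' \<subseteq> E G'" using assms by (simp add: contr_def)
  moreover have "\<psi> ` (?T - S) = T' \<inter> \<psi> ` (E G - S)" by auto
  ultimately have T': "\<psi> ` (?T - S) = T'" using edge_image by auto
  have "contr G P G'' P'' ?T (\<phi>' \<circ> \<phi>) (\<psi>' \<circ> \<psi>) \<longleftrightarrow> contr G' P' G'' P'' (\<psi> ` (?T - S)) \<phi>' \<psi>'"
    by (rule contr_factor_iff[OF T]) simp_all
  then show ?thesis using that[OF T T'] assms T' by simp
qed

lemma contr_factor:
  assumes composite: "contr G P G'' P'' T \<phi>'' \<psi>''" and S_subset: "S \<subseteq> T"
  obtains \<phi>' \<psi>' where "contr G' P' G'' P'' (\<psi> ` (T - S)) \<phi>' \<psi>'" "\<And>e. e \<in> E G - S \<Longrightarrow> \<psi>' (\<psi> e) = \<psi>'' e"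
proof -
  interpret composite: contraction G P G'' P'' T \<phi>'' \<psi>''
    by unfold_locales (use wf P_subset composite in auto)
  have \<phi>: "\<phi>'' (inv_into (V G) \<phi> (\<phi> v)) = \<phi>'' v" if v: "v \<in> V G" for v
  proof -
    have "(inv_into (V G) \<phi> (\<phi> v), v) \<in> (adj G S)\<^sup>*"
      by (intro fibre_connected inv_into_into f_inv_into_f imageI v)
    then have "(inv_into (V G) \<phi> (\<phi> v), v) \<in> (adj G T)\<^sup>*"
      using adj_rtrancl_mono[OF S_subset] by blast
    then show ?thesis using composite.contracted_endpoints path_in_fibre[of T \<phi>''] by metis
  qed
  have \<psi>: "\<psi>'' (inv_into (E G - S) \<psi> (\<psi> e)) = \<psi>'' e" if "e \<in> E G - S" for e
    using that edge_inj by simp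
  have "contr G P G'' P'' T \<phi>'' \<psi>'' \<longleftrightarrow> contr G' P' G'' P'' (\<psi> ` (T - S))
      (\<phi>'' \<circ> inv_into (V G) \<phi>) (\<psi>'' \<circ> inv_into (E G - S) \<psi>)"
    by (rule contr_factor_iff[OF S_subset composite.contracted_subset]) (use \<phi> \<psi> in auto)
  then show ?thesis
    using that[of "\<phi>'' \<circ> inv_into (V G) \<phi>" "\<psi>'' \<circ> inv_into (E G - S) \<psi>"] composite \<psi> by simp
qed

lemma card_half_edges_image:
  assumes kept: "F \<subseteq> E G - S"
  shows "card (half_edges G' (\<psi> ` F) w) = card {h \<in> F \<times> UNIV. \<phi> (origin G h) = w}"
proof -
  have "\<forall>e \<in> F. \<exists>s. \<forall>b. origin G' (\<psi> e, if s then \<not> b else b) = \<phi> (origin G (e, b))"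
    using kept_endpoints kept unfolding endpoints_image_iff by blast
  then obtain \<sigma> where "\<forall>e \<in> F. \<forall>b. origin G' (\<psi> e, if \<sigma> e then \<not> b else b) = \<phi> (origin G (e, b))"
    by (auto dest!: bchoice)
  then have "half_edges G' (\<psi> ` F) w = half_edge_map \<psi> \<sigma> ` {h \<in> F \<times> UNIV. \<phi> (origin G h) = w}"
    by (intro half_edges_image) (auto simp: half_edge_map_def)
  moreover have "inj_on (half_edge_map \<psi> \<sigma>) {h \<in> F \<times> UNIV. \<phi> (origin G h) = w}"
    using inj_on_half_edge_map[OF inj_on_subset[OF edge_inj kept]] by (rule inj_on_subset) auto
  ultimately show ?thesis by (simp add: card_image)
qed

lemma degP_image:
  assumes Q: "Q \<subseteq> E G"
  shows "(\<Sum>v \<in> {v \<in> V G. \<phi> v = w}. degP G Q v)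
     = degP G' (\<psi> ` (Q - S)) w + 2 * card {e \<in> Q \<inter> S. \<phi> ` endpoints G e = {w}}"
proof -
  let ?over = "\<lambda>F. {h \<in> F \<times> UNIV. \<phi> (origin G h) = w}"
  have finite: "finite Q" "finite (V G)" using Q wf_graphD(1,2)[OF wf] finite_subset by auto
  then have "(\<Sum>v \<in> {v \<in> V G. \<phi> v = w}. degP G Q v)
      = card {h \<in> Q \<times> UNIV. origin G h \<in> {v \<in> V G. \<phi> v = w}}"
    by (intro sum_degP) auto
  also have "{h \<in> Q \<times> UNIV. origin G h \<in> {v \<in> V G. \<phi> v = w}} = ?over (Q - S) \<union> ?over (Q \<inter> S)"
    using origin_in_V[OF wf] Q by auto
  also have "card \<dots> = card (?over (Q - S)) + card (?over (Q \<inter> S))"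
    using finite by (intro card_Un_disjoint) (auto intro: finite_subset[of _ "Q \<times> UNIV"])
  also have "?over (Q \<inter> S) = {e \<in> Q \<inter> S. \<phi> ` endpoints G e = {w}} \<times> UNIV"
  proof -
    have "\<phi> (origin G (e, b)) = w \<longleftrightarrow> \<phi> ` endpoints G e = {w}" if e: "e \<in> S" for e b
    proof -
      obtain w' where w': "\<phi> ` endpoints G e = {w'}" using contracted_endpoints[OF e] by blast
      then have "\<phi> (origin G (e, b)) = w'" unfolding endpoints_eq_origins by blast
      then show ?thesis using w' by auto
    qed
    then show ?thesis by auto
  qed
  also have "card (?over (Q - S)) = card (half_edges G' (\<psi> ` (Q - S)) w)"
    using Q by (intro card_half_edges_image[symmetric]) auto
  finally show ?thesis
    using finite by (simp add: degP_eq_card_half_edges card_cartesian_product)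
qed

lemma canon_deg_image:
  assumes "w \<in> V G'"
  shows "canon_deg G' w = (\<Sum>v \<in> {v \<in> V G. \<phi> v = w}. canon_deg G v)"
proof -
  let ?fib = "{v \<in> V G. \<phi> v = w}"
  have "{e \<in> E G \<inter> S. \<phi> ` endpoints G e = {w}} = {e \<in> S. endpoints G e \<subseteq> ?fib}"
    using contracted_subset contracted_endpoints wf_graphD(3)[OF wf]
    by (fastforce simp: endpoints_def)
  then have "(\<Sum>v \<in> ?fib. deg G v) = deg G' w + 2 * card {e \<in> S. endpoints G e \<subseteq> ?fib}"
    using degP_image[OF order_refl, of w] edge_image by (simp add: deg_def)
  then show ?thesis
    using fibre_reduced_genus[OF assms] unfolding sum_canon_deg_eq reduced_genus_def
    by (simp add: canon_deg_def)
qed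

lemma cyc_image:
  assumes "cyc G P"
  shows "cyc G' P'"
  unfolding cyc_def
proof (intro conjI ballI cycle_image_subset)
  fix w assume "w \<in> V G'"
  have "even (\<Sum>v \<in> {v \<in> V G. \<phi> v = w}. degP G P v)"
    using assms by (intro dvd_sum) (auto simp: cyc_def)
  then show "even (degP G' P' w)" unfolding degP_image[OF P_subset] cycle_image by simp
qed

lemma Obj_image:
  assumes obj: "(G, P) \<in> Obj g"
  shows "(G', P') \<in> Obj g"
proof (rule ObjI)
  fix w assume w: "w \<in> V G'"
  then have "{v \<in> V G. \<phi> v = w} \<noteq> {}" unfolding vertex_image[symmetric] by auto
  then show "0 < canon_deg G' w"
    unfolding canon_deg_image[OF w] using ObjD(3,7)[OF obj] by (intro sum_pos) auto
qed (use ObjD[OF obj] wf_image connected_iff genus_image cyc_image in auto)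

lemma Obj_preimage:
  assumes "(G', P') \<in> Obj g" "\<And>v. v \<in> V G \<Longrightarrow> 0 < canon_deg G v" "cyc G P"
  shows "(G, P) \<in> Obj g"
  by (rule ObjI) (use ObjD[OF assms(1)] wf connected_iff genus_image assms in auto)

end

lemma contraction_of_Obj:
  assumes "(G, P) \<in> Obj g" "contr G P G' P' S \<phi> \<psi>"
  shows "contraction G P G' P' S \<phi> \<psi>"
  using ObjD[OF assms(1)] assms(2) by unfold_locales

lemma contr_Obj: "(G, P) \<in> Obj g \<Longrightarrow> contr G P G' P' S \<phi> \<psi> \<Longrightarrow> (G', P') \<in> Obj g"
  using contraction.Obj_image[OF contraction_of_Obj] .

lemma contr_id:
  assumes "wf_graph G"
  shows "contr G P G P {} id id"
proof -
  have "reduced_genus G {} {v \<in> V G. id v = w} = int (wt G w) - 1" if "w \<in> V G" for w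
  proof -
    have "{v \<in> V G. id v = w} = {w}" using that by auto
    then show ?thesis by (simp add: reduced_genus_def)
  qed
  then show ?thesis unfolding contr_iff[OF assms] by auto
qed

definition contract_edge :: "sgraph \<Rightarrow> nat \<Rightarrow> sgraph" where
  "contract_edge G e = (let (a, b) = ends G e; \<phi> = id(b := a) in
     \<lparr>V = \<phi> ` V G, E = E G - {e}, ends = map_prod \<phi> \<phi> \<circ> ends G,
      wt = (wt G)(a := if a = b then wt G a + 1 else wt G a + wt G b)\<rparr>)"

lemma contr_contract_edge:
  assumes wf: "wf_graph G" and e: "e \<in> E G" and ends: "ends G e = (a, b)"
  shows "contr G P (contract_edge G e) (P - {e}) {e} (id(b := a)) id"
proof -
  let ?\<phi> = "id(b := a)" and ?G' = "contract_edge G e"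
  have endpoints_e: "endpoints G e = {a, b}" "a \<in> V G" "b \<in> V G"
    using ends wf_graphD(3)[OF wf e] by (auto simp: endpoints_def)
  have G': "V ?G' = ?\<phi> ` V G" "E ?G' = E G - {e}" "Defs.ends ?G' = map_prod ?\<phi> ?\<phi> \<circ> Defs.ends G"
    "wt ?G' = (wt G)(a := if a = b then wt G a + 1 else wt G a + wt G b)"
    by (simp_all add: contract_edge_def ends Let_def)
  have "(u, v) \<in> (adj G {e})\<^sup>*" if "?\<phi> u = ?\<phi> v" for u v
  proof -
    have "(a, b) \<in> adj G {e}" "(b, a) \<in> adj G {e}" using endpoints_e(1) by (auto simp: adj_iff)
    then show ?thesis using that by (auto split: if_splits)
  qed
  moreover have "int (wt ?G' w) - 1 = reduced_genus G {e} {v \<in> V G. ?\<phi> v = w}"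
    if w: "w \<in> V ?G'" for w
  proof -
    have genus: "reduced_genus G {e} U = (\<Sum>v \<in> U. int (wt G v) - 1) + of_bool (a \<in> U \<and> b \<in> U)" for U
    proof -
      have "{e' \<in> {e}. endpoints G e' \<subseteq> U} = (if a \<in> U \<and> b \<in> U then {e} else {})"
        using endpoints_e(1) by auto
      then show ?thesis by (simp add: reduced_genus_def)
    qed
    show ?thesis
    proof (cases "w = a")
      case True
      then have "{v \<in> V G. ?\<phi> v = w} = {a, b}" using endpoints_e by auto
      then show ?thesis using True by (cases "a = b") (simp_all add: G' genus)
    next
      case False
      then have "{v \<in> V G. ?\<phi> v = w} = {w}" using w by (auto simp: G'(1) split: if_splits)
      then show ?thesis using False by (simp add: G' genus)
    qed
  qed
  moreover have "endpoints ?G' e' = ?\<phi> ` endpoints G e'" for e'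
    by (simp add: endpoints_def G' map_prod_def split_beta)
  ultimately show ?thesis
    unfolding contr_iff[OF wf] using e endpoints_e(1) by (auto simp: G')
qed

lemma contr_exists:
  assumes wf: "wf_graph G" and P: "P \<subseteq> E G" and S: "S \<subseteq> E G"
  shows "\<exists>G' \<phi>. contr G P G' (P - S) S \<phi> id"
proof -
  have "finite S" using S wf_graphD(2)[OF wf] finite_subset by blast
  then show ?thesis using S
  proof (induction S rule: finite_induct)
    case empty
    show ?case using contr_id[OF wf] by (metis Diff_empty)
  next
    case (insert e S)
    then obtain G\<^sub>0 \<phi>\<^sub>0 where "contr G P G\<^sub>0 (P - S) S \<phi>\<^sub>0 id" by blast
    then interpret contraction G P G\<^sub>0 "P - S" S \<phi>\<^sub>0 id using wf P by unfold_locales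
    have "e \<in> E G\<^sub>0" using insert edge_image by auto
    then obtain G' \<phi> where contracts: "contr G\<^sub>0 (P - S) G' (P - S - {e}) {e} \<phi> id"
      using contr_contract_edge[OF wf_image] surj_pair by metis
    obtain T where "S \<subseteq> T" "id ` (T - S) = {e}" "contr G P G' (P - S - {e}) T (\<phi> \<circ> \<phi>\<^sub>0) id"
      by (rule contr_compose[OF contracts]) simp
    moreover have "T = insert e S" "P - S - {e} = P - insert e S" using calculation(1,2) by auto
    ultimately show ?case by metis
  qed
qed

section \<open>The colimit relation\<close>

lemma cone_int_imp_cone: "x \<in> cone_int G \<Longrightarrow> x \<in> cone G"
  by (auto simp: cone_int_def cone_def le_less)

lemma iota_in_cone: "x \<in> cone G' \<Longrightarrow> iota G S \<psi> x \<in> cone G"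
  by (auto simp: iota_def cone_def)

lemma iota_id: "x \<in> cone G \<Longrightarrow> iota G {} id x = x"
  by (auto simp: iota_def cone_def)

definition kept_lengths :: "sgraph \<Rightarrow> nat set \<Rightarrow> (nat \<Rightarrow> nat) \<Rightarrow> (nat \<Rightarrow> real) \<Rightarrow> nat \<Rightarrow> real" where
  "kept_lengths G S \<psi> y e' = (if e' \<in> \<psi> ` (E G - S) then y (inv_into (E G - S) \<psi> e') else 0)"

context contraction
begin

lemma iota_in_cone_int:
  assumes "S = {}" "x \<in> cone_int G'"
  shows "iota G S \<psi> x \<in> cone_int G"
  using assms bij_betw_apply[OF edge_bij] by (auto simp: iota_def cone_int_def)

lemma iota_zero_set:
  assumes "x \<in> cone_int G'"
  shows "{e \<in> E G. iota G S \<psi> x e = 0} = S"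
proof -
  have "0 < x (\<psi> e)" if "e \<in> E G - S" for e
    using bij_betw_apply[OF edge_bij that] assms by (simp add: cone_int_def)
  then show ?thesis using contracted_subset by (force simp: iota_def)
qed

lemma iota_comp:
  assumes "S \<subseteq> T" "T \<subseteq> E G" "\<And>e. e \<in> E G - S \<Longrightarrow> \<psi>' (\<psi> e) = \<psi>'' e"
  shows "iota G S \<psi> (iota G' (\<psi> ` (T - S)) \<psi>' x) = iota G T \<psi>'' x"
proof
  fix e
  have "\<psi> e \<in> E G' - \<psi> ` (T - S) \<longleftrightarrow> e \<in> E G - T" if "e \<in> E G - S"
    unfolding kept_image_Diff[OF assms(1,2)] using that edge_inj assms(1) by (auto simp: inj_on_def)
  then show "iota G S \<psi> (iota G' (\<psi> ` (T - S)) \<psi>' x) e = iota G T \<psi>'' x e"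
    using assms by (auto simp: iota_def)
qed

lemma kept_lengths_apply: "e \<in> E G - S \<Longrightarrow> kept_lengths G S \<psi> y (\<psi> e) = y e"
  using edge_inj by (simp add: kept_lengths_def)

lemma kept_lengths_iota:
  assumes "x \<in> cone G'"
  shows "kept_lengths G S \<psi> (iota G S \<psi> x) = x"
proof
  fix e'
  show "kept_lengths G S \<psi> (iota G S \<psi> x) e' = x e'"
  proof (cases "e' \<in> E G'")
    case True
    then obtain e where "e \<in> E G - S" "e' = \<psi> e" using edge_image by blast
    then show ?thesis by (simp add: kept_lengths_apply iota_def)
  next
    case False
    then show ?thesis using assms edge_image by (auto simp: kept_lengths_def cone_def)
  qed
qed

lemma inj_on_iota: "inj_on (iota G S \<psi>) (cone G')"
  by (rule inj_on_inverseI[of _ "kept_lengths G S \<psi>"]) (rule kept_lengths_iota)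

lemma kept_lengths_factor:
  assumes T: "S \<subseteq> T" and composite: "contr G P G'' P'' T \<phi>'' \<psi>''"
    and quotient: "contr G' P' G'' P'' (\<psi> ` (T - S)) \<phi>' \<psi>'"
      and \<psi>: "\<And>e. e \<in> E G - S \<Longrightarrow> \<psi>' (\<psi> e) = \<psi>'' e"
  shows "kept_lengths G T \<psi>'' (iota G S \<psi> z) = kept_lengths G' (\<psi> ` (T - S)) \<psi>' z"
proof
  fix e''
  interpret composite: contraction G P G'' P'' T \<phi>'' \<psi>''
    by unfold_locales (use wf P_subset composite in auto)
  interpret quotient: contraction G' P' G'' P'' "\<psi> ` (T - S)" \<phi>' \<psi>'
    by unfold_locales (use wf_image cycle_image_subset quotient in auto)
  show "kept_lengths G T \<psi>'' (iota G S \<psi> z) e'' = kept_lengths G' (\<psi> ` (T - S)) \<psi>' z e''"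
  proof (cases "e'' \<in> E G''")
    case True
    then obtain e where e: "e \<in> E G - T" "e'' = \<psi>'' e" using composite.edge_image by blast
    moreover have "\<psi> e \<in> E G' - \<psi> ` (T - S)"
      unfolding kept_image_Diff[OF T composite.contracted_subset] using e by blast
    ultimately show ?thesis
      using composite.kept_lengths_apply[of e "iota G S \<psi> z"]
        quotient.kept_lengths_apply[of "\<psi> e" z] \<psi>[of e] T
      by (auto simp: iota_def)
  next
    case False
    then show ?thesis by (simp add: kept_lengths_def composite.edge_image quotient.edge_image)
  qed
qed

end

lemma gen_rel_iff:
  "(((G', P'), x'), ((G, P), x)) \<in> gen_rel g \<longleftrightarrow> (G, P) \<in> Obj g \<and> (G', P') \<in> Obj g \<and> x' \<in> cone G' \<and>
     (\<exists>S \<phi> \<psi>. contr G P G' P' S \<phi> \<psi> \<and> x = iota G S \<psi> x')"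
  by (auto simp: gen_rel_def)

text \<open>Interior points serve as normal forms: every point reduces to one, uniquely up to
  isomorphism.\<close>

inductive reduces :: "nat \<Rightarrow> cpt \<Rightarrow> cpt \<Rightarrow> bool" for g where
  reducesI: "reduces g ((G, P), iota G S \<psi> z) ((H, Q), z)"
  if "(G, P) \<in> Obj g" "contr G P H Q S \<phi> \<psi>" "z \<in> cone_int H"

lemma reduces_Obj:
  assumes "reduces g ((G, P), x) ((H, Q), z)"
  shows "(G, P) \<in> Obj g" "(H, Q) \<in> Obj g" "z \<in> cone_int H"
  using assms by (auto elim!: reduces.cases intro: contr_Obj)

lemma reducesE:
  assumes "reduces g ((G, P), x) ((H, Q), z)"
  obtains S \<phi> \<psi> where "contraction G P H Q S \<phi> \<psi>" "x = iota G S \<psi> z"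
  using assms by (cases rule: reduces.cases) (auto dest: contraction_of_Obj)

lemma reduces_imp_gen_rel: "reduces g a n \<Longrightarrow> (n, a) \<in> gen_rel g"
proof (induction rule: reduces.induct)
  case (reducesI G P H Q S \<phi> \<psi> z)
  have "(H, Q) \<in> Obj g" using reducesI(1,2) by (rule contr_Obj)
  then show ?case using reducesI cone_int_imp_cone[OF reducesI(3)] by (auto simp: gen_rel_iff)
qed

lemma reduces_refl:
  assumes "(G, P) \<in> Obj g" "x \<in> cone_int G"
  shows "reduces g ((G, P), x) ((G, P), x)"
  using reducesI[OF assms(1) contr_id assms(2)] ObjD(1)[OF assms(1)] iota_id assms(2)
    cone_int_imp_cone by metis

lemma reduces_exists:
  assumes obj: "(G, P) \<in> Obj g" and x: "x \<in> cone G"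
  shows "\<exists>n. reduces g ((G, P), x) n"
proof -
  let ?S = "{e \<in> E G. x e = 0}"
  obtain G' \<phi> where contracts: "contr G P G' (P - ?S) ?S \<phi> id"
    using contr_exists[of G P ?S] ObjD(1,6)[OF obj] by auto
  then interpret contraction G P G' "P - ?S" ?S \<phi> id by (rule contraction_of_Obj[OF obj])
  have "E G' = E G - ?S" using edge_image by simp
  then have "x \<in> cone_int G'" and iota: "iota G ?S id x = x"
    using x by (auto simp: cone_int_def cone_def iota_def less_le fun_eq_iff)
  then show ?thesis using reducesI[OF obj contracts, of x] unfolding iota by blast
qed

lemma gen_rel_reduces:
  assumes rel: "(a, b) \<in> gen_rel g" and red: "reduces g a n"
  shows "reduces g b n"
  using red
proof (cases rule: reduces.cases)
  case (reducesI G' P' H Q S' \<phi>' \<psi>' z)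
  obtain G P S \<phi> \<psi> where b: "b = ((G, P), iota G S \<psi> (iota G' S' \<psi>' z))"
    and obj: "(G, P) \<in> Obj g" and contracts: "contr G P G' P' S \<phi> \<psi>"
    using rel unfolding reducesI(1) gen_rel_def by blast
  interpret contraction G P G' P' S \<phi> \<psi> by (rule contraction_of_Obj[OF obj contracts])
  obtain T where T: "S \<subseteq> T" "T \<subseteq> E G" "\<psi> ` (T - S) = S'" "contr G P H Q T (\<phi>' \<circ> \<phi>) (\<psi>' \<circ> \<psi>)"
    using contr_compose[OF reducesI(4)] .
  have "b = ((G, P), iota G T (\<psi>' \<circ> \<psi>) z)"
    using iota_comp[OF T(1,2), of \<psi>' "\<psi>' \<circ> \<psi>" z] by (simp add: b T(3))
  then show ?thesis using reduces.reducesI[OF obj T(4) reducesI(5)] reducesI(2) by simp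
qed

lemma reduces_trans: "reduces g a n \<Longrightarrow> reduces g n m \<Longrightarrow> reduces g a m"
  using gen_rel_reduces[OF reduces_imp_gen_rel] .

lemma reduces_confluent:
  assumes red: "reduces g a n" and red': "reduces g a n'"
  shows "reduces g n n'"
proof -
  obtain G P x H Q z H' Q' z' where eq: "a = ((G, P), x)" "n = ((H, Q), z)" "n' = ((H', Q'), z')"
    by (metis surj_pair)
  note obj = reduces_Obj[OF red[unfolded eq]] and obj' = reduces_Obj[OF red'[unfolded eq]]
  obtain S \<phi> \<psi> where contracts: "contraction G P H Q S \<phi> \<psi>" and x: "x = iota G S \<psi> z"
    using reducesE[OF red[unfolded eq]] .
  obtain S' \<phi>' \<psi>' where contracts': "contraction G P H' Q' S' \<phi>' \<psi>'" and x': "x = iota G S' \<psi>' z'"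
    using reducesE[OF red'[unfolded eq]] .
  interpret to_H: contraction G P H Q S \<phi> \<psi> by (rule contracts)
  have "S' = S"
    using to_H.iota_zero_set[OF obj(3)] contraction.iota_zero_set[OF contracts' obj'(3)] x x'
    by simp
  then obtain \<phi>\<^sub>3 \<psi>\<^sub>3 where contracts\<^sub>3: "contr H Q H' Q' (\<psi> ` (S - S)) \<phi>\<^sub>3 \<psi>\<^sub>3"
    and \<psi>\<^sub>3: "\<And>e. e \<in> E G - S \<Longrightarrow> \<psi>\<^sub>3 (\<psi> e) = \<psi>' e"
    using to_H.contr_factor[of H' Q' S \<phi>' \<psi>'] contraction.contr[OF contracts'] by blast
  have "iota G S \<psi> z = iota G S \<psi> (iota H (\<psi> ` (S - S)) \<psi>\<^sub>3 z')"
    using to_H.iota_comp[OF order_refl to_H.contracted_subset, of \<psi>\<^sub>3 \<psi>' z'] \<psi>\<^sub>3 x x' \<open>S' = S\<close>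
    by simp
  then have "z = iota H (\<psi> ` (S - S)) \<psi>\<^sub>3 z'"
    using to_H.inj_on_iota obj(3) obj'(3) cone_int_imp_cone iota_in_cone by (metis inj_onD)
  then show ?thesis unfolding eq using reducesI[OF obj(2) contracts\<^sub>3 obj'(3)] by simp
qed

lemma ceq_refl: "(a, a) \<in> ceq g"
  by (simp add: ceq_def)

lemma ceq_sym: "(a, b) \<in> ceq g \<Longrightarrow> (b, a) \<in> ceq g"
  unfolding ceq_def by (rule symD[OF sym_rtrancl[OF sym_Un_converse]])

lemma ceq_trans: "(a, b) \<in> ceq g \<Longrightarrow> (b, c) \<in> ceq g \<Longrightarrow> (a, c) \<in> ceq g"
  unfolding ceq_def by (rule rtrancl_trans)

lemma gen_rel_imp_ceq: "(a, b) \<in> gen_rel g \<Longrightarrow> (a, b) \<in> ceq g"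
  by (auto simp: ceq_def)

lemma reduces_imp_ceq: "reduces g a n \<Longrightarrow> (a, n) \<in> ceq g"
  by (rule ceq_sym[OF gen_rel_imp_ceq[OF reduces_imp_gen_rel]])

lemma ceq_reduces:
  assumes "(a, b) \<in> ceq g" and "reduces g a n"
  shows "reduces g b n"
  using assms(1) unfolding ceq_def
proof (induction rule: rtrancl_induct)
  case base
  show ?case by (rule assms(2))
next
  case (step b c)
  then consider (face) "(b, c) \<in> gen_rel g" | (coface) "(c, b) \<in> gen_rel g" by blast
  then show ?case
  proof cases
    case face
    then show ?thesis using gen_rel_reduces step.IH by blast
  next
    case coface
    then obtain m where "reduces g c m"
      unfolding gen_rel_def using reduces_exists by blast
    then show ?thesis
      using reduces_trans reduces_confluent[OF gen_rel_reduces[OF coface] step.IH] by blast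
  qed
qed

lemma ceq_interior_iff:
  assumes obj: "(G, P) \<in> Obj g" "(G', P') \<in> Obj g" and x: "x \<in> cone_int G" "y \<in> cone_int G'"
  shows "(((G, P), x), ((G', P'), y)) \<in> ceq g \<longleftrightarrow> (\<exists>\<phi> \<psi>. contr G P G' P' {} \<phi> \<psi> \<and> x = iota G {} \<psi> y)"
    (is "?L \<longleftrightarrow> ?R")
proof
  assume ?L
  then have "reduces g ((G, P), x) ((G', P'), y)"
    using ceq_reduces[OF ceq_sym] reduces_refl[OF obj(2) x(2)] by blast
  then obtain S \<phi> \<psi>
    where contracts: "contraction G P G' P' S \<phi> \<psi>" "x = iota G S \<psi> y" by (rule reducesE)
  have "S = {e \<in> E G. x e = 0}"
    using contraction.iota_zero_set[OF contracts(1) x(2)] contracts(2) by simp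
  then have "S = {}" using x(1) by (auto simp: cone_int_def)
  then show ?R using contraction.contr[OF contracts(1)] contracts(2) by blast
next
  assume ?R
  then show ?L using reducesI[OF obj(1) _ x(2)] reduces_imp_ceq by blast
qed

lemma pair_geI: "contr G P G' P' S \<phi> \<psi> \<Longrightarrow> pair_ge (G, P) (G', P')"
  by (auto simp: pair_ge_def)

lemma pair_ge_refl: "GP \<in> Obj g \<Longrightarrow> pair_ge GP GP"
  using pair_geI[OF contr_id[OF ObjD(1)]] by (cases GP) simp

lemma pair_ge_trans:
  assumes "GP \<in> Obj g" "pair_ge GP GP'" "pair_ge GP' GP''"
  shows "pair_ge GP GP''"
proof -
  obtain S \<phi> \<psi> T \<phi>' \<psi>' where contracts: "contr (fst GP) (snd GP) (fst GP') (snd GP') S \<phi> \<psi>"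
    and contracts': "contr (fst GP') (snd GP') (fst GP'') (snd GP'') T \<phi>' \<psi>'"
    using assms(2,3) by (auto simp: pair_ge_def)
  interpret contraction "fst GP" "snd GP" "fst GP'" "snd GP'" S \<phi> \<psi>
    using contraction_of_Obj[OF _ contracts] assms(1) by simp
  show ?thesis using contr_compose[OF contracts'] by (metis pair_ge_def)
qed

lemma pair_iso_sym:
  assumes "GP \<in> Obj g" "pair_iso GP GP'"
  shows "pair_iso GP' GP"
proof -
  obtain G P G' P' \<phi> \<psi> where eq: "GP = (G, P)" "GP' = (G', P')"
    and contracts: "contr G P G' P' {} \<phi> \<psi>"
    using assms(2) by (cases GP; cases GP') (auto simp: pair_iso_def)
  interpret contraction G P G' P' "{}" \<phi> \<psi> using contraction_of_Obj assms(1) contracts eq by blast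
  obtain \<phi>' \<psi>' where "contr G' P' G P (\<psi> ` ({} - {})) \<phi>' \<psi>'"
    by (rule contr_factor[OF contr_id[OF wf] order_refl])
  then show ?thesis by (auto simp: eq pair_iso_def)
qed

section \<open>Topology of the colimit\<close>

lemma cone_eq_PiE: "cone G = (\<Pi>\<^sub>E e\<in>UNIV. if e \<in> E G then {0..} else {0})"
  by (auto simp: cone_def PiE_iff if_split_mem2) (metis order_refl)

lemma cone_int_eq_PiE: "cone_int G = (\<Pi>\<^sub>E e\<in>UNIV. if e \<in> E G then {0<..} else {0})"
  by (auto simp: cone_int_def PiE_iff if_split_mem2)

lemma cone_int_subset: "cone_int G \<subseteq> cone G"
  using cone_int_imp_cone by blast

lemma cone_int_nonempty: "cone_int G \<noteq> {}"
proof -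
  have "(\<lambda>e. if e \<in> E G then 1 else 0) \<in> cone_int G" by (simp add: cone_int_def)
  then show ?thesis by blast
qed

lemma closure_cone_int: "closure (cone_int G) = cone G"
proof -
  have "closure (cone_int G) = (\<Pi>\<^sub>E e\<in>UNIV. closure (if e \<in> E G then {0<..} else {0}))"
    using closure_of_product_topology[of "\<lambda>_. euclidean" UNIV] cone_int_eq_PiE[of G]
    by (simp add: euclidean_product_topology)
  also have "\<dots> = cone G" unfolding cone_eq_PiE by (intro PiE_cong) simp
  finally show ?thesis .
qed

lemma connected_cone: "connected (cone G)"
  using connectedin_PiE[of "\<lambda>_. euclidean" UNIV "\<lambda>e. if e \<in> E G then {0..} else {0::real}"]
  by (simp add: euclidean_product_topology cone_eq_PiE)

lemma openin_cone_int:
  assumes "finite (E G)"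
  shows "openin (top_of_set (cone G)) (cone_int G)"
proof -
  have "open (\<Pi>\<^sub>E e\<in>UNIV. if e \<in> E G then {0<..} else UNIV :: real set)"
    using assms by (intro open_PiE) auto
  moreover have "cone_int G = cone G \<inter> (\<Pi>\<^sub>E e\<in>UNIV. if e \<in> E G then {0<..} else UNIV)"
    using cone_int_imp_cone[of _ G] by (auto simp: cone_int_def cone_def PiE_iff if_split_mem2)
  ultimately show ?thesis by (simp add: openin_open_Int)
qed

lemma continuous_on_kept_lengths: "continuous_on A (kept_lengths G S \<psi>)"
proof (rule continuous_on_coordinatewise_then_product)
  fix e'
  show "continuous_on A (\<lambda>y. kept_lengths G S \<psi> y e')"
    by (cases "e' \<in> \<psi> ` (E G - S)")
      (auto simp: kept_lengths_def
        intro: continuous_on_subset[OF continuous_on_product_coordinates])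
qed

lemma topspace_sumtop: "topspace (sumtop g) = Sigma (Obj g) (\<lambda>GP. cone (fst GP))"
  by (auto simp: sumtop_def)

lemma ceq_in_topspace:
  assumes "(a, b) \<in> ceq g" "a \<in> topspace (sumtop g)"
  shows "b \<in> topspace (sumtop g)"
proof -
  obtain n where "reduces g a n" using assms(2) reduces_exists by (fastforce simp: topspace_sumtop)
  then have "reduces g b n" by (rule ceq_reduces[OF assms(1)])
  then show ?thesis
    by (cases rule: reduces.cases)
      (auto simp: topspace_sumtop intro: iota_in_cone cone_int_imp_cone)
qed

lemma in_cls_self: "a \<in> cls g a"
  by (simp add: cls_def ceq_refl)

lemma cls_eq_iff: "cls g a = cls g b \<longleftrightarrow> (a, b) \<in> ceq g"
  unfolding cls_def using ceq_refl ceq_sym ceq_trans by blast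

lemma gen_rel_cls_eq: "(a, b) \<in> gen_rel g \<Longrightarrow> cls g a = cls g b"
  by (simp add: cls_eq_iff gen_rel_imp_ceq)

lemma reduces_cls_eq: "reduces g a n \<Longrightarrow> cls g a = cls g n"
  by (simp add: cls_eq_iff reduces_imp_ceq)

lemma Tg_eq_image: "Tg g = cls g ` topspace (sumtop g)"
  by (auto simp: Tg_def quotient_def cls_def)

lemma cls_in_Tg_iff: "cls g ((G, P), x) \<in> Tg g \<longleftrightarrow> (G, P) \<in> Obj g \<and> x \<in> cone G"
proof
  assume "cls g ((G, P), x) \<in> Tg g"
  then obtain a where "a \<in> topspace (sumtop g)" "(a, ((G, P), x)) \<in> ceq g"
    unfolding Tg_eq_image using cls_eq_iff by (metis imageE)
  from ceq_in_topspace[OF this(2,1)] show "(G, P) \<in> Obj g \<and> x \<in> cone G"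
    by (simp add: topspace_sumtop)
qed (simp add: Tg_eq_image topspace_sumtop)

lemma Union_eq_preimage_cls:
  assumes "U \<subseteq> Tg g"
  shows "\<Union>U = {a. cls g a \<in> U}"
proof (intro equalityI subsetI CollectI)
  fix a assume "a \<in> \<Union>U"
  then obtain b where "a \<in> cls g b" "cls g b \<in> U" using assms unfolding Tg_eq_image by blast
  moreover from this have "cls g a = cls g b" unfolding cls_eq_iff by (simp add: cls_def ceq_sym)
  ultimately show "cls g a \<in> U" by simp
qed (use in_cls_self in blast)

lemma istopology_Tg: "istopology (\<lambda>U. U \<subseteq> Tg g \<and> openin (sumtop g) (\<Union>U))"
  unfolding istopology_def
proof (intro conjI allI impI)
  fix A B assume "A \<subseteq> Tg g \<and> openin (sumtop g) (\<Union>A)" "B \<subseteq> Tg g \<and> openin (sumtop g) (\<Union>B)"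
  moreover from this have "\<Union>(A \<inter> B) = \<Union>A \<inter> \<Union>B"
    by (subst (1 2 3) Union_eq_preimage_cls) auto
  ultimately show "A \<inter> B \<subseteq> Tg g" "openin (sumtop g) (\<Union>(A \<inter> B))" by auto
next
  fix K assume K: "\<forall>A \<in> K. A \<subseteq> Tg g \<and> openin (sumtop g) (\<Union>A)"
  then show "\<Union>K \<subseteq> Tg g" by blast
  have "\<Union>(\<Union>K) = (\<Union>A \<in> K. \<Union>A)" by blast
  then show "openin (sumtop g) (\<Union>(\<Union>K))" using K by auto
qed

lemma openin_Ttop_iff:
  "openin (Ttop g) U \<longleftrightarrow> U \<subseteq> Tg g \<and>
     (\<forall>G P. (G, P) \<in> Obj g \<longrightarrow> openin (top_of_set (cone G)) {x. cls g ((G, P), x) \<in> U})"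
proof -
  let ?open = "\<lambda>U. U \<subseteq> Tg g \<and> openin (sumtop g) (\<Union>U)"
  have "openin (Ttop g) U \<longleftrightarrow> ?open U"
    using generate_topology_on_coarsest[OF istopology_Tg, of "{U. ?open U}" g U]
    by (auto simp: Ttop_def openin_topology_generated_by_iff intro: generate_topology_on.Basis)
  also have "\<dots> \<longleftrightarrow> U \<subseteq> Tg g \<and> openin (sumtop g) {a. cls g a \<in> U}"
    using Union_eq_preimage_cls by metis
  also have "\<dots> \<longleftrightarrow> U \<subseteq> Tg g \<and>
     (\<forall>G P. (G, P) \<in> Obj g \<longrightarrow> openin (top_of_set (cone G)) {x. cls g ((G, P), x) \<in> U})"
    using cls_in_Tg_iff by (auto simp: sumtop_def openin_sum_topology)
  finally show ?thesis .
qed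

lemma topspace_Ttop: "topspace (Ttop g) = Tg g"
proof -
  have "{x. cls g ((G, P), x) \<in> Tg g} = cone G" if "(G, P) \<in> Obj g" for G P
    using that by (auto simp: cls_in_Tg_iff)
  then have "openin (Ttop g) (Tg g)" by (simp add: openin_Ttop_iff)
  moreover have "topspace (Ttop g) \<subseteq> Tg g" using openin_Ttop_iff openin_topspace by blast
  ultimately show ?thesis using openin_subset by blast
qed

lemma continuous_map_cls:
  assumes "(G, P) \<in> Obj g"
  shows "continuous_map (top_of_set (cone G)) (Ttop g) (\<lambda>x. cls g ((G, P), x))"
  unfolding continuous_map_def topspace_Ttop
proof (intro conjI allI impI)
  show "(\<lambda>x. cls g ((G, P), x)) \<in> topspace (top_of_set (cone G)) \<rightarrow> Tg g"
    using assms by (auto simp: cls_in_Tg_iff)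
  fix U assume U: "openin (Ttop g) U"
  then have "{x \<in> cone G. cls g ((G, P), x) \<in> U} = {x. cls g ((G, P), x) \<in> U}"
    using cls_in_Tg_iff openin_Ttop_iff by blast
  then show "openin (top_of_set (cone G))
      {x \<in> topspace (top_of_set (cone G)). cls g ((G, P), x) \<in> U}"
    using U assms by (simp add: openin_Ttop_iff)
qed

lemma strat_eq_image: "strat g G P = (\<lambda>x. cls g ((G, P), x)) ` cone_int G"
  by (auto simp: strat_def)

lemma strat_subset_Tg: "(G, P) \<in> Obj g \<Longrightarrow> strat g G P \<subseteq> Tg g"
  using cone_int_imp_cone by (auto simp: strat_eq_image cls_in_Tg_iff)

lemma Tg_eq_strata: "Tg g = (\<Union>GP \<in> Obj g. strat g (fst GP) (snd GP))"
proof
  show "(\<Union>GP \<in> Obj g. strat g (fst GP) (snd GP)) \<subseteq> Tg g" using strat_subset_Tg by force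
  show "Tg g \<subseteq> (\<Union>GP \<in> Obj g. strat g (fst GP) (snd GP))"
  proof
    fix c assume "c \<in> Tg g"
    then obtain G P x where c_eq: "c = cls g ((G, P), x)" "(G, P) \<in> Obj g" "x \<in> cone G"
      by (auto simp: Tg_eq_image topspace_sumtop)
    then obtain H Q z where red: "reduces g ((G, P), x) ((H, Q), z)"
      using reduces_exists by (metis surj_pair)
    then have "c = cls g ((H, Q), z)" using c_eq(1) reduces_cls_eq by blast
    then have "c \<in> strat g H Q" using reduces_Obj(3)[OF red] by (auto simp: strat_eq_image)
    then show "c \<in> (\<Union>GP \<in> Obj g. strat g (fst GP) (snd GP))" using reduces_Obj(2)[OF red] by force
  qed
qed

lemma strat_iso_subset:
  assumes "GP \<in> Obj g" "GP' \<in> Obj g" "pair_iso GP GP'"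
  shows "strat g (fst GP') (snd GP') \<subseteq> strat g (fst GP) (snd GP)"
proof -
  obtain G P G' P' \<phi> \<psi> where eq: "GP = (G, P)" "GP' = (G', P')"
    and contracts: "contr G P G' P' {} \<phi> \<psi>"
    using assms(3) by (cases GP; cases GP') (auto simp: pair_iso_def)
  interpret contraction G P G' P' "{}" \<phi> \<psi> using contraction_of_Obj assms(1) contracts eq by blast
  have "cls g ((G', P'), x) = cls g ((G, P), iota G {} \<psi> x)" if "x \<in> cone_int G'" for x
    using assms(1,2) contracts that cone_int_subset
    unfolding eq by (intro gen_rel_cls_eq) (auto simp: gen_rel_iff)
  then show ?thesis using iota_in_cone_int by (auto simp: eq strat_eq_image)
qed

lemma strat_iso:
  assumes "GP \<in> Obj g" "GP' \<in> Obj g" "pair_iso GP GP'"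
  shows "strat g (fst GP) (snd GP) = strat g (fst GP') (snd GP')"
  using strat_iso_subset assms pair_iso_sym by (intro equalityI) blast+

lemma strat_disjoint:
  assumes "GP \<in> Obj g" "GP' \<in> Obj g" "\<not> pair_iso GP GP'"
  shows "strat g (fst GP) (snd GP) \<inter> strat g (fst GP') (snd GP') = {}"
  using assms ceq_interior_iff[of "fst GP" "snd GP" g "fst GP'" "snd GP'"]
  by (auto simp: strat_eq_image cls_eq_iff pair_iso_def)

text \<open>For \<open>A\<close> open in the interior of the cone of \<open>(G, P)\<close> this is an open union of classes which
  traces \<open>A\<close> (up to automorphisms) on that stratum.\<close>

definition star :: "nat \<Rightarrow> sgraph \<Rightarrow> nat set \<Rightarrow> (nat \<Rightarrow> real) set \<Rightarrow> cpt set" where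
  "star g G P A = {((G', P'), y) | G' P' y. (G', P') \<in> Obj g \<and> y \<in> cone G' \<and>
     (\<exists>S \<phi> \<psi>. contr G' P' G P S \<phi> \<psi> \<and> kept_lengths G' S \<psi> y \<in> A)}"

lemma in_star_iff:
  "((G', P'), y) \<in> star g G P A \<longleftrightarrow> (G', P') \<in> Obj g \<and> y \<in> cone G' \<and>
     (\<exists>S \<phi> \<psi>. contr G' P' G P S \<phi> \<psi> \<and> kept_lengths G' S \<psi> y \<in> A)"
  by (simp add: star_def)

lemma in_star_self:
  assumes obj: "(G, P) \<in> Obj g" and A: "A \<subseteq> cone_int G" and x: "x \<in> A"
  shows "((G, P), x) \<in> star g G P A"
proof -
  have contracts: "contr G P G P {} id id" by (rule contr_id[OF ObjD(1)[OF obj]])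
  interpret contraction G P G P "{}" id id by (rule contraction_of_Obj[OF obj contracts])
  have "x \<in> cone G" using A x cone_int_subset by blast
  moreover from this have "kept_lengths G {} id x = x" using kept_lengths_iota[of x] iota_id by simp
  ultimately show ?thesis using obj contracts x unfolding in_star_iff by metis
qed

lemma in_star_reduces_iff:
  assumes red: "reduces g b n" and A: "A \<subseteq> cone_int G"
  shows "b \<in> star g G P A \<longleftrightarrow> n \<in> star g G P A"
proof -
  obtain G' P' y H Q z where eq: "b = ((G', P'), y)" "n = ((H, Q), z)" by (metis surj_pair)
  note obj = reduces_Obj[OF red[unfolded eq]]
  obtain Z \<phi>' \<psi>' where "contraction G' P' H Q Z \<phi>' \<psi>'" and y: "y = iota G' Z \<psi>' z"
    using reducesE[OF red[unfolded eq]] .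
  then interpret contraction G' P' H Q Z \<phi>' \<psi>' by simp
  have z: "z \<in> cone H"
    and y_cone: "y \<in> cone G'" using obj(3) cone_int_subset iota_in_cone y by blast+
  show ?thesis
  proof
    assume "b \<in> star g G P A"
    then obtain S \<phi> \<psi> where contracts: "contr G' P' G P S \<phi> \<psi>"
      and kept_in_A: "kept_lengths G' S \<psi> y \<in> A"
      unfolding eq in_star_iff by blast
    interpret to_G: contraction G' P' G P S \<phi> \<psi> by (rule contraction_of_Obj[OF obj(1) contracts])
    have "y e \<noteq> 0" if "e \<in> E G' - S" for e
      using subsetD[OF A kept_in_A] to_G.kept_lengths_apply[OF that, of y]
        bij_betw_apply[OF to_G.edge_bij that]
      by (auto simp: cone_int_def)
    then have Z_subset: "Z \<subseteq> S" using iota_zero_set[OF obj(3)] unfolding y by blast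
    then obtain \<phi>'' \<psi>'' where contracts'': "contr H Q G P (\<psi>' ` (S - Z)) \<phi>'' \<psi>''"
      and \<psi>'': "\<And>e. e \<in> E G' - Z \<Longrightarrow> \<psi>'' (\<psi>' e) = \<psi> e"
      using contr_factor[OF contracts] by blast
    have "kept_lengths H (\<psi>' ` (S - Z)) \<psi>'' z \<in> A"
      using kept_lengths_factor[OF Z_subset contracts contracts'' \<psi>'', of z] kept_in_A y by simp
    then show "n \<in> star g G P A" unfolding eq in_star_iff using obj(2) z contracts'' by blast
  next
    assume "n \<in> star g G P A"
    then obtain S \<phi> \<psi> where contracts: "contr H Q G P S \<phi> \<psi>"
      and kept_in_A: "kept_lengths H S \<psi> z \<in> A"
      unfolding eq in_star_iff by blast
    obtain T where T: "Z \<subseteq> T" "\<psi>' ` (T - Z) = S" "contr G' P' G P T (\<phi> \<circ> \<phi>') (\<psi> \<circ> \<psi>')"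
      using contr_compose[OF contracts] .
    have "kept_lengths G' T (\<psi> \<circ> \<psi>') y \<in> A"
      using kept_lengths_factor[OF T(1,3), of \<phi> \<psi> z] T(2) contracts kept_in_A y by simp
    then show "b \<in> star g G P A" unfolding eq in_star_iff using obj(1) y_cone T(3) by blast
  qed
qed

lemma cls_in_star_iff:
  assumes A: "A \<subseteq> cone_int G"
  shows "cls g b \<in> cls g ` star g G P A \<longleftrightarrow> b \<in> star g G P A"
proof
  assume "cls g b \<in> cls g ` star g G P A"
  then obtain a where in_star: "a \<in> star g G P A" "(a, b) \<in> ceq g"
    using cls_eq_iff by (metis imageE ceq_sym)
  then obtain n where n: "reduces g a n" using reduces_exists unfolding star_def by blast
  then show "b \<in> star g G P A"
    using ceq_reduces[OF in_star(2) n] in_star_reduces_iff[OF _ A] in_star(1) by blast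
qed blast

lemma openin_star:
  assumes A: "openin (top_of_set (cone_int G)) A" and finite_E: "finite (E G)"
  shows "openin (Ttop g) (cls g ` star g G P A)"
  unfolding openin_Ttop_iff
proof (intro conjI allI impI)
  show "cls g ` star g G P A \<subseteq> Tg g"
    unfolding Tg_eq_image topspace_sumtop star_def by (intro image_mono) auto
  fix G' P' assume obj: "(G', P') \<in> Obj g"
  let ?k = "kept_lengths G'"
  have A_cone: "openin (top_of_set (cone G)) A"
    by (rule openin_trans[OF A openin_cone_int[OF finite_E]])
  have "openin (top_of_set (cone G')) {y \<in> cone G'. ?k S \<psi> y \<in> A}"
    if contracts: "contr G' P' G P S \<phi> \<psi>" for S \<phi> \<psi>
  proof -
    interpret contraction G' P' G P S \<phi> \<psi> by (rule contraction_of_Obj[OF obj contracts])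
    have "?k S \<psi> y \<in> cone G" if "y \<in> cone G'" for y
      using that edge_image by (auto simp: kept_lengths_def cone_def)
    then have "continuous_map (top_of_set (cone G')) (top_of_set (cone G)) (?k S \<psi>)"
      using continuous_on_kept_lengths by (intro continuous_map_into_subtopology) auto
    from openin_continuous_map_preimage[OF this A_cone] show ?thesis by simp
  qed
  then have "openin (top_of_set (cone G'))
      (\<Union>(S, \<phi>, \<psi>) \<in> {(S, \<phi>, \<psi>). contr G' P' G P S \<phi> \<psi>}. {y \<in> cone G'. ?k S \<psi> y \<in> A})"
    by (intro openin_Union) auto
  also have "(\<Union>(S, \<phi>, \<psi>) \<in> {(S, \<phi>, \<psi>). contr G' P' G P S \<phi> \<psi>}. {y \<in> cone G'. ?k S \<psi> y \<in> A})
      = {y. cls g ((G', P'), y) \<in> cls g ` star g G P A}"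
    using obj unfolding cls_in_star_iff[OF openin_imp_subset[OF A]] in_star_iff by auto
  finally show "openin (top_of_set (cone G')) {y. cls g ((G', P'), y) \<in> cls g ` star g G P A}" .
qed

lemma star_Int_strat:
  assumes obj: "(G, P) \<in> Obj g" and A: "A \<subseteq> cone_int G"
  shows "cls g ` star g G P A \<inter> strat g G P = (\<lambda>x. cls g ((G, P), x)) ` A"
proof (intro equalityI subsetI)
  fix c assume "c \<in> cls g ` star g G P A \<inter> strat g G P"
  then obtain x where x: "x \<in> cone_int G" "c = cls g ((G, P), x)" and "c \<in> cls g ` star g G P A"
    by (auto simp: strat_eq_image)
  then have "((G, P), x) \<in> star g G P A" using cls_in_star_iff[OF A] by blast
  then obtain S \<phi> \<psi> where contracts: "contr G P G P S \<phi> \<psi>" and kept_in_A: "kept_lengths G S \<psi> x \<in> A"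
    unfolding in_star_iff by blast
  interpret contraction G P G P S \<phi> \<psi> by (rule contraction_of_Obj[OF obj contracts])
  have "card (E G - S) = card (E G)" using bij_betw_same_card[OF edge_bij] .
  then have S: "S = {}"
    using card_subset_eq[of "E G" "E G - S"] ObjD(8)[OF obj] contracted_subset by auto
  have "x = iota G {} \<psi> (kept_lengths G S \<psi> x)"
    using x(1) kept_lengths_apply[of _ x] by (auto simp: iota_def S cone_int_def)
  moreover have "kept_lengths G S \<psi> x \<in> cone G" using kept_in_A A cone_int_subset by blast
  ultimately have "cls g ((G, P), kept_lengths G S \<psi> x) = c"
    unfolding x(2) using obj contracts S by (intro gen_rel_cls_eq) (auto simp: gen_rel_iff)
  then show "c \<in> (\<lambda>x. cls g ((G, P), x)) ` A" using kept_in_A by blast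
qed (use in_star_self[OF obj A] A in \<open>auto simp: strat_eq_image\<close>)

lemma quotient_map_strat:
  assumes obj: "(G, P) \<in> Obj g"
  shows "quotient_map (top_of_set (cone_int G)) (subtopology (Ttop g) (strat g G P))
      (\<lambda>x. cls g ((G, P), x))"
    (is "quotient_map ?X ?Y ?q")
proof (rule continuous_open_imp_quotient_map)
  show "continuous_map ?X ?Y ?q"
    using continuous_map_from_subtopology_mono[OF continuous_map_cls[OF obj] cone_int_subset]
    by (rule continuous_map_into_subtopology) (auto simp: strat_eq_image)
  show "open_map ?X ?Y ?q"
    unfolding open_map_def
  proof (intro allI impI)
    fix A assume A: "openin ?X A"
    have "?q ` A = strat g G P \<inter> cls g ` star g G P A"
      using star_Int_strat[OF obj openin_imp_subset[OF A]] by blast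
    then show "openin ?Y (?q ` A)"
      using openin_star[OF A ObjD(8)[OF obj]] by (simp add: openin_subtopology_Int2)
  qed
  show "?q ` topspace ?X = topspace ?Y"
    using strat_subset_Tg[OF obj] by (auto simp: topspace_Ttop strat_eq_image)
qed

lemma cls_eq_on_stratum_iff:
  assumes "(G, P) \<in> Obj g" "x \<in> cone_int G" "y \<in> cone_int G"
  shows "cls g ((G, P), x) = cls g ((G, P), y) \<longleftrightarrow> (\<exists>\<phi> \<psi>. contr G P G P {} \<phi> \<psi> \<and> y = iota G {} \<psi> x)"
  using ceq_interior_iff[OF assms(1,1,3,2)] cls_eq_iff by metis

lemma strat_closure_imp_pair_ge:
  assumes obj: "(G', P') \<in> Obj g" and closure: "strat g G' P' \<subseteq> Ttop g closure_of strat g G P"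
  shows "pair_ge (G, P) (G', P')"
proof -
  let ?U = "cls g ` star g G' P' (cone_int G')"
  obtain x' where x': "x' \<in> cone_int G'" using cone_int_nonempty by blast
  have "openin (Ttop g) ?U" by (rule openin_star[OF openin_subtopology_self ObjD(8)[OF obj]])
  moreover have "cls g ((G', P'), x') \<in> ?U" using in_star_self[OF obj order_refl x'] by blast
  moreover have "cls g ((G', P'), x') \<in> Ttop g closure_of strat g G P"
    using closure x' by (auto simp: strat_eq_image)
  ultimately obtain c where "c \<in> strat g G P" "c \<in> ?U" unfolding in_closure_of by blast
  then obtain x where "cls g ((G, P), x) \<in> ?U" by (auto simp: strat_eq_image)
  then have "((G, P), x) \<in> star g G' P' (cone_int G')" unfolding cls_in_star_iff[OF order_refl] .
  then show ?thesis by (auto simp: in_star_iff intro: pair_geI)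
qed

lemma pair_ge_imp_strat_closure:
  assumes obj: "(G, P) \<in> Obj g" "(G', P') \<in> Obj g" and ge: "pair_ge (G, P) (G', P')"
  shows "strat g G' P' \<subseteq> Ttop g closure_of strat g G P"
proof
  obtain S \<phi> \<psi> where contracts: "contr G P G' P' S \<phi> \<psi>" using ge by (auto simp: pair_ge_def)
  fix c assume "c \<in> strat g G' P'"
  then obtain x'
    where x': "x' \<in> cone_int G'" "c = cls g ((G', P'), x')" by (auto simp: strat_eq_image)
  have "x' \<in> cone G'" using x'(1) cone_int_subset by blast
  then have "iota G S \<psi> x' \<in> top_of_set (cone G) closure_of cone_int G"
    using iota_in_cone cone_int_subset[of G]
    by (simp add: closure_of_subtopology Int_absorb1 closure_cone_int)
  moreover have "c = cls g ((G, P), iota G S \<psi> x')"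
    unfolding x'(2)
    using obj contracts \<open>x' \<in> cone G'\<close> by (intro gen_rel_cls_eq) (auto simp: gen_rel_iff)
  ultimately show "c \<in> Ttop g closure_of strat g G P"
    unfolding strat_eq_image
    using continuous_map_image_closure_subset[OF continuous_map_cls[OF obj(1)]] by blast
qed

definition point_graph :: "nat \<Rightarrow> sgraph" where
  "point_graph g = \<lparr>V = {0}, E = {}, ends = \<lambda>_. (0, 0), wt = \<lambda>_. g\<rparr>"

lemma point_graph_Obj: "g \<ge> 2 \<Longrightarrow> (point_graph g, {}) \<in> Obj g"
  by (auto simp: Obj_def point_graph_def stable_graph_def genus_def cyc_def deg_def degP_def)

lemma contr_point_graph:
  assumes obj: "(G, P) \<in> Obj g"
  shows "contr G P (point_graph g) {} (E G) (\<lambda>_. 0) id"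
proof -
  have "int g - 1 = reduced_genus G (E G) (V G)"
    using ObjD(1,4)[OF obj] genus_eq_reduced_genus by fastforce
  moreover have "V G \<noteq> {}" "\<forall>u \<in> V G. \<forall>v \<in> V G. (u, v) \<in> (adj G (E G))\<^sup>*"
    using ObjD(2)[OF obj] by (simp_all add: connected_graph_def)
  ultimately show ?thesis
    unfolding contr_iff[OF ObjD(1)[OF obj]] using ObjD(6)[OF obj]
    by (auto simp: point_graph_def endpoints_def)
qed

lemma connected_space_Ttop:
  assumes "g \<ge> 2"
  shows "connected_space (Ttop g)"
proof -
  let ?im = "\<lambda>(G, P). (\<lambda>x. cls g ((G, P), x)) ` cone G"
  have "connectedin (Ttop g) (?im (G, P))" if "(G, P) \<in> Obj g" for G P
  proof -
    have "connectedin (top_of_set (cone G)) (cone G)"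
      using connected_cone by (simp add: connectedin_subtopology)
    then show ?thesis using connectedin_continuous_map_image[OF continuous_map_cls[OF that]] by simp
  qed
  moreover have "cls g ((point_graph g, {}), \<lambda>_. 0) \<in> ?im (G, P)" if obj: "(G, P) \<in> Obj g" for G P
  proof -
    have zero: "(\<lambda>_. 0) \<in> cone H" for H by (simp add: cone_def)
    have "cls g ((point_graph g, {}), \<lambda>_. 0) = cls g ((G, P), iota G (E G) id (\<lambda>_. 0))"
      using obj point_graph_Obj[OF assms] contr_point_graph[OF obj] zero
      by (intro gen_rel_cls_eq) (auto simp: gen_rel_iff)
    then show ?thesis using iota_in_cone[OF zero] by auto
  qed
  moreover from this have "\<Inter>(?im ` Obj g) \<noteq> {}" by blast
  ultimately have "connectedin (Ttop g) (\<Union>(?im ` Obj g))" by (intro connectedin_Union) blast+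
  moreover have "\<Union>(?im ` Obj g) = topspace (Ttop g)"
    unfolding topspace_Ttop Tg_eq_image topspace_sumtop by force
  ultimately show ?thesis by (simp add: connectedin_topspace)
qed

section \<open>Dimension\<close>

lemma card_E_le:
  assumes obj: "(G, P) \<in> Obj g"
  shows "card (E G) \<le> 3 * g - 3"
proof -
  have "(\<Sum>v \<in> V G. (1::int)) \<le> (\<Sum>v \<in> V G. canon_deg G v)"
    using ObjD(3)[OF obj] by (intro sum_mono) force
  then have "int (card (V G)) \<le> 2 * int g - 2"
    using sum_canon_deg[OF ObjD(1)[OF obj]] ObjD(4)[OF obj] by simp
  moreover have "0 \<le> (\<Sum>v \<in> V G. int (wt G v))" by (intro sum_nonneg) simp
  ultimately have "int (card (E G)) \<le> 3 * int g - 3"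
    using ObjD(4)[OF obj] unfolding genus_def by linarith
  then show ?thesis by linarith
qed

lemma degP_insert:
  assumes "finite Q" "n \<notin> Q"
  shows "degP G (insert n Q) u
    = degP G Q u + of_bool (fst (ends G n) = u) + of_bool (snd (ends G n) = u)"
proof -
  have "card {e \<in> insert n Q. R e} = card {e \<in> Q. R e} + of_bool (R n)" for R
  proof -
    have "{e \<in> insert n Q. R e} = (if R n then insert n {e \<in> Q. R e} else {e \<in> Q. R e})" by auto
    then show ?thesis using assms by simp
  qed
  then show ?thesis unfolding degP_def by simp
qed

definition add_loop :: "sgraph \<Rightarrow> nat \<Rightarrow> nat \<Rightarrow> sgraph" where
  "add_loop G v n = \<lparr>V = V G, E = insert n (E G), ends = (ends G)(n := (v, v)),
     wt = (wt G)(v := wt G v - 1)\<rparr>"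

locale loop_addition =
  fixes G :: sgraph and v n :: nat
  assumes wf: "wf_graph G" and vertex: "v \<in> V G" "1 \<le> wt G v" and new_edge: "n \<notin> E G"
begin

abbreviation "G\<^sub>1 \<equiv> add_loop G v n"

lemma wf_add_loop: "wf_graph G\<^sub>1"
  using wf vertex(1) by (auto simp: wf_graph_def add_loop_def endpoints_def)

lemma degP_add_loop: "Q \<subseteq> E G \<Longrightarrow> degP G\<^sub>1 Q u = degP G Q u"
  using new_edge unfolding degP_def
  by (auto simp: add_loop_def intro!: arg_cong2[of _ _ _ _ "(+)"] arg_cong[of _ _ card])

lemma canon_deg_add_loop: "canon_deg G\<^sub>1 u = canon_deg G u"
proof -
  have "deg G\<^sub>1 u = deg G u + 2 * of_bool (u = v)"
    using degP_insert[of "E G" n G\<^sub>1 u] degP_add_loop[of "E G" u] new_edge wf_graphD(2)[OF wf]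
    by (auto simp: deg_def add_loop_def)
  then show ?thesis using vertex(2) by (auto simp: canon_deg_def add_loop_def of_nat_diff)
qed

lemma contr_add_loop:
  assumes "P \<subseteq> E G"
  shows "contr G\<^sub>1 P G P {n} id id"
proof -
  have "int (wt G w) - 1 = reduced_genus G\<^sub>1 {n} {u \<in> V G\<^sub>1. id u = w}" if "w \<in> V G" for w
  proof -
    have "{u \<in> V G\<^sub>1. id u = w} = {w}" using that by (auto simp: add_loop_def)
    moreover have "{e \<in> {n}. endpoints G\<^sub>1 e \<subseteq> {w}} = (if w = v then {n} else {})"
      by (auto simp: add_loop_def endpoints_def)
    ultimately show ?thesis
      using vertex(2) by (simp add: reduced_genus_def add_loop_def of_nat_diff)
  qed
  then show ?thesis
    unfolding contr_iff[OF wf_add_loop]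
    using new_edge assms by (auto simp: add_loop_def endpoints_def)
qed

end

definition split_vertex :: "sgraph \<Rightarrow> nat \<Rightarrow> (nat \<times> bool) set \<Rightarrow> nat \<Rightarrow> nat \<Rightarrow> sgraph" where
  "split_vertex G v A m n = \<lparr>V = insert m (V G), E = insert n (E G),
     ends = (\<lambda>e. let move = (\<lambda>b u. if (e, b) \<in> A then m else u)
                 in map_prod (move False) (move True) (ends G e))(n := (v, m)),
     wt = (wt G)(m := 0)\<rparr>"

locale vertex_splitting =
  fixes G :: sgraph and v :: nat and A :: "(nat \<times> bool) set" and m n :: nat
  assumes wf: "wf_graph G" and vertex: "v \<in> V G" and moved_subset: "A \<subseteq> half_edges G (E G) v"
    and new_vertex: "m \<notin> V G" and new_edge: "n \<notin> E G"
begin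

abbreviation "G\<^sub>1 \<equiv> split_vertex G v A m n"

definition lift_cycle :: "nat set \<Rightarrow> nat set" where
  "lift_cycle P = (if odd (card (A \<inter> P \<times> UNIV)) then insert n P else P)"

lemma V_split: "V G\<^sub>1 = insert m (V G)" and E_split: "E G\<^sub>1 = insert n (E G)"
  and wt_split: "wt G\<^sub>1 = (wt G)(m := 0)" and ends_split_new: "ends G\<^sub>1 n = (v, m)"
  by (simp_all add: split_vertex_def)

lemma v_neq_m: "v \<noteq> m"
  using vertex new_vertex by blast

lemma origin_split: "e \<in> E G \<Longrightarrow> origin G\<^sub>1 (e, b) = (if (e, b) \<in> A then m else origin G (e, b))"
  using new_edge by (auto simp: origin_def split_vertex_def map_prod_def split_beta)

lemma wf_split: "wf_graph G\<^sub>1"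
proof -
  have "endpoints G\<^sub>1 e \<subseteq> V G\<^sub>1" if "e \<in> E G\<^sub>1" for e
  proof (cases "e = n")
    case True
    then show ?thesis using vertex by (simp add: endpoints_def ends_split_new V_split)
  next
    case False
    then show ?thesis
      using that origin_in_V[OF wf]
      by (auto simp: endpoints_eq_origins origin_split V_split E_split)
  qed
  then show ?thesis using wf by (simp add: wf_graph_def V_split E_split)
qed

lemma half_edges_split:
  assumes "Q \<subseteq> E G"
  shows "half_edges G\<^sub>1 Q u = (if u = m then A \<inter> Q \<times> UNIV else half_edges G Q u - A)"
proof -
  have "origin G\<^sub>1 (e, b) = (if (e, b) \<in> A then m else origin G (e, b))" "origin G (e, b) \<noteq> m"
    if "e \<in> Q" for e b
    using assms that origin_split origin_in_V[OF wf] new_vertex by blast+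
  then show ?thesis
    using vertex new_vertex moved_subset by (auto simp: half_edges_def split: if_splits)
qed

lemma degP_split:
  assumes Q: "Q \<subseteq> E G" and u: "u \<noteq> m"
  shows "degP G\<^sub>1 Q u + (if u = v then card (A \<inter> Q \<times> UNIV) else 0) = degP G Q u"
proof -
  have finite_Q: "finite Q" using Q wf_graphD(2)[OF wf] finite_subset by blast
  have moved: "half_edges G Q u \<inter> A = (if u = v then A \<inter> Q \<times> UNIV else {})"
    using moved_subset by (auto simp: half_edges_def)
  have "card (half_edges G Q u) = card (half_edges G Q u - A) + card (half_edges G Q u \<inter> A)"
    using finite_half_edges[OF finite_Q] by (simp add: card_Diff_subset_Int card_mono)
  then show ?thesis
    using u finite_Q by (simp add: degP_eq_card_half_edges half_edges_split[OF Q] moved)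
qed

lemma degP_split_new: "Q \<subseteq> E G \<Longrightarrow> degP G\<^sub>1 Q m = card (A \<inter> Q \<times> UNIV)"
  using wf_graphD(2)[OF wf] finite_subset by (metis degP_eq_card_half_edges half_edges_split)

lemma degP_split_insert:
  assumes "Q \<subseteq> E G"
  shows "degP G\<^sub>1 (insert n Q) u = degP G\<^sub>1 Q u + of_bool (u = v) + of_bool (u = m)"
proof -
  have "finite Q" "n \<notin> Q" using assms wf_graphD(2)[OF wf] finite_subset new_edge by blast+
  then show ?thesis by (auto simp: degP_insert ends_split_new)
qed

lemma canon_deg_split:
  "canon_deg G\<^sub>1 m = int (card A) - 1"
  "canon_deg G\<^sub>1 v = canon_deg G v + 1 - int (card A)"
  "u \<noteq> m \<Longrightarrow> u \<noteq> v \<Longrightarrow> canon_deg G\<^sub>1 u = canon_deg G u"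
proof -
  have A_E: "A \<inter> E G \<times> UNIV = A" using moved_subset by (auto simp: half_edges_def)
  have deg: "deg G\<^sub>1 u = degP G\<^sub>1 (E G) u + of_bool (u = v) + of_bool (u = m)" for u
    unfolding deg_def E_split by (rule degP_split_insert[OF order_refl])
  show "canon_deg G\<^sub>1 m = int (card A) - 1" "canon_deg G\<^sub>1 v = canon_deg G v + 1 - int (card A)"
    using v_neq_m degP_split_new[OF order_refl] degP_split[OF order_refl, of v]
    by (simp_all add: canon_deg_def deg wt_split A_E deg_def[of G])
  show "canon_deg G\<^sub>1 u = canon_deg G u" if "u \<noteq> m" "u \<noteq> v"
    using that degP_split[OF order_refl, of u]
    by (simp add: canon_deg_def deg wt_split deg_def[of G])
qed

lemma cyc_lift_cycle:
  assumes "cyc G P"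
  shows "cyc G\<^sub>1 (lift_cycle P)"
  unfolding cyc_def
proof (intro conjI ballI)
  have P: "P \<subseteq> E G" using assms by (simp add: cyc_def)
  then show "lift_cycle P \<subseteq> E G\<^sub>1" by (auto simp: lift_cycle_def E_split)
  fix u assume "u \<in> V G\<^sub>1"
  then have even: "even (degP G P u)" if "u \<noteq> m" using that assms by (auto simp: cyc_def V_split)
  have "degP G\<^sub>1 (lift_cycle P) u = degP G\<^sub>1 P u
      + (if odd (card (A \<inter> P \<times> UNIV)) then of_bool (u = v) + of_bool (u = m) else 0)"
    using degP_split_insert[OF P] by (simp add: lift_cycle_def)
  moreover have "even (degP G\<^sub>1 P u) \<longleftrightarrow> even (if u = v \<or> u = m then card (A \<inter> P \<times> UNIV) else 0)"
  proof (cases "u = m")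
    case True
    then show ?thesis using degP_split_new[OF P] by simp
  next
    case False
    then have "even (degP G\<^sub>1 P u + (if u = v then card (A \<inter> P \<times> UNIV) else 0))"
      using even degP_split[OF P] by simp
    then show ?thesis using False by (simp split: if_splits)
  qed
  ultimately show "even (degP G\<^sub>1 (lift_cycle P) u)" using v_neq_m by auto
qed

lemma contr_split:
  assumes P: "P \<subseteq> E G"
  shows "contr G\<^sub>1 (lift_cycle P) G P {n} (id(m := v)) id"
proof -
  let ?\<phi> = "id(m := v)"
  have new: "endpoints G\<^sub>1 n = {v, m}" by (simp add: endpoints_def ends_split_new)
  have "(a, b) \<in> (adj G\<^sub>1 {n})\<^sup>*" if "?\<phi> a = ?\<phi> b" for a b
  proof -
    have "(v, m) \<in> adj G\<^sub>1 {n}" "(m, v) \<in> adj G\<^sub>1 {n}" using new by (auto simp: adj_iff)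
    then show ?thesis using that by (auto split: if_splits)
  qed
  moreover have "endpoints G e = ?\<phi> ` endpoints G\<^sub>1 e" if e: "e \<in> E G" for e
  proof -
    have "?\<phi> (origin G\<^sub>1 (e, b)) = origin G (e, b)" for b
      using e moved_subset origin_in_V[OF wf e, of b] new_vertex
      by (auto simp: origin_split half_edges_def)
    then show ?thesis unfolding endpoints_eq_origins image_image by simp
  qed
  moreover have "int (wt G w) - 1 = reduced_genus G\<^sub>1 {n} {u \<in> V G\<^sub>1. ?\<phi> u = w}"
    if w: "w \<in> V G" for w
  proof (cases "w = v")
    case True
    then have "{u \<in> V G\<^sub>1. ?\<phi> u = w} = {v, m}" using vertex by (auto simp: V_split)
    moreover have "{e \<in> {n}. endpoints G\<^sub>1 e \<subseteq> {v, m}} = {n}" using new by auto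
    ultimately show ?thesis using True v_neq_m by (simp add: reduced_genus_def wt_split)
  next
    case False
    then have "{u \<in> V G\<^sub>1. ?\<phi> u = w} = {w}" using w new_vertex by (auto simp: V_split)
    moreover have "{e \<in> {n}. endpoints G\<^sub>1 e \<subseteq> {w}} = {}" using new v_neq_m by auto
    moreover have "w \<noteq> m" using w new_vertex by blast
    ultimately show ?thesis by (simp add: reduced_genus_def wt_split)
  qed
  moreover have "?\<phi> ` V G\<^sub>1 = V G" using vertex new_vertex by (auto simp: V_split image_iff)
  moreover have "P = id ` (lift_cycle P - {n})" using P new_edge by (auto simp: lift_cycle_def)
  ultimately show ?thesis
    unfolding contr_iff[OF wf_split] using new_edge new v_neq_m by (auto simp: E_split)
qed

end

definition expansion :: "nat \<Rightarrow> sgraph \<times> nat set \<Rightarrow> sgraph \<times> nat set \<Rightarrow> bool" where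
  "expansion g GP GP' \<longleftrightarrow> GP' \<in> Obj g \<and> card (E (fst GP')) = Suc (card (E (fst GP))) \<and> pair_ge GP' GP"

lemma expansion_of_positive_weight:
  assumes obj: "(G, P) \<in> Obj g" and weight: "v \<in> V G" "1 \<le> wt G v"
  shows "\<exists>GP'. expansion g (G, P) GP'"
proof -
  obtain n where n: "n \<notin> E G" using ex_new_if_finite[OF infinite_UNIV_nat ObjD(8)[OF obj]] by blast
  interpret loop_addition G v n by unfold_locales (use ObjD(1)[OF obj] weight n in auto)
  note contracts = contr_add_loop[OF ObjD(6)[OF obj]]
  interpret contraction G\<^sub>1 P G P "{n}" id id
    by unfold_locales (use wf_add_loop contracts ObjD(6)[OF obj] in \<open>auto simp: add_loop_def\<close>)
  have "cyc G\<^sub>1 P" using ObjD(5,6)[OF obj] degP_add_loop by (auto simp: cyc_def add_loop_def)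
  then have "(G\<^sub>1, P) \<in> Obj g"
    using ObjD(3)[OF obj] canon_deg_add_loop
    by (intro Obj_preimage[OF obj]) (auto simp: add_loop_def)
  moreover have "card (E G\<^sub>1) = Suc (card (E G))"
    using n ObjD(8)[OF obj] by (simp add: add_loop_def)
  ultimately show ?thesis
    using pair_geI[OF contracts] by (auto simp: expansion_def simp del: split_paired_Ex)
qed

lemma expansion_of_large_valence:
  assumes obj: "(G, P) \<in> Obj g" and valence: "v \<in> V G" "2 \<le> canon_deg G v" "2 \<le> deg G v"
  shows "\<exists>GP'. expansion g (G, P) GP'"
proof -
  obtain n where n: "n \<notin> E G" using ex_new_if_finite[OF infinite_UNIV_nat ObjD(8)[OF obj]] by blast
  obtain m where m: "m \<notin> V G" using ex_new_if_finite[OF infinite_UNIV_nat ObjD(7)[OF obj]] by blast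
  have "2 \<le> card (half_edges G (E G) v)"
    using valence(3) ObjD(8)[OF obj] by (simp add: deg_def degP_eq_card_half_edges)
  then obtain A where A: "A \<subseteq> half_edges G (E G) v" and card_A: "card A = 2"
    by (rule obtain_subset_with_card_n)
  interpret vertex_splitting G v A m n
    by unfold_locales (use ObjD(1)[OF obj] valence(1) A m n in auto)
  note contracts = contr_split[OF ObjD(6)[OF obj]] and cyc = cyc_lift_cycle[OF ObjD(5)[OF obj]]
  interpret contraction G\<^sub>1 "lift_cycle P" G P "{n}" "id(m := v)" id
    by unfold_locales (use wf_split contracts cyc in \<open>auto simp: cyc_def\<close>)
  have "0 < canon_deg G\<^sub>1 u" if "u \<in> V G\<^sub>1" for u
    using that valence(2) card_A v_neq_m ObjD(3)[OF obj] canon_deg_split(3)[of u]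
    by (cases "u = m"; cases "u = v") (auto simp: canon_deg_split(1,2) V_split)
  then have "(G\<^sub>1, lift_cycle P) \<in> Obj g" using Obj_preimage[OF obj] cyc by blast
  moreover have "card (E G\<^sub>1) = Suc (card (E G))" using n ObjD(8)[OF obj] by (simp add: E_split)
  ultimately show ?thesis
    using pair_geI[OF contracts] by (auto simp: expansion_def simp del: split_paired_Ex)
qed

lemma expansion_exists:
  assumes obj: "(G, P) \<in> Obj g" and less: "card (E G) < 3 * g - 3"
  shows "\<exists>GP'. expansion g (G, P) GP'"
proof (cases "\<exists>v \<in> V G. 1 \<le> wt G v")
  case True
  then show ?thesis using expansion_of_positive_weight[OF obj] by blast
next
  case False
  then have wt: "wt G v = 0" if "v \<in> V G" for v using that by force
  have "\<exists>v \<in> V G. 2 \<le> canon_deg G v"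
  proof (rule ccontr)
    assume "\<not> ?thesis"
    then have "(\<Sum>v \<in> V G. canon_deg G v) \<le> (\<Sum>v \<in> V G. 1)" by (intro sum_mono) force
    moreover have "genus G = int (card (E G)) - int (card (V G)) + 1"
      using wt by (simp add: genus_def)
    ultimately show False using sum_canon_deg[OF ObjD(1)[OF obj]] ObjD(4)[OF obj] less by simp
  qed
  then obtain v where "v \<in> V G" "2 \<le> canon_deg G v" by blast
  moreover from this have "2 \<le> deg G v" using wt by (simp add: canon_deg_def)
  ultimately show ?thesis by (rule expansion_of_large_valence[OF obj])
qed

lemma exists_top_dimensional:
  assumes "GP \<in> Obj g"
  shows "\<exists>GP' \<in> Obj g. card (E (fst GP')) = 3 * g - 3 \<and> pair_ge GP' GP"
  using assms
proof (induction "3 * g - 3 - card (E (fst GP))" arbitrary: GP)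
  case 0
  obtain G P where eq: "GP = (G, P)" by (cases GP)
  have "card (E (fst GP)) = 3 * g - 3" using 0 card_E_le[of G P g] eq by simp
  moreover have "pair_ge GP GP" by (rule pair_ge_refl[OF 0(2)])
  ultimately show ?case using 0(2) by blast
next
  case (Suc k)
  obtain G P where eq: "GP = (G, P)" by (cases GP)
  have "card (E G) < 3 * g - 3" using Suc.hyps(2) eq by simp
  then obtain GP\<^sub>1
    where GP\<^sub>1: "GP\<^sub>1 \<in> Obj g" "card (E (fst GP\<^sub>1)) = Suc (card (E (fst GP)))" "pair_ge GP\<^sub>1 GP"
    using expansion_exists Suc.prems unfolding eq expansion_def by blast
  then have "k = 3 * g - 3 - card (E (fst GP\<^sub>1))" using Suc.hyps(2) by simp
  then show ?case using Suc.hyps(1) GP\<^sub>1(1) pair_ge_trans[OF _ _ GP\<^sub>1(3)] by blast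
qed

section \<open>Piecewise linear functions\<close>

text \<open>A tangent direction of an interval is a pair \<open>(s, \<tau>)\<close> of a point and a sign \<open>\<tau> = \<plusminus>1\<close> such that
  moving from \<open>s\<close> in direction \<open>\<tau>\<close> stays in the interval.\<close>

definition tangents :: "real \<Rightarrow> real \<Rightarrow> (real \<times> real) set" where
  "tangents a b = {a..<b} \<times> {1} \<union> {a<..b} \<times> {-1}"

definition slope :: "(real \<Rightarrow> real) \<Rightarrow> real \<Rightarrow> real \<Rightarrow> real" where
  "slope h s \<tau> = Lim (at_right 0) (\<lambda>u. (h (s + \<tau> * u) - h s) / u)"

definition has_slope :: "(real \<Rightarrow> real) \<Rightarrow> real \<Rightarrow> real \<Rightarrow> real \<Rightarrow> bool" where
  "has_slope h s \<tau> m \<longleftrightarrow> (\<forall>\<^sub>F u in at_right 0. h (s + \<tau> * u) = h s + m * u)"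

lemma tangents_empty: "tangents a a = {}"
  by (simp add: tangents_def)

lemma tangents_Un: "a \<le> b \<Longrightarrow> b \<le> c \<Longrightarrow> tangents a c = tangents a b \<union> tangents b c"
  by (auto simp: tangents_def)

lemma tangents_sign: "(s, \<tau>) \<in> tangents a b \<Longrightarrow> \<tau> = 1 \<or> \<tau> = -1"
  by (auto simp: tangents_def)

lemma tangents_reflect: "(L - s, - \<tau>) \<in> tangents 0 L \<longleftrightarrow> (s, \<tau>) \<in> tangents 0 L"
  by (auto simp: tangents_def minus_equation_iff[of \<tau>])

lemma slope_right: "slope h s 1 = rslope h s" and slope_left: "slope h s (-1) = lslope h s"
  by (simp_all add: slope_def rslope_def lslope_def)

lemma slope_reflect: "slope (\<lambda>t. h (L - t)) s \<tau> = slope h (L - s) (- \<tau>)"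
  by (simp add: slope_def algebra_simps)

lemma has_slope_reflect: "has_slope (\<lambda>t. h (L - t)) s \<tau> m \<longleftrightarrow> has_slope h (L - s) (- \<tau>) m"
  by (simp add: has_slope_def algebra_simps)

lemma slope_eq:
  assumes "has_slope h s \<tau> m"
  shows "slope h s \<tau> = m"
proof -
  have "\<forall>\<^sub>F u::real in at_right 0. 0 < u" by (simp add: eventually_at_right_less)
  with assms have "\<forall>\<^sub>F u in at_right 0. (h (s + \<tau> * u) - h s) / u = m"
    unfolding has_slope_def by eventually_elim simp
  then have "((\<lambda>u. (h (s + \<tau> * u) - h s) / u) \<longlongrightarrow> m) (at_right 0)" by (rule tendsto_eventually)
  then show ?thesis unfolding slope_def by (intro tendsto_Lim) simp_all
qed

lemma has_slope_linear:
  assumes "has_slope h s \<tau> m" "has_slope h' s \<tau> m'"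
  shows "has_slope (\<lambda>t. a * h t + b * h' t) s \<tau> (a * m + b * m')"
  using assms unfolding has_slope_def by eventually_elim (simp add: algebra_simps)

lemma has_slope_affine:
  assumes affine: "\<And>t. t \<in> {a..b} \<Longrightarrow> h t = m * t + c" and s: "(s, \<tau>) \<in> tangents a b"
  shows "has_slope h s \<tau> (\<tau> * m)"
proof -
  have "0 < (if \<tau> = 1 then b - s else s - a)" using s by (auto simp: tangents_def)
  then have "\<forall>\<^sub>F u in at_right 0. u \<in> {0<..<if \<tau> = 1 then b - s else s - a}"
    by (rule eventually_at_right_real)
  then show ?thesis
    unfolding has_slope_def
  proof eventually_elim
    case (elim u)
    then have "s \<in> {a..b}" "s + \<tau> * u \<in> {a..b}"
      using s by (auto simp: tangents_def split: if_splits)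
    then show ?case using affine by (simp add: algebra_simps)
  qed
qed

lemma has_slope_imp_affine:
  assumes slope: "has_slope h s \<tau> (of_int k)" and \<tau>: "\<tau> = 1 \<or> \<tau> = -1"
  shows "\<exists>(m::int) c d. 0 < d \<and> (\<forall>t. 0 \<le> \<tau> * (t - s) \<and> \<tau> * (t - s) < d \<longrightarrow> h t = of_int m * t + c)"
proof -
  obtain d where d: "0 < d" "\<And>u. 0 < u \<Longrightarrow> u < d \<Longrightarrow> h (s + \<tau> * u) = h s + of_int k * u"
    using slope unfolding has_slope_def eventually_at_right_field by auto
  obtain m :: int where m: "of_int m = \<tau> * of_int k"
    using \<tau> by (metis mult_1 mult_minus_left of_int_minus)
  have "h t = of_int m * t + (h s - of_int m * s)" if "0 \<le> \<tau> * (t - s)" "\<tau> * (t - s) < d" for t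
  proof -
    have "s + \<tau> * (\<tau> * (t - s)) = t" using \<tau> by auto
    then have "h t = h s + of_int k * (\<tau> * (t - s))"
      using d(2)[of "\<tau> * (t - s)"] that by (cases "\<tau> * (t - s) = 0") auto
    then show ?thesis unfolding m by (simp add: algebra_simps)
  qed
  then show ?thesis using d(1) by blast
qed

definition locally_pl_on :: "(real \<Rightarrow> real) \<Rightarrow> real \<Rightarrow> real \<Rightarrow> bool" where
  "locally_pl_on h a b \<longleftrightarrow> (\<forall>(s, \<tau>) \<in> tangents a b. \<exists>k::int. has_slope h s \<tau> (of_int k))"

lemma locally_pl_on_imp_affine_near:
  assumes pl: "locally_pl_on h a b" and x: "x \<in> {a..b}" and \<tau>: "\<tau> = 1 \<or> \<tau> = -1"
  shows "\<exists>(m::int) c d. 0 < d \<and>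
    (\<forall>t \<in> {a..b}. 0 \<le> \<tau> * (t - x) \<and> \<tau> * (t - x) < d \<longrightarrow> h t = of_int m * t + c)"
proof (cases "(x, \<tau>) \<in> tangents a b")
  case True
  then obtain k :: int where "has_slope h x \<tau> (of_int k)" using pl by (auto simp: locally_pl_on_def)
  from has_slope_imp_affine[OF this \<tau>] show ?thesis by blast
next
  case False
  then have const: "h t = of_int 0 * t + h x" if "t \<in> {a..b}" "0 \<le> \<tau> * (t - x)" for t
  proof -
    have "t = x" using False that x \<tau> by (auto simp: tangents_def)
    then show ?thesis by simp
  qed
  show ?thesis
    by (intro exI[of _ 0] exI[of _ "h x"] exI[of _ 1] conjI ballI impI const) simp_all
qed

definition int_affine_on :: "(real \<Rightarrow> real) \<Rightarrow> real \<Rightarrow> real \<Rightarrow> bool" where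
  "int_affine_on h a b \<longleftrightarrow> (\<exists>m::int. \<exists>c. \<forall>t \<in> {a..b}. h t = of_int m * t + c)"

lemma int_affine_onI:
  fixes m :: int
  assumes "\<And>t. t \<in> {a..b} \<Longrightarrow> h t = of_int m * t + c"
  shows "int_affine_on h a b"
  using assms unfolding int_affine_on_def by blast

lemma int_affine_onE:
  assumes "int_affine_on h a b"
  obtains m :: int and c where "\<And>t. t \<in> {a..b} \<Longrightarrow> h t = of_int m * t + c"
  using assms unfolding int_affine_on_def by blast

lemma locally_pl_on_induct [consumes 2, case_names affine trans]:
  assumes pl: "locally_pl_on h a b" and "a \<le> b"
    and affine: "\<And>x y. a \<le> x \<Longrightarrow> x \<le> y \<Longrightarrow> y \<le> b \<Longrightarrow> int_affine_on h x y \<Longrightarrow> Q x y"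
    and concat: "\<And>x y z. a \<le> x \<Longrightarrow> x \<le> y \<Longrightarrow> y \<le> z \<Longrightarrow> z \<le> b \<Longrightarrow> Q x y \<Longrightarrow> Q y z \<Longrightarrow> Q x z"
  shows "Q a b"
proof -
  define Q' where "Q' x y \<longleftrightarrow> (a \<le> x \<longrightarrow> y \<le> b \<longrightarrow> Q x y)" for x y
  from \<open>a \<le> b\<close> have "Q' a b"
  proof (induction rule: Bolzano)
    case (trans x y z)
    then show ?case using concat[of x y z] by (simp add: Q'_def)
  next
    case (local x)
    then have x: "x \<in> {a..b}" by simp
    obtain m :: int and c d where d: "0 < d"
      "\<And>t. t \<in> {a..b} \<Longrightarrow> 0 \<le> 1 * (t - x) \<and> 1 * (t - x) < d \<Longrightarrow> h t = of_int m * t + c"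
      using locally_pl_on_imp_affine_near[OF pl x, of 1] by blast
    obtain m' :: int and c' d' where d': "0 < d'"
      "\<And>t. t \<in> {a..b} \<Longrightarrow> 0 \<le> -1 * (t - x) \<and> -1 * (t - x) < d' \<Longrightarrow> h t = of_int m' * t + c'"
      using locally_pl_on_imp_affine_near[OF pl x, of "-1"] by blast
    have "Q' y z" if "y \<le> x" "x \<le> z" "z - y < min d d'" for y z
      unfolding Q'_def
    proof (intro impI)
      assume "a \<le> y" "z \<le> b"
      then have "int_affine_on h y x" "int_affine_on h x z"
        using that x d(2) d'(2) int_affine_onI[of y x h m' c'] int_affine_onI[of x z h m c] by auto
      then have "Q y x" "Q x z" using that x \<open>a \<le> y\<close> \<open>z \<le> b\<close> by (auto intro!: affine)
      then show "Q y z" using concat[of y x z] that \<open>a \<le> y\<close> \<open>z \<le> b\<close> by simp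
    qed
    then show ?case using d(1) d'(1) by (intro exI[of _ "min d d'"]) auto
  qed
  then show ?thesis by (simp add: Q'_def)
qed

definition pl_on :: "(real \<Rightarrow> real) \<Rightarrow> real \<Rightarrow> real \<Rightarrow> bool" where
  "pl_on h a b \<longleftrightarrow> (\<exists>n::nat. \<exists>t::nat \<Rightarrow> real. t 0 = a \<and> t n = b \<and> (\<forall>i < n. t i < t (Suc i)) \<and>
     (\<forall>i < n. int_affine_on h (t i) (t (Suc i))))"

lemma pl_int_eq_pl_on: "pl_int h L = pl_on h 0 L"
  by (simp add: pl_int_def pl_on_def int_affine_on_def)

lemma int_affine_on_imp_pl_on:
  assumes "a \<le> b" "int_affine_on h a b"
  shows "pl_on h a b"
proof (cases "a = b")
  case True
  then show ?thesis unfolding pl_on_def by (intro exI[of _ 0] exI[of _ "\<lambda>_. a"]) simp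
next
  case False
  then show ?thesis
    unfolding pl_on_def
    using assms by (intro exI[of _ 1] exI[of _ "\<lambda>i. if i = 0 then a else b"]) auto
qed

lemma pl_on_trans:
  assumes "pl_on h a b" "pl_on h b c"
  shows "pl_on h a c"
proof -
  obtain n t
    where t: "t 0 = a" "t n = b" "\<forall>i<n. t i < t (Suc i)" "\<forall>i<n. int_affine_on h (t i) (t (Suc i))"
    using assms(1) unfolding pl_on_def by blast
  obtain n' t' where t': "t' 0 = b" "t' n' = c" "\<forall>i<n'. t' i < t' (Suc i)"
    "\<forall>i<n'. int_affine_on h (t' i) (t' (Suc i))"
    using assms(2) unfolding pl_on_def by blast
  define r where "r i = (if i \<le> n then t i else t' (i - n))" for i
  have "r i < r (Suc i) \<and> int_affine_on h (r i) (r (Suc i))" if i: "i < n + n'" for i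
  proof (cases "i < n")
    case True
    then have "r i = t i" "r (Suc i) = t (Suc i)" by (auto simp: r_def)
    then show ?thesis using t True by simp
  next
    case False
    then have "r i = t' (i - n)" "r (Suc i) = t' (Suc (i - n))"
      using t t' by (auto simp: r_def Suc_diff_le)
    moreover have "i - n < n'" using i False by simp
    ultimately show ?thesis using t' by simp
  qed
  moreover have "r 0 = a" "r (n + n') = c" using t t' by (auto simp: r_def)
  ultimately show ?thesis unfolding pl_on_def by (intro exI[of _ "n + n'"] exI[of _ r]) blast
qed

lemma locally_pl_on_imp_pl_on:
  assumes "locally_pl_on h a b" "a \<le> b"
  shows "pl_on h a b"
  using assms
  by (induction rule: locally_pl_on_induct) (auto intro: int_affine_on_imp_pl_on pl_on_trans)

lemma int_affine_on_imp_locally_pl_on: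
  assumes "int_affine_on h a b"
  shows "locally_pl_on h a b"
proof -
  obtain m :: int and c where affine: "\<And>t. t \<in> {a..b} \<Longrightarrow> h t = of_int m * t + c"
    using assms by (rule int_affine_onE) blast
  have "\<exists>k::int. has_slope h s \<tau> (of_int k)" if "(s, \<tau>) \<in> tangents a b" for s \<tau>
    using has_slope_affine[OF affine that] tangents_sign[OF that]
    by (metis mult_1 mult_minus_left of_int_minus)
  then show ?thesis by (auto simp: locally_pl_on_def)
qed

lemma pl_on_imp_locally_pl_on:
  assumes "pl_on h a b"
  shows "locally_pl_on h a b"
proof -
  obtain n t where t: "t 0 = a" "t n = b" "\<forall>i<n. t i < t (Suc i)"
    "\<forall>i<n. int_affine_on h (t i) (t (Suc i))"
    using assms unfolding pl_on_def by blast
  have "t 0 \<le> t i \<and> locally_pl_on h (t 0) (t i)" if "i \<le> n" for i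
    using that
  proof (induction i)
    case (Suc i)
    then have "t 0 \<le> t i" "locally_pl_on h (t 0) (t i)" "t i < t (Suc i)"
      "locally_pl_on h (t i) (t (Suc i))"
      using t(3,4) int_affine_on_imp_locally_pl_on by auto
    then show ?case
      using tangents_Un[of "t 0" "t i" "t (Suc i)"] by (auto simp: locally_pl_on_def)
  qed (simp add: locally_pl_on_def tangents_empty)
  then show ?thesis using t(1,2) by auto
qed

lemma pl_int_iff_locally_pl_on: "0 \<le> L \<Longrightarrow> pl_int h L \<longleftrightarrow> locally_pl_on h 0 L"
  unfolding pl_int_eq_pl_on using locally_pl_on_imp_pl_on pl_on_imp_locally_pl_on by blast

lemma slopes_congruent:
  fixes d :: int
  assumes "locally_pl_on h a b" "a \<le> b"
    and bends: "\<And>s. a < s \<Longrightarrow> s < b \<Longrightarrow> \<exists>k. slope h s 1 + slope h s (-1) = of_int (d * k)"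
  shows "\<exists>m. \<forall>(s, \<tau>) \<in> tangents a b. \<exists>k. slope h s \<tau> = \<tau> * of_int (m + d * k)"
  using assms(1,2)
proof (induction rule: locally_pl_on_induct)
  case (affine x y)
  then obtain m :: int and c where "\<And>t. t \<in> {x..y} \<Longrightarrow> h t = of_int m * t + c"
    by (metis int_affine_onE)
  then have "slope h s \<tau> = \<tau> * of_int (m + d * 0)" if "(s, \<tau>) \<in> tangents x y" for s \<tau>
    using slope_eq[OF has_slope_affine[OF _ that]] by simp
  then show ?case by blast
next
  case (trans x y z)
  obtain m where m: "\<And>s \<tau>. (s, \<tau>) \<in> tangents x y \<Longrightarrow> \<exists>k. slope h s \<tau> = \<tau> * of_int (m + d * k)"
    using trans.IH(1) by blast
  obtain m' where m': "\<And>s \<tau>. (s, \<tau>) \<in> tangents y z \<Longrightarrow> \<exists>k. slope h s \<tau> = \<tau> * of_int (m' + d * k)"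
    using trans.IH(2) by blast
  have Un: "tangents x z = tangents x y \<union> tangents y z" using trans.hyps by (intro tangents_Un)
  show ?case
  proof (cases "x < y \<and> y < z")
    case True
    obtain k\<^sub>0 where k\<^sub>0: "slope h y 1 + slope h y (-1) = of_int (d * k\<^sub>0)"
      using bends True trans.hyps by force
    obtain k\<^sub>1 where k\<^sub>1: "slope h y (-1) = -1 * of_int (m + d * k\<^sub>1)"
      using m[of y "-1"] True by (auto simp: tangents_def)
    obtain k\<^sub>2 where k\<^sub>2: "slope h y 1 = 1 * of_int (m' + d * k\<^sub>2)"
      using m'[of y 1] True by (auto simp: tangents_def)
    have "of_int (m' + d * k\<^sub>2 - (m + d * k\<^sub>1)) = (of_int (d * k\<^sub>0) :: real)"
      using k\<^sub>0 k\<^sub>1 k\<^sub>2 by simp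
    then have "m' + d * k\<^sub>2 - (m + d * k\<^sub>1) = d * k\<^sub>0" unfolding of_int_eq_iff .
    then have "m' + d * k = m + d * (k\<^sub>0 + k\<^sub>1 - k\<^sub>2 + k)" for k by (simp add: algebra_simps)
    then have "\<exists>k. slope h s \<tau> = \<tau> * of_int (m + d * k)" if "(s, \<tau>) \<in> tangents x z" for s \<tau>
      using that m m' unfolding Un by (metis UnE)
    then show ?thesis by blast
  next
    case False
    then have "x = y \<or> y = z" using trans.hyps by auto
    then show ?thesis using trans.IH by (elim disjE) simp_all
  qed
qed

lemma displacement_of_constant_slope:
  assumes "locally_pl_on h a b" "a \<le> b"
    and slope: "\<And>s \<tau>. (s, \<tau>) \<in> tangents a b \<Longrightarrow> slope h s \<tau> = \<tau> * m"
  shows "h b - h a = m * (b - a)"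
  using assms(1,2)
proof (induction rule: locally_pl_on_induct)
  case (affine x y)
  obtain k :: int and c where h: "\<And>t. t \<in> {x..y} \<Longrightarrow> h t = of_int k * t + c"
    using affine(4) by (metis int_affine_onE)
  show ?case
  proof (cases "x = y")
    case False
    then have x: "(x, 1) \<in> tangents x y" "(x, 1) \<in> tangents a b"
      using affine(1-3) by (auto simp: tangents_def)
    have "m = of_int k"
      using slope[OF x(2)] slope_eq[OF has_slope_affine[OF h x(1)]] by simp
    then show ?thesis using affine(2) h[of x] h[of y] by (simp add: algebra_simps)
  qed simp
qed (simp add: algebra_simps)

section \<open>Rational functions and divisors\<close>

definition tangent_vectors :: "tcurve \<Rightarrow> (nat \<times> real \<times> real) set" where
  "tangent_vectors \<Gamma> = (SIGMA e : E (fst \<Gamma>). tangents 0 (snd \<Gamma> e))"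

definition half_edge_tangent :: "tcurve \<Rightarrow> nat \<times> bool \<Rightarrow> nat \<times> real \<times> real" where
  "half_edge_tangent \<Gamma> h = (fst h, if snd h then snd \<Gamma> (fst h) else 0, if snd h then -1 else 1)"

definition tangents_at :: "tcurve \<Rightarrow> tpt \<Rightarrow> (nat \<times> real \<times> real) set" where
  "tangents_at \<Gamma> p = (case p of
      Vt v \<Rightarrow> half_edge_tangent \<Gamma> ` half_edges (fst \<Gamma>) (E (fst \<Gamma>)) v
    | Ep e t \<Rightarrow> {(e, t, 1), (e, t, -1)})"

definition tslope :: "tcurve \<Rightarrow> (tpt \<Rightarrow> real) \<Rightarrow> nat \<times> real \<times> real \<Rightarrow> real" where
  "tslope \<Gamma> f = (\<lambda>(e, s, \<tau>). slope (fedge \<Gamma> f e) s \<tau>)"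

definition has_tslope :: "tcurve \<Rightarrow> (tpt \<Rightarrow> real) \<Rightarrow> nat \<times> real \<times> real \<Rightarrow> real \<Rightarrow> bool" where
  "has_tslope \<Gamma> f = (\<lambda>(e, s, \<tau>). has_slope (fedge \<Gamma> f e) s \<tau>)"

lemma Vt_in_pts_iff [simp]: "Vt v \<in> pts \<Gamma> \<longleftrightarrow> v \<in> V (fst \<Gamma>)"
  and Ep_in_pts_iff [simp]: "Ep e t \<in> pts \<Gamma> \<longleftrightarrow> e \<in> E (fst \<Gamma>) \<and> 0 < t \<and> t < snd \<Gamma> e"
  by (auto simp: pts_def)

lemma inj_half_edge_tangent: "inj_on (half_edge_tangent \<Gamma>) A"
  by (auto simp: inj_on_def half_edge_tangent_def split: if_splits)

lemma tslope_eq: "has_tslope \<Gamma> f d m \<Longrightarrow> tslope \<Gamma> f d = m"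
  by (cases d) (simp add: has_tslope_def tslope_def slope_eq)

lemma fedge_linear:
  "fedge \<Gamma> (\<lambda>p. a * f p + b * f' p) e = (\<lambda>t. a * fedge \<Gamma> f e t + b * fedge \<Gamma> f' e t)"
  by (auto simp: fedge_def)

lemma has_tslope_linear:
  assumes "has_tslope \<Gamma> f d m" "has_tslope \<Gamma> f' d m'"
  shows "has_tslope \<Gamma> (\<lambda>p. a * f p + b * f' p) d (a * m + b * m')"
  using assms has_slope_linear by (cases d) (simp add: has_tslope_def fedge_linear)

lemma has_tslope_const: "has_tslope \<Gamma> (\<lambda>_. c) d 0"
  by (cases d) (simp add: has_tslope_def has_slope_def fedge_def)

locale metric_graph =
  fixes G :: sgraph and l :: "nat \<Rightarrow> real"
  assumes wf: "wf_graph G" and length_pos: "e \<in> E G \<Longrightarrow> 0 < l e"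
begin

abbreviation \<Gamma> :: tcurve where
  "\<Gamma> \<equiv> (G, l)"

lemma finite_V: "finite (V G)" and finite_E: "finite (E G)"
  using wf_graphD[OF wf] by simp_all

lemma half_edge_tangent_in_tangent_vectors:
  "fst h \<in> E G \<Longrightarrow> half_edge_tangent \<Gamma> h \<in> tangent_vectors \<Gamma>"
  using length_pos by (auto simp: half_edge_tangent_def tangent_vectors_def tangents_def)

lemma tangents_at_subset:
  assumes "p \<in> pts \<Gamma>"
  shows "tangents_at \<Gamma> p \<subseteq> tangent_vectors \<Gamma>"
proof (cases p)
  case (Vt v)
  then show ?thesis
    using half_edge_tangent_in_tangent_vectors unfolding tangents_at_def half_edges_def by auto
next
  case (Ep e t)
  then show ?thesis
    using assms by (auto simp: pts_def tangents_at_def tangent_vectors_def tangents_def)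
qed

lemma ordf_Vt: "ordf \<Gamma> f (Vt v) = (\<Sum>h \<in> half_edges G (E G) v. tslope \<Gamma> f (half_edge_tangent \<Gamma> h))"
  by (simp add: sum_half_edges[OF finite_E] ordf_def tslope_def half_edge_tangent_def
      slope_right slope_left)

lemma ordf_eq_sum: "ordf \<Gamma> f p = (\<Sum>d \<in> tangents_at \<Gamma> p. tslope \<Gamma> f d)"
proof (cases p)
  case (Vt v)
  then show ?thesis by (simp add: ordf_Vt tangents_at_def sum.reindex[OF inj_half_edge_tangent])
next
  case (Ep e t)
  then show ?thesis by (simp add: ordf_def tangents_at_def tslope_def slope_right slope_left)
qed

lemma rational_fun_iff_locally_pl_on:
  "rational_fun \<Gamma> f \<longleftrightarrow> (\<forall>e \<in> E G. locally_pl_on (fedge \<Gamma> f e) 0 (l e))"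
  using pl_int_iff_locally_pl_on length_pos by (simp add: rational_fun_def less_imp_le)

lemma rational_fun_iff:
  "rational_fun \<Gamma> f \<longleftrightarrow> (\<forall>d \<in> tangent_vectors \<Gamma>. \<exists>k::int. has_tslope \<Gamma> f d (of_int k))"
  by (auto simp: rational_fun_iff_locally_pl_on locally_pl_on_def tangent_vectors_def
      has_tslope_def)

lemma rational_fun_tslope:
  assumes "rational_fun \<Gamma> f" "d \<in> tangent_vectors \<Gamma>"
  obtains k :: int where "tslope \<Gamma> f d = of_int k" "has_tslope \<Gamma> f d (of_int k)"
  using assms tslope_eq unfolding rational_fun_iff by blast

lemma tslope_linear:
  assumes "rational_fun \<Gamma> f" "rational_fun \<Gamma> f'" "d \<in> tangent_vectors \<Gamma>"
  shows "tslope \<Gamma> (\<lambda>p. a * f p + b * f' p) d = a * tslope \<Gamma> f d + b * tslope \<Gamma> f' d"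
proof -
  obtain k k' :: int where "has_tslope \<Gamma> f d (of_int k)" "has_tslope \<Gamma> f' d (of_int k')"
    using rational_fun_tslope[OF assms(1,3)] rational_fun_tslope[OF assms(2,3)] by metis
  from tslope_eq[OF has_tslope_linear[OF this]] tslope_eq[OF this(1)] tslope_eq[OF this(2)]
  show ?thesis by simp
qed

lemma rational_fun_linear:
  assumes "rational_fun \<Gamma> f" "rational_fun \<Gamma> f'"
    and "\<And>d. d \<in> tangent_vectors \<Gamma> \<Longrightarrow> a * tslope \<Gamma> f d + b * tslope \<Gamma> f' d \<in> \<int>"
  shows "rational_fun \<Gamma> (\<lambda>p. a * f p + b * f' p)"
  unfolding rational_fun_iff
proof
  fix d assume d: "d \<in> tangent_vectors \<Gamma>"
  obtain k where k: "tslope \<Gamma> f d = of_int k" "has_tslope \<Gamma> f d (of_int k)"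
    by (rule rational_fun_tslope[OF assms(1) d])
  obtain k' where k': "tslope \<Gamma> f' d = of_int k'" "has_tslope \<Gamma> f' d (of_int k')"
    by (rule rational_fun_tslope[OF assms(2) d])
  show "\<exists>j::int. has_tslope \<Gamma> (\<lambda>p. a * f p + b * f' p) d (of_int j)"
    using has_tslope_linear[OF k(2) k'(2), of a b] assms(3)[OF d] k(1) k'(1)
    by (auto elim!: Ints_cases)
qed

lemma rational_fun_int_linear:
  assumes "rational_fun \<Gamma> f" "rational_fun \<Gamma> f'"
  shows "rational_fun \<Gamma> (\<lambda>p. of_int a * f p + of_int b * f' p)"
proof (rule rational_fun_linear[OF assms])
  fix d assume d: "d \<in> tangent_vectors \<Gamma>"
  show "of_int a * tslope \<Gamma> f d + of_int b * tslope \<Gamma> f' d \<in> \<int>"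
    by (rule rational_fun_tslope[OF assms(1) d], rule rational_fun_tslope[OF assms(2) d]) simp
qed

lemma ordf_linear:
  assumes "rational_fun \<Gamma> f" "rational_fun \<Gamma> f'" "p \<in> pts \<Gamma>"
  shows "ordf \<Gamma> (\<lambda>p. a * f p + b * f' p) p = a * ordf \<Gamma> f p + b * ordf \<Gamma> f' p"
proof -
  have "(\<Sum>d \<in> tangents_at \<Gamma> p. tslope \<Gamma> (\<lambda>p. a * f p + b * f' p) d)
      = (\<Sum>d \<in> tangents_at \<Gamma> p. a * tslope \<Gamma> f d + b * tslope \<Gamma> f' d)"
    using tangents_at_subset[OF assms(3)] by (intro sum.cong tslope_linear assms) auto
  then show ?thesis by (simp add: ordf_eq_sum sum.distrib sum_distrib_left)
qed

lemma lin_equiv_linear: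
  assumes "lin_equiv \<Gamma> D\<^sub>1 D\<^sub>1'" "lin_equiv \<Gamma> D\<^sub>2 D\<^sub>2'" "D \<in> Div \<Gamma>" "D' \<in> Div \<Gamma>"
    and D: "\<And>p. D p - D' p = a * (D\<^sub>1 p - D\<^sub>1' p) + b * (D\<^sub>2 p - D\<^sub>2' p)"
  shows "lin_equiv \<Gamma> D D'"
proof -
  obtain f\<^sub>1 where f\<^sub>1: "rational_fun \<Gamma> f\<^sub>1" "\<forall>p \<in> pts \<Gamma>. of_int (D\<^sub>1 p - D\<^sub>1' p) = ordf \<Gamma> f\<^sub>1 p"
    using assms(1) unfolding lin_equiv_def by blast
  obtain f\<^sub>2 where f\<^sub>2: "rational_fun \<Gamma> f\<^sub>2" "\<forall>p \<in> pts \<Gamma>. of_int (D\<^sub>2 p - D\<^sub>2' p) = ordf \<Gamma> f\<^sub>2 p"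
    using assms(2) unfolding lin_equiv_def by blast
  have "of_int (D p - D' p) = ordf \<Gamma> (\<lambda>p. of_int a * f\<^sub>1 p + of_int b * f\<^sub>2 p) p"
    if p: "p \<in> pts \<Gamma>" for p
    unfolding ordf_linear[OF f\<^sub>1(1) f\<^sub>2(1) p] D using f\<^sub>1(2) f\<^sub>2(2) p
    by (metis of_int_add of_int_mult)
  then show ?thesis
    unfolding lin_equiv_def using assms(3,4) rational_fun_int_linear[OF f\<^sub>1(1) f\<^sub>2(1)] by blast
qed

lemma lin_equiv_refl:
  assumes "D \<in> Div \<Gamma>"
  shows "lin_equiv \<Gamma> D D"
proof -
  have "rational_fun \<Gamma> (\<lambda>_. 0)"
    unfolding rational_fun_iff using has_tslope_const by (metis of_int_0)
  moreover have "ordf \<Gamma> (\<lambda>_. 0) p = 0" for p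
    by (simp add: ordf_eq_sum tslope_eq[OF has_tslope_const])
  ultimately show ?thesis unfolding lin_equiv_def using assms by auto
qed

lemma lin_equiv_sym:
  assumes "lin_equiv \<Gamma> D D'"
  shows "lin_equiv \<Gamma> D' D"
  by (rule lin_equiv_linear[OF assms assms, of _ _ "-1" 0])
    (use assms in \<open>auto simp: lin_equiv_def\<close>)

lemma lin_equiv_trans:
  assumes "lin_equiv \<Gamma> D D'" "lin_equiv \<Gamma> D' D''"
  shows "lin_equiv \<Gamma> D D''"
  by (rule lin_equiv_linear[OF assms, of _ _ 1 1]) (use assms in \<open>auto simp: lin_equiv_def\<close>)

lemma pic_cls_eq_iff:
  assumes "D \<in> Div \<Gamma>"
  shows "pic_cls \<Gamma> D = pic_cls \<Gamma> D' \<longleftrightarrow> lin_equiv \<Gamma> D D'"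
proof
  assume "pic_cls \<Gamma> D = pic_cls \<Gamma> D'"
  then show "lin_equiv \<Gamma> D D'" using lin_equiv_refl[OF assms] by (auto simp: pic_cls_def)
next
  assume "lin_equiv \<Gamma> D D'"
  then show "pic_cls \<Gamma> D = pic_cls \<Gamma> D'"
    unfolding pic_cls_def using lin_equiv_sym lin_equiv_trans by blast
qed

lemma tslopes_congruent:
  fixes d :: int
  assumes f: "rational_fun \<Gamma> f"
    and bends: "\<And>e s. Ep e s \<in> pts \<Gamma> \<Longrightarrow> \<exists>k. ordf \<Gamma> f (Ep e s) = of_int (d * k)"
  shows "\<exists>m :: nat \<Rightarrow> int. \<forall>(e, s, \<tau>) \<in> tangent_vectors \<Gamma>. \<exists>k.
      tslope \<Gamma> f (e, s, \<tau>) = \<tau> * of_int (m e + d * k)"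
proof -
  have "\<forall>e \<in> E G. \<exists>m. \<forall>(s, \<tau>) \<in> tangents 0 (l e). \<exists>k.
      slope (fedge \<Gamma> f e) s \<tau> = \<tau> * of_int (m + d * k)"
  proof
    fix e assume e: "e \<in> E G"
    show "\<exists>m. \<forall>(s, \<tau>) \<in> tangents 0 (l e). \<exists>k. slope (fedge \<Gamma> f e) s \<tau> = \<tau> * of_int (m + d * k)"
    proof (rule slopes_congruent)
      show "0 \<le> l e" using length_pos[OF e] by simp
      show "locally_pl_on (fedge \<Gamma> f e) 0 (l e)"
        using f e by (simp add: rational_fun_iff_locally_pl_on)
      fix s assume "0 < s" "s < l e"
      then have "Ep e s \<in> pts \<Gamma>" using e by simp
      from bends[OF this]
      show "\<exists>k. slope (fedge \<Gamma> f e) s 1 + slope (fedge \<Gamma> f e) s (-1) = of_int (d * k)"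
        by (simp add: ordf_def slope_right slope_left)
    qed
  qed
  from bchoice[OF this] obtain m where "\<forall>e \<in> E G. \<forall>(s, \<tau>) \<in> tangents 0 (l e).
      \<exists>k. slope (fedge \<Gamma> f e) s \<tau> = \<tau> * of_int (m e + d * k)" by blast
  then show ?thesis by (intro exI[of _ m]) (auto simp: tangent_vectors_def tslope_def)
qed

lemma sum_values_ordf_eq_neg_energy:
  assumes f: "rational_fun \<Gamma> f"
    and tslope: "\<And>e s \<tau>. (e, s, \<tau>) \<in> tangent_vectors \<Gamma> \<Longrightarrow> tslope \<Gamma> f (e, s, \<tau>) = \<tau> * m e"
  shows "(\<Sum>v \<in> V G. f (Vt v) * ordf \<Gamma> f (Vt v)) = - (\<Sum>e \<in> E G. (m e)\<^sup>2 * l e)"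
proof -
  let ?f = "\<lambda>h. f (Vt (origin G h))" and ?slope = "\<lambda>h. tslope \<Gamma> f (half_edge_tangent \<Gamma> h)"
  have edge:
    "?f (e, False) * ?slope (e, False) + ?f (e, True) * ?slope (e, True) = - ((m e)\<^sup>2 * l e)"
    if e: "e \<in> E G" for e
  proof -
    have "fedge \<Gamma> f e (l e) - fedge \<Gamma> f e 0 = m e * (l e - 0)"
    proof (rule displacement_of_constant_slope)
      show "0 \<le> l e" using length_pos[OF e] by simp
      show "locally_pl_on (fedge \<Gamma> f e) 0 (l e)"
        using f e by (simp add: rational_fun_iff_locally_pl_on)
    qed (use tslope e in \<open>auto simp: tslope_def tangent_vectors_def\<close>)
    then have "?f (e, True) - ?f (e, False) = m e * l e"
      using length_pos[OF e] by (simp add: fedge_def origin_def)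
    moreover have "?slope (e, b) = (if b then -1 else 1) * m e" for b
      using half_edge_tangent_in_tangent_vectors[of "(e, b)"] e tslope
      by (auto simp: half_edge_tangent_def)
    ultimately show ?thesis by (simp add: algebra_simps power2_eq_square)
  qed
  have "(\<Sum>v \<in> V G. f (Vt v) * ordf \<Gamma> f (Vt v))
      = (\<Sum>v \<in> V G. \<Sum>h \<in> half_edges G (E G) v. ?f h * ?slope h)"
    unfolding ordf_Vt sum_distrib_left by (intro sum.cong) (auto simp: half_edges_def)
  also have "\<dots> = (\<Sum>e \<in> E G. ?f (e, False) * ?slope (e, False) + ?f (e, True) * ?slope (e, True))"
    by (rule sum_all_half_edges[OF wf])
  also have "\<dots> = - (\<Sum>e \<in> E G. (m e)\<^sup>2 * l e)"
    unfolding sum_negf[symmetric] using edge by (intro sum.cong) auto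
  finally show ?thesis .
qed

lemma harmonic_tslope_eq_0:
  assumes f: "rational_fun \<Gamma> f" and harmonic: "\<And>p. p \<in> pts \<Gamma> \<Longrightarrow> ordf \<Gamma> f p = 0"
    and d: "d \<in> tangent_vectors \<Gamma>"
  shows "tslope \<Gamma> f d = 0"
proof -
  have "\<exists>k. ordf \<Gamma> f (Ep e s) = of_int (0 * k)" if "Ep e s \<in> pts \<Gamma>" for e s
    using harmonic[OF that] by simp
  from tslopes_congruent[OF f this] obtain m :: "nat \<Rightarrow> int"
    where m: "\<And>e s \<tau>. (e, s, \<tau>) \<in> tangent_vectors \<Gamma> \<Longrightarrow> tslope \<Gamma> f (e, s, \<tau>) = \<tau> * of_int (m e)"
    by fastforce
  have "(\<Sum>e \<in> E G. (of_int (m e))\<^sup>2 * l e) = 0"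
    using sum_values_ordf_eq_neg_energy[OF f m] harmonic by simp
  then have "\<forall>e \<in> E G. (of_int (m e))\<^sup>2 * l e = 0"
    using finite_E length_pos by (subst (asm) sum_nonneg_eq_0_iff) (auto simp: less_imp_le)
  then have "m e = 0" if "e \<in> E G" for e using that length_pos by force
  then show ?thesis using m d by (cases d) (auto simp: tangent_vectors_def)
qed

section \<open>Theta characteristics\<close>

lemma double_in_Div: "D \<in> Div \<Gamma> \<Longrightarrow> (\<lambda>p. 2 * D p) \<in> Div \<Gamma>"
  by (simp add: Div_def)

lemma canon_in_Div: "canon \<Gamma> \<in> Div \<Gamma>"
proof -
  have "p \<in> Vt ` V G" if "canon \<Gamma> p \<noteq> 0" for p
    using that by (cases p) (auto simp: canon_def split: if_splits)
  then have "{p. canon \<Gamma> p \<noteq> 0} \<subseteq> Vt ` V G" by blast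
  moreover from this have "finite {p. canon \<Gamma> p \<noteq> 0}" using finite_V finite_subset by blast
  ultimately show ?thesis by (auto simp: Div_def)
qed

lemma TP_in_Div: "TP \<Gamma> P \<in> Div \<Gamma>"
proof -
  let ?A = "Vt ` V G \<union> (\<lambda>e. Ep e (l e / 2)) ` E G"
  have "p \<in> ?A" if "TP \<Gamma> P p \<noteq> 0" for p
    using that by (cases p) (auto simp: TP_def split: if_splits)
  then have support: "{p. TP \<Gamma> P p \<noteq> 0} \<subseteq> ?A" by blast
  moreover have "?A \<subseteq> pts \<Gamma>" using length_pos by auto
  moreover have "finite {p. TP \<Gamma> P p \<noteq> 0}"
    using finite_subset[OF support] finite_V finite_E by simp
  ultimately show ?thesis unfolding Div_def by blast
qed

definition slope_parity :: "(tpt \<Rightarrow> real) \<Rightarrow> nat set \<Rightarrow> bool" where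
  "slope_parity f P \<longleftrightarrow>
     (\<forall>d \<in> tangent_vectors \<Gamma>. \<exists>k::int. tslope \<Gamma> f d = of_int k \<and> (even k \<longleftrightarrow> fst d \<in> P))"

lemma slope_parityE:
  assumes "slope_parity f P" "d \<in> tangent_vectors \<Gamma>"
  obtains k :: int where "tslope \<Gamma> f d = of_int k" "even k \<longleftrightarrow> fst d \<in> P"
  using assms unfolding slope_parity_def by blast

lemma slope_parity_exists:
  assumes "rational_fun \<Gamma> f"
    and "\<And>e s. Ep e s \<in> pts \<Gamma> \<Longrightarrow> \<exists>k. ordf \<Gamma> f (Ep e s) = of_int (2 * k)"
  obtains P where "P \<subseteq> E G" "slope_parity f P"
proof -
  from tslopes_congruent[OF assms] obtain m :: "nat \<Rightarrow> int" where m: "\<And>e s \<tau>.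
      (e, s, \<tau>) \<in> tangent_vectors \<Gamma> \<Longrightarrow> \<exists>k. tslope \<Gamma> f (e, s, \<tau>) = \<tau> * of_int (m e + 2 * k)"
    by blast
  have "\<exists>k::int. tslope \<Gamma> f d = of_int k \<and> (even k \<longleftrightarrow> fst d \<in> {e \<in> E G. even (m e)})"
    if d: "d \<in> tangent_vectors \<Gamma>" for d
  proof -
    obtain e s \<tau> where eq: "d = (e, s, \<tau>)" by (cases d)
    then have "e \<in> E G" and sign: "\<tau> = 1 \<or> \<tau> = -1"
      using d tangents_sign by (auto simp: tangent_vectors_def)
    obtain j where j: "tslope \<Gamma> f d = \<tau> * of_int (m e + 2 * j)" using m d unfolding eq by blast
    obtain k :: int where "tslope \<Gamma> f d = of_int k" "k = m e + 2 * j \<or> k = - (m e + 2 * j)"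
      using sign j by (metis mult_1 mult_minus_left of_int_minus)
    then show ?thesis using \<open>e \<in> E G\<close> by (intro exI[of _ k]) (auto simp: eq)
  qed
  then have "slope_parity f {e \<in> E G. even (m e)}" unfolding slope_parity_def by blast
  then show ?thesis by (rule that[rotated]) blast
qed

lemma rational_fun_half_sum:
  assumes "rational_fun \<Gamma> f" "rational_fun \<Gamma> f'" and parity: "slope_parity f P" "slope_parity f' P"
  shows "rational_fun \<Gamma> (\<lambda>p. 1/2 * f p + 1/2 * f' p)"
proof (rule rational_fun_linear[OF assms(1,2)])
  fix d assume d: "d \<in> tangent_vectors \<Gamma>"
  obtain k :: int where k: "tslope \<Gamma> f d = of_int k" "even k \<longleftrightarrow> fst d \<in> P"
    by (rule slope_parityE[OF parity(1) d])
  obtain k' :: int where k': "tslope \<Gamma> f' d = of_int k'" "even k' \<longleftrightarrow> fst d \<in> P"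
    by (rule slope_parityE[OF parity(2) d])
  obtain j where "k + k' = 2 * j" using k(2) k'(2) by (metis evenE even_add)
  then have "1/2 * tslope \<Gamma> f d + 1/2 * tslope \<Gamma> f' d = of_int j"
    unfolding k(1) k'(1) by (simp flip: of_int_add distrib_left)
  then show "1/2 * tslope \<Gamma> f d + 1/2 * tslope \<Gamma> f' d \<in> \<int>" by simp
qed

definition vertex_dist :: "nat set \<Rightarrow> tpt \<Rightarrow> real" where
  "vertex_dist P p = (case p of Vt v \<Rightarrow> 0 | Ep e t \<Rightarrow> if e \<in> P then 0 else min t (l e - t))"

lemma has_tslope_vertex_dist:
  assumes d: "(e, s, \<tau>) \<in> tangent_vectors \<Gamma>"
  shows "has_tslope \<Gamma> (vertex_dist P) (e, s, \<tau>)
    (if e \<in> P then 0 else if (s, \<tau>) \<in> tangents 0 (l e / 2) then \<tau> else - \<tau>)"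
proof -
  let ?h = "fedge \<Gamma> (vertex_dist P) e"
  have e: "0 < l e" "(s, \<tau>) \<in> tangents 0 (l e)"
    using d length_pos by (auto simp: tangent_vectors_def)
  have h: "?h t = (if e \<in> P then 0 else min t (l e - t))" for t
    using e(1) by (auto simp: fedge_def vertex_dist_def)
  consider (on_cycle) "e \<in> P" | (first_half) "e \<notin> P" "(s, \<tau>) \<in> tangents 0 (l e / 2)"
    | (second_half) "e \<notin> P" "(s, \<tau>) \<notin> tangents 0 (l e / 2)" "(s, \<tau>) \<in> tangents (l e / 2) (l e)"
    using e tangents_Un[of 0 "l e / 2" "l e"] by auto
  then show ?thesis
  proof cases
    case on_cycle
    then have "has_slope ?h s \<tau> (\<tau> * 0)"
      by (intro has_slope_affine[OF _ e(2), of _ _ 0]) (simp add: h)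
    then show ?thesis using on_cycle by (simp add: has_tslope_def)
  next
    case first_half
    then have "has_slope ?h s \<tau> (\<tau> * 1)"
      by (intro has_slope_affine[OF _ first_half(2), of _ _ 0]) (auto simp: h)
    then show ?thesis using first_half by (simp add: has_tslope_def)
  next
    case second_half
    then have "has_slope ?h s \<tau> (\<tau> * -1)"
      by (intro has_slope_affine[OF _ second_half(3), of _ _ "l e"]) (auto simp: h)
    then show ?thesis using second_half by (simp add: has_tslope_def)
  qed
qed

lemma slope_parity_vertex_dist: "slope_parity (vertex_dist P) P"
  unfolding slope_parity_def
proof
  fix d assume d: "d \<in> tangent_vectors \<Gamma>"
  obtain e s \<tau> where eq: "d = (e, s, \<tau>)" by (cases d)
  have "\<tau> = 1 \<or> \<tau> = -1" using d tangents_sign by (auto simp: eq tangent_vectors_def)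
  then consider "tslope \<Gamma> (vertex_dist P) d = of_int 0" "e \<in> P"
    | "tslope \<Gamma> (vertex_dist P) d = of_int 1" "e \<notin> P"
    | "tslope \<Gamma> (vertex_dist P) d = of_int (-1)" "e \<notin> P"
    using tslope_eq[OF has_tslope_vertex_dist[OF d[unfolded eq], of P]]
    by (cases "e \<in> P") (auto simp: eq split: if_splits)
  then show "\<exists>k::int. tslope \<Gamma> (vertex_dist P) d = of_int k \<and> (even k \<longleftrightarrow> fst d \<in> P)"
    by cases (metis eq fst_conv even_zero odd_one even_minus)+
qed

lemma rational_fun_vertex_dist: "rational_fun \<Gamma> (vertex_dist P)"
  unfolding rational_fun_iff
proof
  fix d assume d: "d \<in> tangent_vectors \<Gamma>"
  obtain e s \<tau> where eq: "d = (e, s, \<tau>)" by (cases d)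
  obtain k :: int where "tslope \<Gamma> (vertex_dist P) d = of_int k"
    using slope_parityE[OF slope_parity_vertex_dist d] .
  then show "\<exists>k::int. has_tslope \<Gamma> (vertex_dist P) d (of_int k)"
    using has_tslope_vertex_dist[of e s \<tau> P] d tslope_eq unfolding eq by metis
qed

lemma tslope_vertex_dist_half_edge:
  assumes "e \<in> E G"
  shows "tslope \<Gamma> (vertex_dist P) (half_edge_tangent \<Gamma> (e, b)) = of_bool (e \<notin> P)"
  using tslope_eq[OF has_tslope_vertex_dist, of e _ _ P] length_pos[OF assms]
    half_edge_tangent_in_tangent_vectors[of "(e, b)"] assms
  by (auto simp: half_edge_tangent_def tangents_def)

lemma ordf_vertex_dist:
  assumes P: "cyc G P" and p: "p \<in> pts \<Gamma>"
  shows "ordf \<Gamma> (vertex_dist P) p = of_int (canon \<Gamma> p - 2 * TP \<Gamma> P p)"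
proof (cases p)
  case (Vt v)
  then have v: "v \<in> V G" using p by simp
  have P_subset: "P \<subseteq> E G" and even: "even (degP G P v)" using P v by (auto simp: cyc_def)
  have "ordf \<Gamma> (vertex_dist P) p = (\<Sum>h \<in> half_edges G (E G) v. of_bool (fst h \<notin> P))"
    unfolding Vt ordf_Vt
    by (intro sum.cong) (auto simp: half_edges_def tslope_vertex_dist_half_edge)
  also have "\<dots> = real (card {h \<in> half_edges G (E G) v. fst h \<notin> P})"
    using finite_half_edges[OF finite_E] by (simp add: of_bool_def sum.If_cases Int_def)
  also have "{h \<in> half_edges G (E G) v. fst h \<notin> P} = half_edges G (E G - P) v"
    by (auto simp: half_edges_def)
  also have "real (card (half_edges G (E G - P) v)) = real (deg G v) - real (degP G P v)"
    using degP_Diff[OF finite_E P_subset, of G v] finite_E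
    by (simp add: deg_def degP_eq_card_half_edges)
  also have "\<dots> = of_int (canon \<Gamma> p - 2 * TP \<Gamma> P p)"
  proof -
    have "2 * (int (degP G P v) div 2) = int (degP G P v)" using even by simp
    then show ?thesis using v by (simp add: Vt canon_def TP_def)
  qed
  finally show ?thesis .
next
  case (Ep e t)
  then have e: "e \<in> E G" "0 < t" "t < l e" using p by simp_all
  then have "(e, t, 1) \<in> tangent_vectors \<Gamma>" "(e, t, -1) \<in> tangent_vectors \<Gamma>"
    by (auto simp: tangent_vectors_def tangents_def)
  from this[THEN has_tslope_vertex_dist, THEN tslope_eq, of P] show ?thesis
    using e by (simp add: Ep ordf_eq_sum tangents_at_def canon_def TP_def) (auto simp: tangents_def)
qed

lemma TP_theta_char:
  assumes "cyc G P"
  shows "pic_cls \<Gamma> (TP \<Gamma> P) \<in> theta_chars \<Gamma>"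
proof -
  have "lin_equiv \<Gamma> (canon \<Gamma>) (\<lambda>p. 2 * TP \<Gamma> P p)"
    unfolding lin_equiv_def
    using canon_in_Div double_in_Div[OF TP_in_Div] rational_fun_vertex_dist
      ordf_vertex_dist[OF assms] by metis
  then show ?thesis unfolding theta_chars_def using TP_in_Div lin_equiv_sym by blast
qed

lemma cyc_of_slope_parity:
  assumes P: "P \<subseteq> E G"
    and parity: "slope_parity f P"
    and div: "\<And>v. v \<in> V G \<Longrightarrow> of_int (2 * D (Vt v) - canon \<Gamma> (Vt v)) = ordf \<Gamma> f (Vt v)"
  shows "cyc G P"
  unfolding cyc_def
proof (intro conjI ballI P)
  fix v assume v: "v \<in> V G"
  let ?H = "half_edges G (E G) v" and ?t = "half_edge_tangent \<Gamma>"
  have "\<exists>k::int. tslope \<Gamma> f (?t h) = of_int k \<and> (even k \<longleftrightarrow> fst h \<in> P)" if "h \<in> ?H" for h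
  proof -
    have "?t h \<in> tangent_vectors \<Gamma>"
      using that by (intro half_edge_tangent_in_tangent_vectors) (auto simp: half_edges_def)
    moreover have "fst (?t h) = fst h" by (simp add: half_edge_tangent_def)
    ultimately show ?thesis using parity unfolding slope_parity_def by metis
  qed
  then have "\<forall>h \<in> ?H. \<exists>k::int. tslope \<Gamma> f (?t h) = of_int k \<and> (even k \<longleftrightarrow> fst h \<in> P)" by blast
  from bchoice[OF this] obtain k :: "nat \<times> bool \<Rightarrow> int"
    where k: "\<And>h. h \<in> ?H \<Longrightarrow> tslope \<Gamma> f (?t h) = of_int (k h)" "\<And>h. h \<in> ?H \<Longrightarrow> even (k h) \<longleftrightarrow> fst h \<in> P"
    by blast
  have "of_int (2 * D (Vt v) - canon \<Gamma> (Vt v)) = (of_int (\<Sum>h \<in> ?H. k h) :: real)"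
    unfolding div[OF v] ordf_Vt of_int_sum using k(1) by (intro sum.cong) auto
  then have "2 * D (Vt v) - canon \<Gamma> (Vt v) = (\<Sum>h \<in> ?H. k h)" unfolding of_int_eq_iff .
  then have "(\<Sum>h \<in> ?H. k h) = 2 * (D (Vt v) - int (wt G v) + 1) - int (deg G v)"
    using v by (simp add: canon_def)
  then have "even (\<Sum>h \<in> ?H. k h) \<longleftrightarrow> even (deg G v)" by simp
  moreover have "even (\<Sum>h \<in> ?H. k h) \<longleftrightarrow> even (card {h \<in> ?H. odd (k h)})"
    by (rule even_sum_iff) (rule finite_half_edges[OF finite_E])
  moreover have "{h \<in> ?H. odd (k h)} = half_edges G (E G - P) v"
    using k(2) by (auto simp: half_edges_def)
  ultimately have "even (deg G v) \<longleftrightarrow> even (degP G (E G - P) v)"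
    using finite_E by (simp add: degP_eq_card_half_edges)
  then show "even (degP G P v)"
    using degP_Diff[OF finite_E P, of G v] unfolding deg_def by (metis even_add)
qed

lemma theta_char_TP:
  assumes D: "D \<in> Div \<Gamma>" and theta: "lin_equiv \<Gamma> (\<lambda>p. 2 * D p) (canon \<Gamma>)"
  obtains P where "cyc G P" "lin_equiv \<Gamma> D (TP \<Gamma> P)"
proof -
  obtain f where f: "rational_fun \<Gamma> f"
    and div: "\<And>p. p \<in> pts \<Gamma> \<Longrightarrow> of_int (2 * D p - canon \<Gamma> p) = ordf \<Gamma> f p"
    using theta unfolding lin_equiv_def by blast
  have "\<exists>k. ordf \<Gamma> f (Ep e s) = of_int (2 * k)" if "Ep e s \<in> pts \<Gamma>" for e s
    using div[OF that] by (intro exI[of _ "D (Ep e s)"]) (simp add: canon_def)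
  from slope_parity_exists[OF f this] obtain P where "P \<subseteq> E G" and parity: "slope_parity f P" .
  have P: "cyc G P" using div by (intro cyc_of_slope_parity[OF \<open>P \<subseteq> E G\<close> parity, of D]) auto
  let ?f = "\<lambda>p. 1/2 * f p + 1/2 * vertex_dist P p"
  have "rational_fun \<Gamma> ?f"
    by (rule rational_fun_half_sum[OF f rational_fun_vertex_dist parity slope_parity_vertex_dist])
  moreover have "of_int (D p - TP \<Gamma> P p) = ordf \<Gamma> ?f p" if p: "p \<in> pts \<Gamma>" for p
    unfolding ordf_linear[OF f rational_fun_vertex_dist p] ordf_vertex_dist[OF P p]
      div[OF p, symmetric]
    by (simp add: field_simps)
  ultimately have "lin_equiv \<Gamma> D (TP \<Gamma> P)" unfolding lin_equiv_def using D TP_in_Div by blast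
  then show ?thesis using that P by blast
qed

lemma TP_inj:
  assumes P: "cyc G P" "cyc G P'" and equiv: "lin_equiv \<Gamma> (TP \<Gamma> P) (TP \<Gamma> P')"
  shows "P = P'"
proof -
  obtain f where f: "rational_fun \<Gamma> f"
    and div: "\<And>p. p \<in> pts \<Gamma> \<Longrightarrow> of_int (TP \<Gamma> P p - TP \<Gamma> P' p) = ordf \<Gamma> f p"
    using equiv unfolding lin_equiv_def by blast
  let ?diff = "\<lambda>p. of_int 1 * vertex_dist P p + of_int (-1) * vertex_dist P' p"
  let ?total = "\<lambda>p. of_int 2 * f p + of_int 1 * ?diff p"
  note rational_dist = rational_fun_vertex_dist
  have rational_diff: "rational_fun \<Gamma> ?diff"
    by (rule rational_fun_int_linear[OF rational_dist rational_dist])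
  have rational_total: "rational_fun \<Gamma> ?total" by (rule rational_fun_int_linear[OF f rational_diff])
  have "ordf \<Gamma> ?total p = 0" if p: "p \<in> pts \<Gamma>" for p
    unfolding ordf_linear[OF f rational_diff p] ordf_linear[OF rational_dist rational_dist p]
      ordf_vertex_dist[OF P(1) p] ordf_vertex_dist[OF P(2) p] div[OF p, symmetric]
    by simp
  then have harmonic: "tslope \<Gamma> ?total t = 0" if "t \<in> tangent_vectors \<Gamma>" for t
    using that by (intro harmonic_tslope_eq_0[OF rational_total])
  have "e \<in> P \<longleftrightarrow> e \<in> P'" if e: "e \<in> E G" for e
  proof -
    let ?t = "half_edge_tangent \<Gamma> (e, False)"
    have t: "?t \<in> tangent_vectors \<Gamma>" using half_edge_tangent_in_tangent_vectors e by simp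
    obtain k :: int where k: "tslope \<Gamma> f ?t = of_int k" by (rule rational_fun_tslope[OF f t])
    have "2 * of_int k + (of_bool (e \<notin> P) - of_bool (e \<notin> P')) = (0::real)"
      using harmonic[OF t]
      unfolding tslope_linear[OF f rational_diff t] tslope_linear[OF rational_dist rational_dist t]
        k tslope_vertex_dist_half_edge[OF e] by simp
    then have "of_int (2 * k + of_bool (e \<notin> P) - of_bool (e \<notin> P')) = (0::real)" by simp
    then have "2 * k + of_bool (e \<notin> P) - of_bool (e \<notin> P') = 0" unfolding of_int_eq_0_iff .
    then show ?thesis by (cases "e \<in> P"; cases "e \<in> P'") (simp_all, presburger+)
  qed
  then show ?thesis using P by (auto simp: cyc_def)
qed

end

section \<open>Isomorphisms of tropical curves\<close>

lemma contr_empty_iff: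
  assumes wf: "wf_graph G"
  shows "contr G P G' P' {} \<phi> \<psi> \<longleftrightarrow> bij_betw \<phi> (V G) (V G') \<and> bij_betw \<psi> (E G) (E G') \<and>
     (\<forall>e \<in> E G. endpoints G' (\<psi> e) = \<phi> ` endpoints G e) \<and>
     (\<forall>v \<in> V G. wt G' (\<phi> v) = wt G v) \<and> P' = \<psi> ` P"
proof -
  have "(adj G {})\<^sup>* = Id" by (simp add: adj_def)
  then have inj: "(\<forall>u \<in> V G. \<forall>v \<in> V G. \<phi> u = \<phi> v \<longrightarrow> (u, v) \<in> (adj G {})\<^sup>*) \<longleftrightarrow> inj_on \<phi> (V G)"
    by (simp add: inj_on_def)
  have weight: "(\<forall>w \<in> V G'. int (wt G' w) - 1 = reduced_genus G {} {v \<in> V G. \<phi> v = w})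
      \<longleftrightarrow> (\<forall>v \<in> V G. wt G' (\<phi> v) = wt G v)" if "\<phi> ` V G = V G'" "inj_on \<phi> (V G)"
  proof -
    have "{u \<in> V G. \<phi> u = \<phi> v} = {v}" if "v \<in> V G" for v
      using that \<open>inj_on \<phi> (V G)\<close> by (auto dest: inj_onD)
    then show ?thesis by (simp add: reduced_genus_def flip: that(1))
  qed
  show ?thesis
    unfolding contr_iff[OF wf] inj bij_betw_def[of \<phi>] using weight by auto
qed

lemma tc_iso_iff:
  "tc_iso (G, l) (G', l') \<phi> \<psi> \<sigma> \<longleftrightarrow> bij_betw \<phi> (V G) (V G') \<and> bij_betw \<psi> (E G) (E G') \<and>
     (\<forall>v \<in> V G. wt G' (\<phi> v) = wt G v) \<and> (\<forall>e \<in> E G. l' (\<psi> e) = l e) \<and>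
     (\<forall>e \<in> E G. \<forall>b. origin G' (half_edge_map \<psi> \<sigma> (e, b)) = \<phi> (origin G (e, b)))"
proof -
  have "ends G' (\<psi> e) = (if \<sigma> e then prod.swap else id) (map_prod \<phi> \<phi> (ends G e))
      \<longleftrightarrow> (\<forall>b. origin G' (half_edge_map \<psi> \<sigma> (e, b)) = \<phi> (origin G (e, b)))" for e
    by (cases "ends G e"; cases "ends G' (\<psi> e)")
      (auto simp: origin_def half_edge_map_def all_bool_eq)
  then show ?thesis by (auto simp: tc_iso_def)
qed

lemma contr_empty_iff_tc_iso:
  assumes wf: "wf_graph G"
  shows "contr G P G' P' {} \<phi> \<psi> \<and> (\<forall>e \<in> E G. l' (\<psi> e) = l e) \<longleftrightarrow>
    (\<exists>\<sigma>. tc_iso (G, l) (G', l') \<phi> \<psi> \<sigma>) \<and> P' = \<psi> ` P"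
proof -
  have "(\<forall>e \<in> E G. endpoints G' (\<psi> e) = \<phi> ` endpoints G e)
      \<longleftrightarrow> (\<exists>\<sigma>. \<forall>e \<in> E G. \<forall>b. origin G' (half_edge_map \<psi> \<sigma> (e, b)) = \<phi> (origin G (e, b)))"
    by (simp add: endpoints_image_iff bchoice_iff half_edge_map_def)
  then show ?thesis by (auto simp: contr_empty_iff[OF wf] tc_iso_iff)
qed

lemma tc_iso_refl: "(\<And>e. e \<in> E G \<Longrightarrow> l e = l' e) \<Longrightarrow> tc_iso (G, l) (G, l') id id (\<lambda>_. False)"
  by (simp add: tc_iso_iff half_edge_map_def)

lemma half_edge_map_comp:
  "half_edge_map \<psi>' \<sigma>' (half_edge_map \<psi> \<sigma> h) = half_edge_map (\<psi>' \<circ> \<psi>) (\<lambda>e. \<sigma> e \<noteq> \<sigma>' (\<psi> e)) h"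
  by (cases h) (simp add: half_edge_map_def)

lemma tc_iso_comp:
  assumes "tc_iso \<Gamma> \<Gamma>' \<phi> \<psi> \<sigma>" "tc_iso \<Gamma>' \<Gamma>'' \<phi>' \<psi>' \<sigma>'"
  shows "tc_iso \<Gamma> \<Gamma>'' (\<phi>' \<circ> \<phi>) (\<psi>' \<circ> \<psi>) (\<lambda>e. \<sigma> e \<noteq> \<sigma>' (\<psi> e))"
proof -
  obtain G l G' l' G'' l'' where eq: "\<Gamma> = (G, l)" "\<Gamma>' = (G', l')" "\<Gamma>'' = (G'', l'')"
    by (metis surj_pair)
  note iso = assms(1)[unfolded eq tc_iso_iff] and iso' = assms(2)[unfolded eq tc_iso_iff]
  have vertex: "\<phi> v \<in> V G'" if "v \<in> V G" for v using that iso bij_betw_apply by metis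
  have edge: "\<psi> e \<in> E G'" if "e \<in> E G" for e using that iso bij_betw_apply by metis
  have "origin G'' (half_edge_map \<psi>' \<sigma>' (half_edge_map \<psi> \<sigma> (e, b))) = \<phi>' (\<phi> (origin G (e, b)))"
    if e: "e \<in> E G" for e b
  proof -
    obtain b' where "half_edge_map \<psi> \<sigma> (e, b) = (\<psi> e, b')" by (simp add: half_edge_map_def)
    then show ?thesis using iso iso' edge[OF e] e by metis
  qed
  then show ?thesis
    unfolding eq tc_iso_iff half_edge_map_comp[symmetric]
    using iso iso' vertex edge by (auto intro: bij_betw_trans)
qed

definition theta_class :: "tcurve \<Rightarrow> nat set \<Rightarrow> (tpt \<Rightarrow> int) set" where
  "theta_class \<Gamma> P = pic_cls \<Gamma> (TP \<Gamma> P)"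

definition transport ::
    "tcurve \<Rightarrow> tcurve \<Rightarrow> (tpt \<Rightarrow> tpt) \<Rightarrow> (tpt \<Rightarrow> int) set \<Rightarrow> (tpt \<Rightarrow> int) set" where
  "transport \<Gamma> \<Gamma>' \<alpha> \<theta> = {D' \<in> Div \<Gamma>'. \<exists>D \<in> \<theta>. \<forall>p \<in> pts \<Gamma>. D' (\<alpha> p) = D p}"

lemma tc_pair_rel_iff:
  "((\<Gamma>, \<theta>), (\<Gamma>', \<theta>')) \<in> tc_pair_rel \<longleftrightarrow>
     (\<exists>\<phi> \<psi> \<sigma>. tc_iso \<Gamma> \<Gamma>' \<phi> \<psi> \<sigma> \<and> \<theta>' = transport \<Gamma> \<Gamma>' (ptmap \<Gamma> \<phi> \<psi> \<sigma>) \<theta>)"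
  unfolding tc_pair_rel_def transport_def by blast

locale tc_isomorphism = metric_graph G l for G :: sgraph and l :: "nat \<Rightarrow> real" +
  fixes G' :: sgraph and l' :: "nat \<Rightarrow> real" and \<phi> \<psi> :: "nat \<Rightarrow> nat" and \<sigma> :: "nat \<Rightarrow> bool"
  assumes iso: "tc_iso (G, l) (G', l') \<phi> \<psi> \<sigma>"
begin

abbreviation \<Gamma>' :: tcurve where
  "\<Gamma>' \<equiv> (G', l')"

lemma vertex_bij: "bij_betw \<phi> (V G) (V G')"
  and edge_bij: "bij_betw \<psi> (E G) (E G')"
  and weight_eq: "v \<in> V G \<Longrightarrow> wt G' (\<phi> v) = wt G v"
  and length_eq: "e \<in> E G \<Longrightarrow> l' (\<psi> e) = l e"
  and origin_eq: "e \<in> E G \<Longrightarrow> origin G' (half_edge_map \<psi> \<sigma> (e, b)) = \<phi> (origin G (e, b))"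
  using iso unfolding tc_iso_iff by blast+

lemma edge_inj: "inj_on \<psi> (E G)" and edge_image: "\<psi> ` E G = E G'"
  using edge_bij by (simp_all add: bij_betw_def)

lemma vertex_eq_iff: "u \<in> V G \<Longrightarrow> v \<in> V G \<Longrightarrow> \<phi> u = \<phi> v \<longleftrightarrow> u = v"
  using vertex_bij by (auto simp: bij_betw_def dest: inj_onD)

lemma contraction:
  assumes "P \<subseteq> E G"
  shows "contraction G P G' (\<psi> ` P) {} \<phi> \<psi>"
  using contr_empty_iff_tc_iso[OF wf, of P G' "\<psi> ` P" \<phi> \<psi> l' l] iso wf assms by unfold_locales auto

lemma metric_graph_image: "metric_graph G' l'"
proof
  show "wf_graph G'" using contraction.wf_image[OF contraction] by blast
  fix e' assume "e' \<in> E G'"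
  then obtain e where "e \<in> E G" "e' = \<psi> e" using edge_image by blast
  then show "0 < l' e'" using length_eq length_pos by simp
qed

lemma cyc_image: "cyc G P \<Longrightarrow> cyc G' (\<psi> ` P)"
  using contraction.cyc_image[OF contraction] by (simp add: cyc_def)

lemma degP_image:
  assumes "P \<subseteq> E G" and v: "v \<in> V G"
  shows "degP G' (\<psi> ` P) (\<phi> v) = degP G P v"
proof -
  have "{u \<in> V G. \<phi> u = \<phi> v} = {v}" using vertex_eq_iff v by auto
  then show ?thesis
    using contraction.degP_image[OF contraction[OF assms(1)] assms(1), of "\<phi> v"] by simp
qed

lemma half_edges_at_image:
  assumes "v \<in> V G"
  shows "half_edges G' (E G') (\<phi> v) = half_edge_map \<psi> \<sigma> ` half_edges G (E G) v"
proof -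
  have "half_edges G' (\<psi> ` E G) (\<phi> v)
      = half_edge_map \<psi> \<sigma> ` {h \<in> E G \<times> UNIV. \<phi> (origin G h) = \<phi> v}"
    using origin_eq by (intro half_edges_image) auto
  also have "{h \<in> E G \<times> UNIV. \<phi> (origin G h) = \<phi> v} = half_edges G (E G) v"
    using vertex_eq_iff[OF origin_in_V[OF wf] assms] by (auto simp: half_edges_def)
  finally show ?thesis by (simp add: edge_image)
qed

abbreviation (input) vertex_inv :: "nat \<Rightarrow> nat" where
  "vertex_inv \<equiv> inv_into (V G) \<phi>"

abbreviation (input) edge_inv :: "nat \<Rightarrow> nat" where
  "edge_inv \<equiv> inv_into (E G) \<psi>"

lemma inverse: "tc_isomorphism G' l' G l vertex_inv edge_inv (\<sigma> \<circ> edge_inv)"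
proof -
  interpret image: metric_graph G' l' by (rule metric_graph_image)
  have vertex: "vertex_inv v' \<in> V G" "\<phi> (vertex_inv v') = v'" if "v' \<in> V G'" for v'
    using that vertex_bij by (auto simp: bij_betw_def inv_into_into f_inv_into_f)
  have edge: "edge_inv e' \<in> E G" "\<psi> (edge_inv e') = e'" if "e' \<in> E G'" for e'
    using that edge_image by (auto simp: inv_into_into f_inv_into_f)
  have "origin G (half_edge_map edge_inv (\<sigma> \<circ> edge_inv) (e', b)) = vertex_inv (origin G' (e', b))"
    if e': "e' \<in> E G'" for e' b
  proof -
    let ?h = "half_edge_map edge_inv (\<sigma> \<circ> edge_inv) (e', b)"
    have h: "?h = (edge_inv e', snd ?h)" "half_edge_map \<psi> \<sigma> ?h = (e', b)"
      using edge(2)[OF e'] by (auto simp: half_edge_map_def)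
    then have "origin G' (e', b) = \<phi> (origin G ?h)" using origin_eq[OF edge(1)[OF e']] by metis
    moreover have "origin G ?h \<in> V G" using h(1) origin_in_V[OF wf edge(1)[OF e']] by metis
    ultimately show ?thesis using vertex_bij by (simp add: bij_betw_def)
  qed
  then show ?thesis
    using vertex edge weight_eq[OF vertex(1)] length_eq[OF edge(1)]
    by unfold_locales (auto simp: tc_iso_iff bij_betw_inv_into vertex_bij edge_bij)
qed

definition tangent_map :: "nat \<times> real \<times> real \<Rightarrow> nat \<times> real \<times> real" where
  "tangent_map = (\<lambda>(e, s, \<tau>). (\<psi> e, if \<sigma> e then l e - s else s, if \<sigma> e then - \<tau> else \<tau>))"

abbreviation point_map :: "tpt \<Rightarrow> tpt" where
  "point_map \<equiv> ptmap \<Gamma> \<phi> \<psi> \<sigma>"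

lemma point_map_in_pts: "p \<in> pts \<Gamma> \<Longrightarrow> point_map p \<in> pts \<Gamma>'"
  using bij_betw_apply[OF vertex_bij] bij_betw_apply[OF edge_bij] length_eq
  by (cases p) (auto simp: ptmap_def)

lemma point_map_inverse:
  assumes "p \<in> pts \<Gamma>"
  shows "ptmap \<Gamma>' vertex_inv edge_inv (\<sigma> \<circ> edge_inv) (point_map p) = p"
  using assms vertex_bij edge_bij length_eq by (cases p) (auto simp: ptmap_def bij_betw_def)

lemma point_map_surj:
  assumes "q \<in> pts \<Gamma>'"
  shows "\<exists>p \<in> pts \<Gamma>. point_map p = q"
proof (cases q)
  case (Vt v')
  then obtain v where "v \<in> V G" "v' = \<phi> v" using assms vertex_bij by (auto simp: bij_betw_def)
  then show ?thesis using Vt by (intro bexI[of _ "Vt v"]) (auto simp: ptmap_def)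
next
  case (Ep e' t)
  then obtain e where "e \<in> E G" "e' = \<psi> e" using assms edge_bij by (auto simp: bij_betw_def)
  then show ?thesis
    using assms Ep length_eq
    by (intro bexI[of _ "Ep e (if \<sigma> e then l e - t else t)"]) (auto simp: ptmap_def)
qed

lemma tangent_map_in_tangent_vectors:
  assumes "d \<in> tangent_vectors \<Gamma>"
  shows "tangent_map d \<in> tangent_vectors \<Gamma>'"
  using assms bij_betw_apply[OF edge_bij] length_eq tangents_reflect
  by (auto simp: tangent_vectors_def tangent_map_def)

lemma inj_tangent_map: "inj_on tangent_map (tangent_vectors \<Gamma>)"
  using edge_bij
  by (auto simp: inj_on_def bij_betw_def tangent_map_def tangent_vectors_def split: if_splits)

lemma tangents_at_image:
  assumes p: "p \<in> pts \<Gamma>"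
  shows "tangents_at \<Gamma>' (point_map p) = tangent_map ` tangents_at \<Gamma> p"
proof (cases p)
  case (Vt v)
  then have v: "v \<in> V G" using p by simp
  have "half_edge_tangent \<Gamma>' (half_edge_map \<psi> \<sigma> h) = tangent_map (half_edge_tangent \<Gamma> h)"
    if "fst h \<in> E G" for h
    using length_eq[OF that]
    by (cases h) (simp add: half_edge_tangent_def half_edge_map_def tangent_map_def)
  then have "(half_edge_tangent \<Gamma>' \<circ> half_edge_map \<psi> \<sigma>) ` half_edges G (E G) v
      = (tangent_map \<circ> half_edge_tangent \<Gamma>) ` half_edges G (E G) v"
    by (intro image_cong) (auto simp: half_edges_def)
  then show ?thesis
    by (simp add: Vt ptmap_def tangents_at_def half_edges_at_image[OF v] image_comp)
next
  case (Ep e t)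
  then show ?thesis by (auto simp: ptmap_def tangents_at_def tangent_map_def)
qed

lemma fedge_point_map:
  assumes e: "e \<in> E G"
  shows "fedge \<Gamma> (f \<circ> point_map) e = (\<lambda>t. fedge \<Gamma>' f (\<psi> e) (if \<sigma> e then l e - t else t))"
proof
  fix t
  show "fedge \<Gamma> (f \<circ> point_map) e t = fedge \<Gamma>' f (\<psi> e) (if \<sigma> e then l e - t else t)"
    using length_pos[OF e] length_eq[OF e] origin_eq[OF e, of False] origin_eq[OF e, of True]
    by (cases "\<sigma> e") (auto simp: fedge_def ptmap_def origin_def half_edge_map_def)
qed

lemma tslope_point_map:
  assumes "d \<in> tangent_vectors \<Gamma>"
  shows "tslope \<Gamma> (f \<circ> point_map) d = tslope \<Gamma>' f (tangent_map d)"
proof -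
  obtain e s \<tau> where "d = (e, s, \<tau>)" "e \<in> E G" using assms by (auto simp: tangent_vectors_def)
  then show ?thesis
    by (cases "\<sigma> e") (simp_all add: tslope_def tangent_map_def fedge_point_map slope_reflect)
qed

lemma has_tslope_point_map:
  assumes "d \<in> tangent_vectors \<Gamma>"
  shows "has_tslope \<Gamma> (f \<circ> point_map) d m \<longleftrightarrow> has_tslope \<Gamma>' f (tangent_map d) m"
proof -
  obtain e s \<tau> where "d = (e, s, \<tau>)" "e \<in> E G" using assms by (auto simp: tangent_vectors_def)
  then show ?thesis
    by (cases "\<sigma> e")
      (simp_all add: has_tslope_def tangent_map_def fedge_point_map has_slope_reflect)
qed

lemma rational_fun_point_map:
  assumes "rational_fun \<Gamma>' f"
  shows "rational_fun \<Gamma> (f \<circ> point_map)"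
  unfolding rational_fun_iff
proof
  interpret image: metric_graph G' l' by (rule metric_graph_image)
  fix d assume d: "d \<in> tangent_vectors \<Gamma>"
  then obtain k :: int where "has_tslope \<Gamma>' f (tangent_map d) (of_int k)"
    using assms tangent_map_in_tangent_vectors unfolding image.rational_fun_iff by blast
  then show "\<exists>k::int. has_tslope \<Gamma> (f \<circ> point_map) d (of_int k)"
    using has_tslope_point_map[OF d] by blast
qed

lemma ordf_point_map:
  assumes p: "p \<in> pts \<Gamma>"
  shows "ordf \<Gamma> (f \<circ> point_map) p = ordf \<Gamma>' f (point_map p)"
proof -
  interpret image: metric_graph G' l' by (rule metric_graph_image)
  note sub = tangents_at_subset[OF p]
  have "ordf \<Gamma> (f \<circ> point_map) p = (\<Sum>d \<in> tangents_at \<Gamma> p. tslope \<Gamma>' f (tangent_map d))"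
    unfolding ordf_eq_sum using sub tslope_point_map by (intro sum.cong) auto
  also have "\<dots> = (\<Sum>d' \<in> tangent_map ` tangents_at \<Gamma> p. tslope \<Gamma>' f d')"
    by (simp add: sum.reindex[OF inj_on_subset[OF inj_tangent_map sub]])
  also have "\<dots> = ordf \<Gamma>' f (point_map p)"
    by (simp add: image.ordf_eq_sum tangents_at_image[OF p])
  finally show ?thesis .
qed

lemma lin_equiv_pullback:
  assumes "lin_equiv \<Gamma>' C' D'" "C \<in> Div \<Gamma>" "D \<in> Div \<Gamma>"
    and C: "\<And>p. p \<in> pts \<Gamma> \<Longrightarrow> C p = C' (point_map p)" and D: "\<And>p. p \<in> pts \<Gamma> \<Longrightarrow> D p = D' (point_map p)"
  shows "lin_equiv \<Gamma> C D"
proof -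
  obtain f where f: "rational_fun \<Gamma>' f" "\<forall>q \<in> pts \<Gamma>'. of_int (C' q - D' q) = ordf \<Gamma>' f q"
    using assms(1) unfolding lin_equiv_def by blast
  have "of_int (C p - D p) = ordf \<Gamma> (f \<circ> point_map) p" if p: "p \<in> pts \<Gamma>" for p
    using f(2) point_map_in_pts[OF p] by (simp add: ordf_point_map[OF p] C[OF p] D[OF p])
  then show ?thesis
    unfolding lin_equiv_def using assms(2,3) rational_fun_point_map[OF f(1)] by blast
qed

lemma pullback_in_Div:
  assumes "D' \<in> Div \<Gamma>'"
  shows "(\<lambda>p. if p \<in> pts \<Gamma> then D' (point_map p) else 0) \<in> Div \<Gamma>" (is "?D \<in> _")
proof -
  have "inj_on point_map (pts \<Gamma>)" using point_map_inverse by (rule inj_on_inverseI)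
  then have "inj_on point_map {p. ?D p \<noteq> 0}" by (rule inj_on_subset) auto
  moreover have "point_map ` {p. ?D p \<noteq> 0} \<subseteq> {q. D' q \<noteq> 0}" by auto
  ultimately have "finite {p. ?D p \<noteq> 0}" by (rule inj_on_finite) (use assms in \<open>simp add: Div_def\<close>)
  then show ?thesis by (auto simp: Div_def)
qed

lemma transport_pic_cls:
  assumes D: "D \<in> Div \<Gamma>" "D' \<in> Div \<Gamma>'" "\<And>p. p \<in> pts \<Gamma> \<Longrightarrow> D' (point_map p) = D p"
  shows "transport \<Gamma> \<Gamma>' point_map (pic_cls \<Gamma> D) = pic_cls \<Gamma>' D'"
proof (intro equalityI subsetI)
  interpret inverse: tc_isomorphism G' l' G l vertex_inv edge_inv "\<sigma> \<circ> edge_inv"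
    by (rule inverse)
  fix C' assume "C' \<in> transport \<Gamma> \<Gamma>' point_map (pic_cls \<Gamma> D)"
  then obtain C where C': "C' \<in> Div \<Gamma>'"
    and C: "lin_equiv \<Gamma> C D" "\<forall>p \<in> pts \<Gamma>. C' (point_map p) = C p"
    by (auto simp: transport_def pic_cls_def)
  have "lin_equiv \<Gamma>' C' D'"
  proof (rule inverse.lin_equiv_pullback[OF C(1) C' D(2)])
    fix q assume "q \<in> pts \<Gamma>'"
    then obtain p where "p \<in> pts \<Gamma>" "q = point_map p" using point_map_surj by blast
    then show "C' q = C (inverse.point_map q)" "D' q = D (inverse.point_map q)"
      using C(2) D(3) point_map_inverse by simp_all
  qed
  then show "C' \<in> pic_cls \<Gamma>' D'" by (simp add: pic_cls_def)
next
  fix C' assume C': "C' \<in> pic_cls \<Gamma>' D'"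
  then have "C' \<in> Div \<Gamma>'" by (simp add: pic_cls_def lin_equiv_def)
  let ?C = "\<lambda>p. if p \<in> pts \<Gamma> then C' (point_map p) else 0"
  have "lin_equiv \<Gamma> ?C D"
    using lin_equiv_pullback[of C' D' ?C D] C' pullback_in_Div[OF \<open>C' \<in> Div \<Gamma>'\<close>] D
    by (simp add: pic_cls_def)
  then show "C' \<in> transport \<Gamma> \<Gamma>' point_map (pic_cls \<Gamma> D)"
    using \<open>C' \<in> Div \<Gamma>'\<close> by (auto simp: transport_def pic_cls_def intro!: bexI[of _ ?C])
qed

lemma TP_point_map:
  assumes P: "P \<subseteq> E G" and p: "p \<in> pts \<Gamma>"
  shows "TP \<Gamma>' (\<psi> ` P) (point_map p) = TP \<Gamma> P p"
proof (cases p)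
  case (Vt v)
  then have "v \<in> V G" "\<phi> v \<in> V G'" using p bij_betw_apply[OF vertex_bij] by auto
  then show ?thesis by (simp add: Vt TP_def ptmap_def degP_image[OF P] weight_eq)
next
  case (Ep e t)
  then have e: "e \<in> E G" using p by simp
  have "\<psi> e \<in> E G' - \<psi> ` P \<longleftrightarrow> e \<in> E G - P"
    using e P edge_bij unfolding bij_betw_def inj_on_def by blast
  then show ?thesis using length_eq[OF e] by (auto simp: Ep TP_def ptmap_def)
qed

lemma transport_theta_class:
  assumes "P \<subseteq> E G"
  shows "transport \<Gamma> \<Gamma>' point_map (theta_class \<Gamma> P) = theta_class \<Gamma>' (\<psi> ` P)"
proof -
  interpret image: metric_graph G' l' by (rule metric_graph_image)
  show ?thesis
    unfolding theta_class_def
    by (intro transport_pic_cls TP_in_Div image.TP_in_Div TP_point_map assms)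
qed

end

section \<open>The points of the cone complex\<close>

definition theta_pair_class :: "tcurve \<Rightarrow> nat set \<Rightarrow> (tcurve \<times> (tpt \<Rightarrow> int) set) set" where
  "theta_pair_class \<Gamma> P = tc_pair_rel `` {(\<Gamma>, theta_class \<Gamma> P)}"

lemma (in metric_graph) in_theta_pair_class_iff:
  assumes "P \<subseteq> E G"
  shows "(\<Gamma>', \<theta>') \<in> theta_pair_class \<Gamma> P \<longleftrightarrow>
    (\<exists>\<phi> \<psi> \<sigma>. tc_iso \<Gamma> \<Gamma>' \<phi> \<psi> \<sigma> \<and> \<theta>' = theta_class \<Gamma>' (\<psi> ` P))"
proof -
  have "transport \<Gamma> \<Gamma>' (ptmap \<Gamma> \<phi> \<psi> \<sigma>) (theta_class \<Gamma> P) = theta_class \<Gamma>' (\<psi> ` P)"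
    if iso: "tc_iso \<Gamma> \<Gamma>' \<phi> \<psi> \<sigma>" for \<phi> \<psi> \<sigma>
  proof -
    obtain G' l' where \<Gamma>': "\<Gamma>' = (G', l')" by (cases \<Gamma>')
    interpret tc_isomorphism G l G' l' \<phi> \<psi> \<sigma> by unfold_locales (use iso \<Gamma>' in simp)
    show ?thesis using transport_theta_class[OF assms] by (simp add: \<Gamma>')
  qed
  then show ?thesis by (simp add: theta_pair_class_def tc_pair_rel_iff cong: conj_cong)
qed

lemma (in metric_graph) in_theta_pair_class_self:
  assumes "P \<subseteq> E G"
  shows "(\<Gamma>, theta_class \<Gamma> P) \<in> theta_pair_class \<Gamma> P"
proof -
  have "tc_iso \<Gamma> \<Gamma> id id (\<lambda>_. False)" by (rule tc_iso_refl) simp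
  then show ?thesis unfolding in_theta_pair_class_iff[OF assms] by (metis image_id id_apply)
qed

context tc_isomorphism
begin

lemma theta_pair_class_subset:
  assumes P: "P \<subseteq> E G"
  shows "theta_pair_class \<Gamma>' (\<psi> ` P) \<subseteq> theta_pair_class \<Gamma> P"
proof
  interpret image: metric_graph G' l' by (rule metric_graph_image)
  fix z assume z: "z \<in> theta_pair_class \<Gamma>' (\<psi> ` P)"
  obtain \<Gamma>'' \<theta>'' where eq: "z = (\<Gamma>'', \<theta>'')" by (cases z)
  have P': "\<psi> ` P \<subseteq> E G'" using P edge_image by blast
  obtain \<phi>' \<psi>' \<sigma>'
    where iso': "tc_iso \<Gamma>' \<Gamma>'' \<phi>' \<psi>' \<sigma>'" and "\<theta>'' = theta_class \<Gamma>'' (\<psi>' ` \<psi> ` P)"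
    using z unfolding eq image.in_theta_pair_class_iff[OF P'] by blast
  then show "z \<in> theta_pair_class \<Gamma> P"
    unfolding eq in_theta_pair_class_iff[OF P] image_comp using tc_iso_comp[OF iso iso'] by blast
qed

lemma theta_pair_class_eq:
  assumes P: "P \<subseteq> E G"
  shows "theta_pair_class \<Gamma>' (\<psi> ` P) = theta_pair_class \<Gamma> P"
proof
  interpret inverse: tc_isomorphism G' l' G l vertex_inv edge_inv "\<sigma> \<circ> edge_inv"
    by (rule inverse)
  have "\<psi> ` P \<subseteq> E G'" "edge_inv ` \<psi> ` P = P"
    using P edge_bij by (auto simp: bij_betw_def inv_into_image_cancel)
  then show "theta_pair_class \<Gamma> P \<subseteq> theta_pair_class \<Gamma>' (\<psi> ` P)"
    using inverse.theta_pair_class_subset[of "\<psi> ` P"] by simp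
qed (rule theta_pair_class_subset[OF P])

end

lemma theta_pair_class_eq_iff:
  assumes "metric_graph G l" "metric_graph G' l'" and P: "cyc G P" "cyc G' P'"
  shows "theta_pair_class (G, l) P = theta_pair_class (G', l') P' \<longleftrightarrow>
    (\<exists>\<phi> \<psi> \<sigma>. tc_iso (G, l) (G', l') \<phi> \<psi> \<sigma> \<and> P' = \<psi> ` P)" (is "?L \<longleftrightarrow> ?R")
proof -
  interpret \<Gamma>: metric_graph G l by (rule assms(1))
  interpret \<Gamma>': metric_graph G' l' by (rule assms(2))
  have P_subset: "P \<subseteq> E G" "P' \<subseteq> E G'" using P by (simp_all add: cyc_def)
  show ?thesis
  proof
    assume ?L
    then have "((G', l'), theta_class (G', l') P') \<in> theta_pair_class (G, l) P"
      using \<Gamma>'.in_theta_pair_class_self[OF P_subset(2)] by simp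
    then obtain \<phi> \<psi> \<sigma> where iso: "tc_iso (G, l) (G', l') \<phi> \<psi> \<sigma>"
      and class_eq: "theta_class (G', l') P' = theta_class (G', l') (\<psi> ` P)"
      unfolding \<Gamma>.in_theta_pair_class_iff[OF P_subset(1)] by blast
    interpret tc_isomorphism G l G' l' \<phi> \<psi> \<sigma> by unfold_locales (rule iso)
    have "lin_equiv (G', l') (TP (G', l') P') (TP (G', l') (\<psi> ` P))"
      using class_eq \<Gamma>'.pic_cls_eq_iff[OF \<Gamma>'.TP_in_Div] by (simp add: theta_class_def)
    then have "P' = \<psi> ` P" by (rule \<Gamma>'.TP_inj[OF P(2) cyc_image[OF P(1)]])
    then show ?R using iso by blast
  next
    assume ?R
    then obtain \<phi> \<psi> \<sigma> where iso: "tc_iso (G, l) (G', l') \<phi> \<psi> \<sigma>" and P': "P' = \<psi> ` P" by blast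
    interpret tc_isomorphism G l G' l' \<phi> \<psi> \<sigma> by unfold_locales (rule iso)
    show ?L using theta_pair_class_eq[OF P_subset(1)] P' by simp
  qed
qed

definition interior_points :: "nat \<Rightarrow> cpt set" where
  "interior_points g = {((G, P), x). (G, P) \<in> Obj g \<and> x \<in> cone_int G}"

definition point_class :: "cpt \<Rightarrow> (tcurve \<times> (tpt \<Rightarrow> int) set) set" where
  "point_class = (\<lambda>((G, P), x). theta_pair_class (G, x) P)"

lemma metric_graph_of_interior:
  assumes "(G, P) \<in> Obj g" "x \<in> cone_int G"
  shows "metric_graph G x"
  using ObjD(1)[OF assms(1)] assms(2) by unfold_locales (auto simp: cone_int_def)

lemma cls_image_interior_points: "cls g ` interior_points g = Tg g"
  unfolding Tg_eq_strata strat_eq_image interior_points_def by force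

lemma point_class_image_subset: "point_class ` interior_points g \<subseteq> TC g"
proof
  fix c assume "c \<in> point_class ` interior_points g"
  then obtain G P x where obj: "(G, P) \<in> Obj g" "x \<in> cone_int G"
    and c_eq: "c = theta_pair_class (G, x) P"
    by (auto simp: interior_points_def point_class_def)
  interpret metric_graph G x by (rule metric_graph_of_interior[OF obj])
  have "trop_curve g (G, x)" using obj by (auto simp: trop_curve_def cone_int_def Obj_def)
  then show "c \<in> TC g"
    unfolding TC_def c_eq theta_pair_class_def
    using TP_theta_char[OF ObjD(5)[OF obj(1)]] by (intro quotientI) (simp add: theta_class_def)
qed

lemma TC_subset_point_class_image: "TC g \<subseteq> point_class ` interior_points g"
proof
  fix c assume "c \<in> TC g"
  then obtain G l \<theta> where curve: "trop_curve g (G, l)" and theta: "\<theta> \<in> theta_chars (G, l)"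
    and c_eq: "c = tc_pair_rel `` {((G, l), \<theta>)}"
    unfolding TC_def by (auto elim!: quotientE)
  interpret metric_graph G l
    using curve by unfold_locales (auto simp: trop_curve_def stable_graph_iff)
  obtain D
    where D: "\<theta> = pic_cls (G, l) D" "D \<in> Div (G, l)" "lin_equiv (G, l) (\<lambda>p. 2 * D p) (canon (G, l))"
    using theta unfolding theta_chars_def by blast
  obtain P where P: "cyc G P" "lin_equiv (G, l) D (TP (G, l) P)" by (rule theta_char_TP[OF D(2,3)])
  have \<theta>: "\<theta> = theta_class (G, l) P"
    using D(1) P(2) pic_cls_eq_iff[OF D(2)] by (simp add: theta_class_def)
  define x where "x e = (if e \<in> E G then l e else 0)" for e
  interpret tc_isomorphism G l G x id id "\<lambda>_. False"
    by unfold_locales (rule tc_iso_refl, simp add: x_def)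
  have "P \<subseteq> E G" using P(1) by (simp add: cyc_def)
  then have "c = point_class ((G, P), x)"
    using theta_pair_class_eq[of P] by (simp add: c_eq \<theta> point_class_def theta_pair_class_def)
  moreover have "((G, P), x) \<in> interior_points g"
    using curve P(1) by (auto simp: interior_points_def Obj_def trop_curve_def cone_int_def x_def)
  ultimately show "c \<in> point_class ` interior_points g" by blast
qed

lemma cls_eq_iff_point_class_eq:
  assumes "n \<in> interior_points g" "n' \<in> interior_points g"
  shows "cls g n = cls g n' \<longleftrightarrow> point_class n = point_class n'"
proof -
  obtain G P x G' P' x' where eq: "n = ((G, P), x)" "n' = ((G', P'), x')"
    and obj: "(G, P) \<in> Obj g" "(G', P') \<in> Obj g" and x: "x \<in> cone_int G" "x' \<in> cone_int G'"
    using assms by (auto simp: interior_points_def)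
  interpret metric_graph G x by (rule metric_graph_of_interior[OF obj(1) x(1)])
  have "x = iota G {} \<psi> x' \<longleftrightarrow> (\<forall>e \<in> E G. x' (\<psi> e) = x e)" for \<psi>
    using x(1) by (auto simp: iota_def cone_int_def fun_eq_iff)
  then have "cls g n = cls g n' \<longleftrightarrow> (\<exists>\<phi> \<psi>. contr G P G' P' {} \<phi> \<psi> \<and> (\<forall>e \<in> E G. x' (\<psi> e) = x e))"
    unfolding eq cls_eq_iff ceq_interior_iff[OF obj x] by simp
  also have "\<dots> \<longleftrightarrow> (\<exists>\<phi> \<psi> \<sigma>. tc_iso (G, x) (G', x') \<phi> \<psi> \<sigma> \<and> P' = \<psi> ` P)"
    unfolding contr_empty_iff_tc_iso[OF wf] by blast
  also have "\<dots> \<longleftrightarrow> point_class n = point_class n'"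
    using theta_pair_class_eq_iff[OF metric_graph_axioms metric_graph_of_interior[OF obj(2) x(2)]
        ObjD(5)[OF obj(1)] ObjD(5)[OF obj(2)]]
    by (simp add: eq point_class_def)
  finally show ?thesis .
qed

lemma bij_betw_of_common_cover:
  assumes "\<And>n n'. n \<in> N \<Longrightarrow> n' \<in> N \<Longrightarrow> a n = a n' \<longleftrightarrow> b n = b n'"
  shows "\<exists>F. bij_betw F (a ` N) (b ` N) \<and> (\<forall>n \<in> N. F (a n) = b n)"
proof -
  define F where "F = b \<circ> inv_into N a"
  have F: "F (a n) = b n" if "n \<in> N" for n
    using assms[of "inv_into N a (a n)" n] that by (simp add: F_def inv_into_into f_inv_into_f)
  have "inj_on F (a ` N)" by (rule inj_onI) (use F assms in force)
  moreover have "F ` a ` N = b ` N" unfolding image_image using F by (intro image_cong) auto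
  ultimately show ?thesis using F unfolding bij_betw_def by blast
qed

lemma points_bijection:
  "\<exists>F. bij_betw F (Tg g) (TC g) \<and> (\<forall>G P x. (G, P) \<in> Obj g \<longrightarrow> x \<in> cone_int G \<longrightarrow>
     F (cls g ((G, P), x)) = tc_pair_rel `` {((G, x), pic_cls (G, x) (TP (G, x) P))})"
proof -
  obtain F
    where "bij_betw F (Tg g) (TC g)" "\<And>n. n \<in> interior_points g \<Longrightarrow> F (cls g n) = point_class n"
    using bij_betw_of_common_cover[of "interior_points g" "cls g" point_class,
        OF cls_eq_iff_point_class_eq]
      cls_image_interior_points point_class_image_subset TC_subset_point_class_image
    by (metis subset_antisym)
  then show ?thesis
    by (intro exI[of _ F]) (auto simp: interior_points_def point_class_def theta_pair_class_def
        theta_class_def)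
qed

theorem theorem4p1:
  fixes g :: nat
  assumes "g \<ge> 2"
  shows
    \<comment> \<open>(1) points <-> isomorphism classes of (Gamma, theta), naturally\<close>
    "(\<exists>F. bij_betw F (Tg g) (TC g) \<and>
        (\<forall>G P x. (G, P) \<in> Obj g \<longrightarrow> x \<in> cone_int G \<longrightarrow>
           F (cls g ((G, P), x)) = tc_pair_rel `` {((G, x), pic_cls (G, x) (TP (G, x) P))}))
   \<and> \<comment> \<open>(1) stratification over isomorphism classes of pairs (G,P)\<close>
     Tg g = (\<Union>GP \<in> Obj g. strat g (fst GP) (snd GP))
   \<and> (\<forall>GP \<in> Obj g. \<forall>GP' \<in> Obj g.
        (pair_iso GP GP' \<longrightarrow> strat g (fst GP) (snd GP) = strat g (fst GP') (snd GP')) \<and>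
        (\<not> pair_iso GP GP' \<longrightarrow> strat g (fst GP) (snd GP) \<inter> strat g (fst GP') (snd GP') = {}))
   \<and> \<comment> \<open>(2) T_(G,P) = open cone / Aut(G,P)\<close>
     (\<forall>(G, P) \<in> Obj g.
        quotient_map (subtopology euclidean (cone_int G)) (subtopology (Ttop g) (strat g G P))
                     (\<lambda>x. cls g ((G, P), x)) \<and>
        (\<forall>x \<in> cone_int G. \<forall>y \<in> cone_int G.
           cls g ((G, P), x) = cls g ((G, P), y) \<longleftrightarrow>
           (\<exists>\<phi> \<psi>. contr G P G P {} \<phi> \<psi> \<and> y = iota G {} \<psi> x)))
   \<and> \<comment> \<open>(3) connected, pure of dimension 3g-3\<close>
     connected_space (Ttop g)
   \<and> (\<forall>(G, P) \<in> Obj g. card (E G) \<le> 3 * g - 3)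
   \<and> (\<forall>(G, P) \<in> Obj g. \<exists>(G', P') \<in> Obj g. card (E G') = 3 * g - 3 \<and> pair_ge (G', P') (G, P))
   \<and> \<comment> \<open>(4) closure relations\<close>
     (\<forall>(G, P) \<in> Obj g. \<forall>(G', P') \<in> Obj g.
        strat g G' P' \<subseteq> Ttop g closure_of (strat g G P) \<longleftrightarrow> pair_ge (G, P) (G', P'))"
proof (intro conjI points_bijection Tg_eq_strata connected_space_Ttop[OF assms])
  show "\<forall>GP \<in> Obj g. \<forall>GP' \<in> Obj g.
      (pair_iso GP GP' \<longrightarrow> strat g (fst GP) (snd GP) = strat g (fst GP') (snd GP')) \<and>
      (\<not> pair_iso GP GP' \<longrightarrow> strat g (fst GP) (snd GP) \<inter> strat g (fst GP') (snd GP') = {})"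
    using strat_iso strat_disjoint by blast
  show "\<forall>(G, P) \<in> Obj g.
      quotient_map (subtopology euclidean (cone_int G)) (subtopology (Ttop g) (strat g G P))
                   (\<lambda>x. cls g ((G, P), x)) \<and>
      (\<forall>x \<in> cone_int G. \<forall>y \<in> cone_int G.
         cls g ((G, P), x) = cls g ((G, P), y) \<longleftrightarrow>
         (\<exists>\<phi> \<psi>. contr G P G P {} \<phi> \<psi> \<and> y = iota G {} \<psi> x))"
    by (clarsimp simp: quotient_map_strat cls_eq_on_stratum_iff)
  show "\<forall>(G, P) \<in> Obj g. card (E G) \<le> 3 * g - 3" using card_E_le by blast
  show "\<forall>(G, P) \<in> Obj g. \<exists>(G', P') \<in> Obj g. card (E G') = 3 * g - 3 \<and> pair_ge (G', P') (G, P)"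
    using exists_top_dimensional by fastforce
  show "\<forall>(G, P) \<in> Obj g. \<forall>(G', P') \<in> Obj g.
      strat g G' P' \<subseteq> Ttop g closure_of (strat g G P) \<longleftrightarrow> pair_ge (G, P) (G', P')"
    using strat_closure_imp_pair_ge pair_ge_imp_strat_closure by blast
qed

end
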